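(* The quantum group coordinate algebra $\mathbb{C}_F[\mathrm{GL}_4]$ has deformed product \begin{align*} \tau^\mu_\nu\bullet\tau^\alpha_\beta&=\tau^\mu_\nu\tau^\alpha_\beta+\tfrac{\imath}{2}\theta^{\mu\alpha}_{cd}\,\tilde\gamma^c_\nu\tilde\gamma^d_\beta-\tfrac{\imath}{2}\gamma^\mu_c\gamma^\alpha_d\,\theta^{cd}_{\nu\beta}+\tfrac14\theta^{\mu\alpha}_{ab}\,\sigma^a_c\sigma^b_d\,\theta^{cd}_{\nu\beta},\\ \gamma^\mu_\nu\bullet\tau^\alpha_\beta&=\gamma^\mu_\nu\tau^\alpha_\beta+\tfrac{\imath}{2}\theta^{\mu\alpha}_{cd}\,\sigma^c_\nu\tilde\gamma^d_\beta,\qquad \tau^\mu_\nu\bullet\gamma^\alpha_\beta=\tau^\mu_\nu\gamma^\alpha_\beta+\tfrac{\imath}{2}\theta^{\mu\alpha}_{cd}\,\tilde\gamma^c_\nu\sigma^d_\beta,\\ \tilde\gamma^\mu_\nu\bullet\tau^\alpha_\beta&=\tilde\gamma^\mu_\nu\tau^\alpha_\beta-\tfrac{\imath}{2}\sigma^\mu_c\gamma^\alpha_d\,\theta^{cd}_{\nu\beta},\qquad \tau^\mu_\nu\bullet\tilde\gamma^\alpha_\beta=\tau^\mu_\nu\tilde\gamma^\alpha_\beta-\tfrac{\imath}{2}\gamma^\mu_c\sigma^\alpha_d\,\theta^{cd}_{\nu\beta},\\ \gamma^\mu_\nu\bullet\gamma^\alpha_\beta&=\gamma^\mu_\nu\gamma^\alpha_\beta+\tfrac{\imath}{2}\theta^{\mu\alpha}_{cd}\,\sigma^c_\nu\sigma^d_\beta,\qquad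 \tilde\gamma^\mu_\nu\bullet\tilde\gamma^\alpha_\beta=\tilde\gamma^\mu_\nu\tilde\gamma^\alpha_\beta-\tfrac{\imath}{2}\sigma^\mu_c\sigma^\alpha_d\,\theta^{cd}_{\nu\beta}, \end{align*} with the remaining products of generators, the antipode and the coproduct undeformed on the generators. The quantum group is generated by the matrices $\gamma,\tilde\gamma,\tau,\sigma$ of generators with commutation relations \[ [\gamma^\mu_\nu,\gamma^\alpha_\beta]_\bullet=\imath\theta^-{}^{\mu\alpha}_{cd}\sigma^c_\nu\bullet\sigma^d_\beta,\qquad [\tilde\gamma^\mu_\nu,\tilde\gamma^\alpha_\beta]_\bullet=-\imath\sigma^\alpha_d\bullet\sigma^\mu_c\,\theta^-{}^{cd}_{\nu\beta}, \] \[ [\gamma^\mu_\nu,\tau^\alpha_\beta]_\bullet=\imath\theta^-{}^{\mu\alpha}_{cd}\sigma^c_\nu\bullet\tilde\gamma^d_\beta,\qquad [\tilde\gamma^\mu_\nu,\tau^\alpha_\beta]_\bullet=-\imath\gamma^\alpha_d\bullet\sigma^\mu_c\,\theta^-{}^{cd}_{\nu\beta}, \] \[ [\tau^\mu_\nu,\tau^\alpha_\beta]_\bullet=\imath\theta^-{}^{\mu\alpha}_{cd}\tilde\gamma^c_\nu\bullet\tilde\gamma^d_\beta-\imath\gamma^\alpha_d\bullet\gamma^\mu_c\,\theta^-{}^{cd}_{\nu\beta} \] (the remaining commutators of generators being zero as in the classical case) and a certain determinant inverted.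
   Context: $\mathbb{C}[\mathrm{GL}_4]$ is the commutative Hopf algebra with generators $a^\mu_\nu$ ($\mu,\nu=1,\dots,4$; $\mu$ the row index), matrix coproduct $\Delta a^\mu_\nu=a^\mu_\alpha\otimes a^\alpha_\nu$, counit $\epsilon(a^\mu_\nu)=\delta^\mu_\nu$, and the determinant inverted. The matrix $a$ is written in $2\times2$ blocks $a=\begin{pmatrix}\gamma&\tau\\\sigma&\tilde\gamma\end{pmatrix}$, entries keeping their $\mathrm{GL}_4$ index values: $\gamma^\mu_\nu$ has $\mu,\nu\in\{1,2\}$; $\tau^\mu_\nu$ has $\mu\in\{1,2\},\nu\in\{3,4\}$; $\sigma^\mu_\nu$ has $\mu\in\{3,4\},\nu\in\{1,2\}$; $\tilde\gamma^\mu_\nu$ has $\mu,\nu\in\{3,4\}$. Repeated indices are summed. Let $\theta^{AB}_{A'B'}$ ($A,B\in\{1,2\}$, $A',B'\in\{3,4\}$) be complex parameters; extend to $\theta^{\mu\alpha}_{\nu\beta}$, set to zero unless $\mu,\alpha\in\{1,2\}$ and $\nu,\beta\in\{3,4\}$. Put $\theta^-{}^{\mu\alpha}_{\nu\beta}=\frac12(\theta^{\mu\alpha}_{\nu\beta}-\theta^{\alpha\mu}_{\beta\nu})$. Let $\mathbb{C}[\mathbb{C}^4]$ be the polynomial Hopf algebra on generators $t^A_{A'}$ with additive coproduct, and let $\partial^{A'}_A$ be the dual translation generators, acting by differentiation and evaluation at zero, $\langle\partial^{A'}_A,t^B_{B'}\rangle=\delta^{A'}_{B'}\delta^B_A$.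 The 2-cocycle $F(h,g)=\langle\exp(\frac{\imath}{2}\theta^{AB}_{A'B'}\partial^{A'}_A\otimes\partial^{B'}_B),h\otimes g\rangle$ on $\mathbb{C}[\mathbb{C}^4]$ is pulled back to $\mathbb{C}[\mathrm{GL}_4]$ along the Hopf algebra map $\gamma\mapsto 1,\ \tilde\gamma\mapsto1,\ \sigma\mapsto0,\ \tau^A_{A'}\mapsto t^A_{A'}$; on generators $F(a^\mu_\nu,a^\alpha_\beta)=\delta^\mu_\nu\delta^\alpha_\beta+\frac{\imath}{2}\theta^{\mu\alpha}_{\nu\beta}$. $\mathbb{C}_F[\mathrm{GL}_4]$ is the cotwisted Hopf algebra: the same coalgebra as $\mathbb{C}[\mathrm{GL}_4]$, with product (Sweedler notation) $h\bullet g=F(h_{(1)},g_{(1)})\,h_{(2)}g_{(2)}\,F^{-1}(h_{(3)},g_{(3)})$ ($F^{-1}$ the convolution inverse) and antipode $S_F(h)=U(h_{(1)})\,Sh_{(2)}\,U^{-1}(h_{(3)})$, $U(h)=F(h_{(1)},Sh_{(2)})$. Products without $\bullet$ are in the original commutative algebra, and $[h,g]_\bullet=h\bullet g-g\bullet h$. *)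

theory Defs
  imports "HOL-Analysis.Analysis" "HOL-Library.Poly_Mapping"
begin

section \<open>Complex algebras\<close>

class complex_algebra = ring_1 +
  fixes scaleC :: "complex \<Rightarrow> 'a \<Rightarrow> 'a" (infixr "*\<^sub>C" 75)
  assumes scaleC_add_right: "c *\<^sub>C (x + y) = c *\<^sub>C x + c *\<^sub>C y"
    and scaleC_add_left: "(c + d) *\<^sub>C x = c *\<^sub>C x + d *\<^sub>C x"
    and scaleC_scaleC: "c *\<^sub>C (d *\<^sub>C x) = (c * d) *\<^sub>C x"
    and scaleC_one: "1 *\<^sub>C x = x"
    and mult_scaleC_left: "(c *\<^sub>C x) * y = c *\<^sub>C (x * y)"
    and mult_scaleC_right: "x * (c *\<^sub>C y) = c *\<^sub>C (x * y)"

class comm_complex_algebra = complex_algebra + comm_ring_1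

instantiation complex :: comm_complex_algebra
begin

definition scaleC_complex :: "complex \<Rightarrow> complex \<Rightarrow> complex"
  where "scaleC_complex c x = c * x"

instance
  by standard (simp_all add: scaleC_complex_def algebra_simps)

end

lemma poly_mapping_single_induct [case_names zero single add]:
  fixes p :: "'m \<Rightarrow>\<^sub>0 'b::comm_monoid_add"
  assumes "P 0" "\<And>k v. P (Poly_Mapping.single k v)" "\<And>p q. P p \<Longrightarrow> P q \<Longrightarrow> P (p + q)"
  shows "P p"
proof (induction p rule: update_induct)
  case (update f a b)
  have "Poly_Mapping.update a b f = f + Poly_Mapping.single a b"
    using update.hyps(1)
    by (intro poly_mapping_eqI)
      (auto simp: lookup_update lookup_add lookup_single when_def in_keys_iff)
  then show ?case
    using update.IH assms by simp
qed (rule assms)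

text \<open>Monoid algebras \<^typ>\<open>'m \<Rightarrow>\<^sub>0 complex\<close>; the monoid is written additively.\<close>

instantiation poly_mapping :: (monoid_add, complex_algebra) complex_algebra
begin

definition scaleC_poly_mapping :: "complex \<Rightarrow> ('a \<Rightarrow>\<^sub>0 'b) \<Rightarrow> ('a \<Rightarrow>\<^sub>0 'b)"
  where "scaleC_poly_mapping c p = Poly_Mapping.single 0 (c *\<^sub>C 1) * p"

instance
proof
  fix c d :: complex and x y :: "'a \<Rightarrow>\<^sub>0 'b"
  have one_l: "(c *\<^sub>C 1) * z = c *\<^sub>C z" and one_r: "z * (c *\<^sub>C 1) = c *\<^sub>C z" for c and z :: 'b
    by (simp_all add: mult_scaleC_left mult_scaleC_right)
  have "Poly_Mapping.single 0 (c *\<^sub>C (1::'b)) * z = z * Poly_Mapping.single 0 (c *\<^sub>C 1)"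
    for c and z :: "'a \<Rightarrow>\<^sub>0 'b"
  proof (induction z rule: poly_mapping_single_induct)
    case (single k v)
    then show ?case by (simp add: mult_single one_l one_r)
  qed (simp_all add: distrib_left distrib_right)
  note comm = this
  show "c *\<^sub>C (x + y) = c *\<^sub>C x + c *\<^sub>C y"
    by (simp add: scaleC_poly_mapping_def distrib_left)
  show "(c + d) *\<^sub>C x = c *\<^sub>C x + d *\<^sub>C x"
    by (simp add: scaleC_poly_mapping_def scaleC_add_left single_add distrib_right)
  show "c *\<^sub>C (d *\<^sub>C x) = (c * d) *\<^sub>C x"
    by (simp add: scaleC_poly_mapping_def mult.assoc[symmetric] mult_single one_l scaleC_scaleC)
  show "1 *\<^sub>C x = x"
    by (simp add: scaleC_poly_mapping_def scaleC_one)
  show "(c *\<^sub>C x) * y = c *\<^sub>C (x * y)"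
    by (simp add: scaleC_poly_mapping_def mult.assoc)
  show "x * (c *\<^sub>C y) = c *\<^sub>C (x * y)"
    unfolding scaleC_poly_mapping_def by (metis comm mult.assoc)
qed

end

instance poly_mapping :: (comm_monoid_add, comm_complex_algebra) comm_complex_algebra ..

definition linear_extension ::
  "('m \<Rightarrow> 'c::complex_algebra) \<Rightarrow> ('m \<Rightarrow>\<^sub>0 complex) \<Rightarrow> 'c"
  where "linear_extension g p = (\<Sum>m\<in>Poly_Mapping.keys p. Poly_Mapping.lookup p m *\<^sub>C g m)"

lemma scaleC_zero_left [simp]: "0 *\<^sub>C (x::'a::complex_algebra) = 0"
  using scaleC_add_left[of 0 0 x] by simp

lemma scaleC_zero_right [simp]: "c *\<^sub>C (0::'a::complex_algebra) = 0"
  using scaleC_add_right[of c 0 "0::'a"] by simp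

lemma linear_extension_superset:
  assumes "finite A" "Poly_Mapping.keys p \<subseteq> A"
  shows "linear_extension g p = (\<Sum>m\<in>A. Poly_Mapping.lookup p m *\<^sub>C g m)"
  unfolding linear_extension_def
  by (rule sum.mono_neutral_left[OF assms]) (auto simp: in_keys_iff)

lemma linear_extension_zero [simp]: "linear_extension g 0 = 0"
  by (simp add: linear_extension_def)

lemma linear_extension_single [simp]: "linear_extension g (Poly_Mapping.single m c) = c *\<^sub>C g m"
  by (cases "c = 0") (simp_all add: linear_extension_def)

lemma linear_extension_add:
  "linear_extension g (p + q) = linear_extension g p + linear_extension g q"
proof -
  define A where "A = Poly_Mapping.keys p \<union> Poly_Mapping.keys q"
  have "finite A" "Poly_Mapping.keys p \<subseteq> A" "Poly_Mapping.keys q \<subseteq> A"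
    "Poly_Mapping.keys (p + q) \<subseteq> A"
    using Poly_Mapping.keys_add[of p q] by (auto simp: A_def)
  then show ?thesis
    by (simp add: linear_extension_superset[of A] lookup_add scaleC_add_left sum.distrib)
qed

lemma linear_extension_diff:
  "linear_extension g (p - q) = linear_extension g p - linear_extension g q"
  using linear_extension_add[of g "p - q" q] by simp

lemma linear_extension_scaleC:
  fixes p :: "'m::monoid_add \<Rightarrow>\<^sub>0 complex"
  shows "linear_extension g (c *\<^sub>C p) = c *\<^sub>C linear_extension g p"
  by (induction p rule: poly_mapping_single_induct)
    (simp_all add: scaleC_add_right linear_extension_add,
     simp add: scaleC_poly_mapping_def scaleC_complex_def mult_single scaleC_scaleC)

lemma linear_extension_mult:
  fixes g :: "'m::monoid_add \<Rightarrow> 'c::complex_algebra"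
  assumes "\<And>m n. g (m + n) = g m * g n"
  shows "linear_extension g (p * q) = linear_extension g p * linear_extension g q"
proof (induction p rule: poly_mapping_single_induct)
  case (single k v)
  show ?case
    by (induction q rule: poly_mapping_single_induct)
      (simp_all add: distrib_left linear_extension_add mult_single assms mult_scaleC_left
        mult_scaleC_right scaleC_scaleC mult.commute)
qed (simp_all add: distrib_right linear_extension_add)

abbreviation clinear :: "('a::complex_algebra \<Rightarrow> 'b::complex_algebra) \<Rightarrow> bool"
  where "clinear \<equiv> Vector_Spaces.linear (*\<^sub>C) (*\<^sub>C)"

definition cbilinear ::
  "('a::complex_algebra \<Rightarrow> 'b::complex_algebra \<Rightarrow> 'c::complex_algebra) \<Rightarrow> bool"
  where "cbilinear f \<longleftrightarrow> (\<forall>x. clinear (f x)) \<and> (\<forall>y. clinear (\<lambda>x. f x y))"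

inductive_set gen_ideal :: "'a::ring_1 set \<Rightarrow> 'a set" for S where
  zero: "0 \<in> gen_ideal S"
| gen: "s \<in> S \<Longrightarrow> s \<in> gen_ideal S"
| add: "x \<in> gen_ideal S \<Longrightarrow> y \<in> gen_ideal S \<Longrightarrow> x + y \<in> gen_ideal S"
| mult: "x \<in> gen_ideal S \<Longrightarrow> p * x * q \<in> gen_ideal S"

lemma gen_ideal_uminus: "x \<in> gen_ideal S \<Longrightarrow> - x \<in> gen_ideal S"
  using gen_ideal.mult[of x S "-1" 1] by simp

lemma gen_ideal_diff: "x \<in> gen_ideal S \<Longrightarrow> y \<in> gen_ideal S \<Longrightarrow> x - y \<in> gen_ideal S"
  using gen_ideal.add[OF _ gen_ideal_uminus, of x S y] by simp

lemma gen_ideal_equivp: "equivp (\<lambda>x y. x - y \<in> gen_ideal S)"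
proof (rule equivpI)
  show "reflp (\<lambda>x y. x - y \<in> gen_ideal S)"
    by (simp add: reflp_def gen_ideal.zero)
  show "symp (\<lambda>x y. x - y \<in> gen_ideal S)"
    by (metis (mono_tags, lifting) gen_ideal_uminus minus_diff_eq sympI)
  show "transp (\<lambda>x y. x - y \<in> gen_ideal S)"
  proof (rule transpI)
    fix x y z
    assume "x - y \<in> gen_ideal S" "y - z \<in> gen_ideal S"
    then show "x - z \<in> gen_ideal S"
      using gen_ideal.add[of "x - y" S "y - z"] by simp
  qed
qed

lemma gen_ideal_cong_mult:
  assumes "x - x' \<in> gen_ideal S" "y - y' \<in> gen_ideal S"
  shows "x * y - x' * y' \<in> gen_ideal S"
proof -
  have "x * y - x' * y' = 1 * (x - x') * y + x' * (y - y') * 1"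
    by (simp add: algebra_simps)
  then show ?thesis
    using assms gen_ideal.add gen_ideal.mult by metis
qed

lemma gen_ideal_cong_add:
  assumes "x - x' \<in> gen_ideal S" "y - y' \<in> gen_ideal S"
  shows "(x + y) - (x' + y') \<in> gen_ideal S"
  using gen_ideal.add[OF assms] by (simp add: algebra_simps)

lemma gen_ideal_cong_diff:
  assumes "x - x' \<in> gen_ideal S" "y - y' \<in> gen_ideal S"
  shows "(x - y) - (x' - y') \<in> gen_ideal S"
  using gen_ideal_diff[OF assms] by (simp add: algebra_simps)

lemma gen_ideal_cong_uminus:
  assumes "x - x' \<in> gen_ideal S"
  shows "(- x) - (- x') \<in> gen_ideal S"
  using gen_ideal_uminus[OF assms] by (simp add: algebra_simps)

section \<open>Polynomials\<close>

type_synonym 'v cpoly = "('v \<Rightarrow>\<^sub>0 nat) \<Rightarrow>\<^sub>0 complex"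

definition var :: "'v \<Rightarrow> 'v cpoly"
  where "var v = Poly_Mapping.single (Poly_Mapping.single v 1) 1"

definition poly_eval :: "('v \<Rightarrow> 'c::comm_complex_algebra) \<Rightarrow> 'v cpoly \<Rightarrow> 'c"
  where "poly_eval f =
    linear_extension (\<lambda>m. \<Prod>v\<in>Poly_Mapping.keys m. f v ^ Poly_Mapping.lookup m v)"

lemma poly_eval_add: "poly_eval f (p + q) = poly_eval f p + poly_eval f q"
  by (simp add: poly_eval_def linear_extension_add)

lemma poly_eval_mult:
  fixes f :: "'v \<Rightarrow> 'c::comm_complex_algebra"
  shows "poly_eval f (p * q) = poly_eval f p * poly_eval f q"
  unfolding poly_eval_def
proof (rule linear_extension_mult)
  fix m n :: "'v \<Rightarrow>\<^sub>0 nat"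
  let ?A = "Poly_Mapping.keys m \<union> Poly_Mapping.keys n"
  have *: "(\<Prod>v\<in>Poly_Mapping.keys k. f v ^ Poly_Mapping.lookup k v) =
      (\<Prod>v\<in>?A. f v ^ Poly_Mapping.lookup k v)" if "Poly_Mapping.keys k \<subseteq> ?A" for k
    using that by (intro prod.mono_neutral_left) (auto simp: in_keys_iff)
  show "(\<Prod>v\<in>Poly_Mapping.keys (m + n). f v ^ Poly_Mapping.lookup (m + n) v) =
      (\<Prod>v\<in>Poly_Mapping.keys m. f v ^ Poly_Mapping.lookup m v) *
      (\<Prod>v\<in>Poly_Mapping.keys n. f v ^ Poly_Mapping.lookup n v)"
    using *[of m] *[of n] *[of "m + n"] Poly_Mapping.keys_add[of m n]
    by (simp add: lookup_add power_add prod.distrib)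
qed

lemma poly_eval_var [simp]: "poly_eval f (var v) = f v"
  by (simp add: poly_eval_def var_def scaleC_one)

lemma poly_eval_one [simp]: "poly_eval f 1 = 1"
  by (simp add: poly_eval_def scaleC_one flip: single_one)

lemma poly_eval_zero [simp]: "poly_eval f 0 = 0"
  by (simp add: poly_eval_def)

lemma poly_eval_uminus: "poly_eval f (- p) = - poly_eval f p"
  using poly_eval_add[of f p "- p"] by (simp add: eq_neg_iff_add_eq_0 add.commute)

lemma poly_eval_diff: "poly_eval f (p - q) = poly_eval f p - poly_eval f q"
  using poly_eval_add[of f p "- q"] by (simp add: poly_eval_uminus)

lemma poly_eval_sum: "poly_eval f (sum g A) = (\<Sum>x\<in>A. poly_eval f (g x))"
  by (induction A rule: infinite_finite_induct) (simp_all add: poly_eval_add)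

lemma poly_eval_prod: "poly_eval f (prod g A) = (\<Prod>x\<in>A. poly_eval f (g x))"
  by (induction A rule: infinite_finite_induct) (simp_all add: poly_eval_mult)

lemma poly_eval_of_int: "poly_eval f (of_int k) = of_int k"
proof -
  have nat: "poly_eval f (of_nat n) = of_nat n" for n
    by (induction n) (simp_all add: poly_eval_add)
  show ?thesis
    by (cases k) (simp_all add: nat poly_eval_diff poly_eval_uminus poly_eval_add)
qed

lemma poly_eval_det:
  "poly_eval f (det A) = det (\<chi> i j. poly_eval f (A $ i $ j))"
  by (simp add: det_def poly_eval_sum poly_eval_mult poly_eval_prod poly_eval_of_int)

definition partial_deriv :: "'v \<Rightarrow> 'v cpoly \<Rightarrow> 'v cpoly"
  where "partial_deriv v = linear_extension (\<lambda>m.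
    Poly_Mapping.single (m - Poly_Mapping.single v 1) (of_nat (Poly_Mapping.lookup m v)))"

section \<open>Tensor products of commutative algebras\<close>

lemma exists_unital_functional: "\<exists>f :: 'a::complex_algebra \<Rightarrow> complex. clinear f \<and> f 1 = 1"
proof -
  interpret vector_space_pair "(*\<^sub>C) :: complex \<Rightarrow> 'a \<Rightarrow> 'a" "(*\<^sub>C) :: complex \<Rightarrow> complex \<Rightarrow> complex"
    by standard (simp_all add: scaleC_add_left scaleC_add_right scaleC_scaleC scaleC_one)
  have "vs1.independent {1 :: 'a}"
    by simp
  from linear_independent_extend[OF this, of "\<lambda>_. 1"] show ?thesis
    by simp
qed

text \<open>
  The monoid algebra of the multiplicative monoid \<open>A \<times> B\<close> is the free vector space on
  the pairs \<open>(x, y)\<close> with the product \<open>(x, y) (x', y') = (x x', y y')\<close>. The span of the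
  bilinearity relations is an ideal, since multiplying such a relation by a pair yields another
  one; hence the quotient by the ideal they generate is the tensor product.
\<close>

datatype ('a, 'b) pair_key = Pair_Key 'a 'b

instantiation pair_key :: (comm_monoid_mult, comm_monoid_mult) comm_monoid_add
begin

definition zero_pair_key :: "('a, 'b) pair_key"
  where "zero_pair_key = Pair_Key 1 1"

fun plus_pair_key :: "('a, 'b) pair_key \<Rightarrow> ('a, 'b) pair_key \<Rightarrow> ('a, 'b) pair_key"
  where "plus_pair_key (Pair_Key x y) (Pair_Key x' y') = Pair_Key (x * x') (y * y')"

instance
proof
  fix a b c :: "('a, 'b) pair_key"
  show "a + b + c = a + (b + c)"
    by (cases a; cases b; cases c) (simp add: mult.assoc)
  show "a + b = b + a"
    by (cases a; cases b) (simp add: mult.commute)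
  show "0 + a = a"
    by (cases a) (simp add: zero_pair_key_def)
qed

end

type_synonym ('a, 'b) formal_tensor = "('a, 'b) pair_key \<Rightarrow>\<^sub>0 complex"

definition formal_tens :: "'a \<Rightarrow> 'b \<Rightarrow> ('a, 'b) formal_tensor"
  where "formal_tens x y = Poly_Mapping.single (Pair_Key x y) 1"

definition bilinearity_relations ::
  "('a::comm_complex_algebra, 'b::comm_complex_algebra) formal_tensor set"
  where "bilinearity_relations =
      {formal_tens (x + x') y - formal_tens x y - formal_tens x' y | x x' y. True}
    \<union> {formal_tens x (y + y') - formal_tens x y - formal_tens x y' | x y y'. True}
    \<union> {formal_tens (c *\<^sub>C x) y - c *\<^sub>C formal_tens x y | c x y. True}
    \<union> {formal_tens x (c *\<^sub>C y) - c *\<^sub>C formal_tens x y | c x y. True}"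

quotient_type (overloaded) ('a, 'b) tensor =
  "('a::comm_complex_algebra, 'b::comm_complex_algebra) formal_tensor"
  / "\<lambda>s t. s - t \<in> gen_ideal bilinearity_relations"
  by (rule gen_ideal_equivp)

instantiation tensor :: (comm_complex_algebra, comm_complex_algebra) comm_complex_algebra
begin

lift_definition zero_tensor :: "('a, 'b) tensor" is 0 .
lift_definition one_tensor :: "('a, 'b) tensor" is 1 .
lift_definition plus_tensor :: "('a, 'b) tensor \<Rightarrow> ('a, 'b) tensor \<Rightarrow> ('a, 'b) tensor"
  is "(+)" by (rule gen_ideal_cong_add)
lift_definition minus_tensor :: "('a, 'b) tensor \<Rightarrow> ('a, 'b) tensor \<Rightarrow> ('a, 'b) tensor"
  is "(-)" by (rule gen_ideal_cong_diff)
lift_definition uminus_tensor :: "('a, 'b) tensor \<Rightarrow> ('a, 'b) tensor"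
  is uminus by (rule gen_ideal_cong_uminus)
lift_definition times_tensor :: "('a, 'b) tensor \<Rightarrow> ('a, 'b) tensor \<Rightarrow> ('a, 'b) tensor"
  is "(*)" by (rule gen_ideal_cong_mult)
lift_definition scaleC_tensor :: "complex \<Rightarrow> ('a, 'b) tensor \<Rightarrow> ('a, 'b) tensor"
  is "(*\<^sub>C)"
  unfolding scaleC_poly_mapping_def
  by (rule gen_ideal_cong_mult) (simp_all add: gen_ideal.zero)

lemma tensor_zero_neq_one: "(0::('a, 'b) tensor) \<noteq> 1"
proof
  assume "(0::('a, 'b) tensor) = 1"
  then have "0 - (1::('a, 'b) formal_tensor) \<in> gen_ideal bilinearity_relations"
    unfolding zero_tensor_def one_tensor_def tensor.abs_eq_iff .
  from gen_ideal_uminus[OF this]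
  have one: "(1::('a, 'b) formal_tensor) \<in> gen_ideal bilinearity_relations"
    by simp
  obtain f :: "'a \<Rightarrow> complex" where f: "clinear f" "f 1 = 1"
    using exists_unital_functional by blast
  obtain g :: "'b \<Rightarrow> complex" where g: "clinear g" "g 1 = 1"
    using exists_unital_functional by blast
  define \<Phi> :: "('a, 'b) formal_tensor \<Rightarrow> complex"
    where "\<Phi> = linear_extension (\<lambda>k. case k of Pair_Key x y \<Rightarrow> f x * g y)"
  have tens: "formal_tens x y * formal_tens u v = formal_tens (x * u) (y * v)"
    for x u :: 'a and y v :: 'b
    by (simp add: formal_tens_def mult_single)
  have \<Phi>: "\<Phi> (formal_tens x y) = f x * g y" "\<Phi> (s + t) = \<Phi> s + \<Phi> t" "\<Phi> (s - t) = \<Phi> s - \<Phi> t"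
    "\<Phi> (c *\<^sub>C s) = c * \<Phi> s" for x y s t c
    by (simp_all add: \<Phi>_def formal_tens_def linear_extension_add linear_extension_diff
        linear_extension_scaleC scaleC_complex_def)
  have lin: "f (x + y) = f x + f y" "f (c *\<^sub>C x) = c * f x"
    "g (u + v) = g u + g v" "g (c *\<^sub>C u) = c * g u" for x y u v c
    using f(1) g(1)
    by (simp_all add: Vector_Spaces.linear_iff scaleC_complex_def)
  have rel: "\<Phi> (r * formal_tens u v) = 0" if "r \<in> bilinearity_relations" for r u v
    using that unfolding bilinearity_relations_def
    by (auto simp: left_diff_distrib tens \<Phi> lin mult_scaleC_left distrib_right distrib_left
        mult.assoc mult.left_commute)
  have rel': "\<Phi> (r * q) = 0" if "r \<in> bilinearity_relations" for r q
  proof (induction q rule: poly_mapping_single_induct)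
    case (single k c)
    obtain u v where "k = Pair_Key u v" by (cases k)
    then have "Poly_Mapping.single k c = c *\<^sub>C formal_tens u v"
      by (simp add: scaleC_poly_mapping_def formal_tens_def mult_single scaleC_complex_def)
    then show ?case
      by (simp add: mult_scaleC_right \<Phi> rel[OF that])
  qed (simp_all add: distrib_left \<Phi>, simp add: \<Phi>_def)
  have "\<Phi> (x * q) = 0" if "x \<in> gen_ideal bilinearity_relations" for x q
    using that
  proof (induction arbitrary: q)
    case (mult x p p')
    have "p * x * p' * q = x * (p * p' * q)"
      by (simp add: ac_simps)
    then show ?case
      by (simp only: mult.IH)
  qed (simp_all add: distrib_right \<Phi> rel', simp add: \<Phi>_def)
  from this[OF one, of 1] have "\<Phi> 1 = 0"
    by simp
  moreover have "\<Phi> 1 = \<Phi> (formal_tens 1 1)"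
    by (simp add: formal_tens_def zero_pair_key_def flip: single_one)
  ultimately show False
    using f(2) g(2) by (simp add: \<Phi>)
qed

instance
proof
  fix a b c :: "('a, 'b) tensor" and x y :: complex
  show "a + b + c = a + (b + c)" by transfer (simp add: gen_ideal.zero add.assoc)
  show "a + b = b + a" by transfer (simp add: gen_ideal.zero add.commute)
  show "0 + a = a" by transfer (simp add: gen_ideal.zero)
  show "- a + a = 0" by transfer (simp add: gen_ideal.zero)
  show "a - b = a + - b" by transfer (simp add: gen_ideal.zero)
  show "a * b * c = a * (b * c)" by transfer (simp add: gen_ideal.zero mult.assoc)
  show "a * b = b * a" by transfer (simp add: gen_ideal.zero mult.commute)
  show "1 * a = a" by transfer (simp add: gen_ideal.zero)
  show "a * 1 = a" by transfer (simp add: gen_ideal.zero)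
  show "(a + b) * c = a * c + b * c" by transfer (simp add: gen_ideal.zero distrib_right)
  show "a * (b + c) = a * b + a * c" by transfer (simp add: gen_ideal.zero distrib_left)
  show "(0::('a, 'b) tensor) \<noteq> 1" by (rule tensor_zero_neq_one)
  show "x *\<^sub>C (a + b) = x *\<^sub>C a + x *\<^sub>C b"
    by transfer (simp add: gen_ideal.zero scaleC_add_right)
  show "(x + y) *\<^sub>C a = x *\<^sub>C a + y *\<^sub>C a"
    by transfer (simp add: gen_ideal.zero scaleC_add_left)
  show "x *\<^sub>C (y *\<^sub>C a) = (x * y) *\<^sub>C a"
    by transfer (simp add: gen_ideal.zero scaleC_scaleC)
  show "1 *\<^sub>C a = a" by transfer (simp add: gen_ideal.zero scaleC_one)
  show "(x *\<^sub>C a) * b = x *\<^sub>C (a * b)"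
    by transfer (simp add: gen_ideal.zero mult_scaleC_left)
  show "a * (x *\<^sub>C b) = x *\<^sub>C (a * b)"
    by transfer (simp add: gen_ideal.zero mult_scaleC_right)
qed

end

lift_definition tens ::
  "'a::comm_complex_algebra \<Rightarrow> 'b::comm_complex_algebra \<Rightarrow> ('a, 'b) tensor" (infixr "\<otimes>" 72)
  is formal_tens .

text \<open>The linear map with \<open>x \<otimes> y \<mapsto> f x y\<close>; independent of the representative when \<open>f\<close> is
  bilinear.\<close>

definition tensor_lift ::
  "('a::comm_complex_algebra \<Rightarrow> 'b::comm_complex_algebra \<Rightarrow> 'c::complex_algebra) \<Rightarrow>
    ('a, 'b) tensor \<Rightarrow> 'c"
  where "tensor_lift f t =
    linear_extension (\<lambda>k. case k of Pair_Key x y \<Rightarrow> f x y) (rep_tensor t)"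

section \<open>The Hopf algebra \<open>\<complex>[GL\<^sub>4]\<close>\<close>

text \<open>
  The numeral type \<^typ>\<open>4\<close> has the four distinct elements \<open>1, 2, 3, 4\<close> (as \<open>4 = 0\<close>). The algebra is
  the polynomial algebra on the matrix entries and one further variable \<open>d\<close>, modulo
  \<open>d det a = 1\<close>.
\<close>

datatype gl4_gen = Entry 4 4 | Det_Inv

definition generic_matrix :: "gl4_gen cpoly ^ 4 ^ 4"
  where "generic_matrix = (\<chi> \<mu> \<nu>. var (Entry \<mu> \<nu>))"

definition det_relation :: "gl4_gen cpoly"
  where "det_relation = var Det_Inv * det generic_matrix - 1"

quotient_type gl4 = "gl4_gen cpoly" / "\<lambda>p q. det_relation dvd p - q"
proof (rule equivpI)
  show "reflp (\<lambda>p q. det_relation dvd p - q)"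
    by (simp add: reflp_def)
  show "symp (\<lambda>p q. det_relation dvd p - q)"
    by (metis (mono_tags, lifting) dvd_minus_iff minus_diff_eq sympI)
  show "transp (\<lambda>p q. det_relation dvd p - q)"
  proof (rule transpI)
    fix p q r
    assume "det_relation dvd p - q" "det_relation dvd q - r"
    then show "det_relation dvd p - r"
      using dvd_add[of det_relation "p - q" "q - r"] by simp
  qed
qed

instantiation gl4 :: comm_complex_algebra
begin

lift_definition zero_gl4 :: gl4 is 0 .
lift_definition one_gl4 :: gl4 is 1 .
lift_definition plus_gl4 :: "gl4 \<Rightarrow> gl4 \<Rightarrow> gl4" is "(+)"
  by (metis add_diff_add dvd_add)
lift_definition minus_gl4 :: "gl4 \<Rightarrow> gl4 \<Rightarrow> gl4" is "(-)"
proof -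
  fix p p' q q' :: "gl4_gen cpoly"
  assume "det_relation dvd p - p'" "det_relation dvd q - q'"
  then have "det_relation dvd (p - p') - (q - q')"
    by (rule dvd_diff)
  then show "det_relation dvd (p - q) - (p' - q')"
    by (simp add: algebra_simps)
qed
lift_definition uminus_gl4 :: "gl4 \<Rightarrow> gl4" is uminus
  by (metis dvd_minus_iff minus_diff_eq minus_diff_minus)
lift_definition times_gl4 :: "gl4 \<Rightarrow> gl4 \<Rightarrow> gl4" is "(*)"
proof -
  fix p p' q q' :: "gl4_gen cpoly"
  assume "det_relation dvd p - p'" "det_relation dvd q - q'"
  then have "det_relation dvd (p - p') * q + p' * (q - q')"
    by simp
  then show "det_relation dvd p * q - p' * q'"
    by (simp add: algebra_simps)
qed
lift_definition scaleC_gl4 :: "complex \<Rightarrow> gl4 \<Rightarrow> gl4" is "(*\<^sub>C)"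
proof -
  fix c and p p' :: "gl4_gen cpoly"
  assume "det_relation dvd p - p'"
  then have "det_relation dvd Poly_Mapping.single 0 (c *\<^sub>C 1) * (p - p')"
    by simp
  then show "det_relation dvd c *\<^sub>C p - c *\<^sub>C p'"
    by (simp add: scaleC_poly_mapping_def right_diff_distrib)
qed

lemma gl4_zero_neq_one: "(0::gl4) \<noteq> 1"
proof
  assume "(0::gl4) = 1"
  then have "det_relation dvd 0 - 1"
    unfolding zero_gl4_def one_gl4_def gl4.abs_eq_iff .
  then have "det_relation dvd 1"
    by simp
  then obtain q where q: "1 = det_relation * q"
    by (rule dvdE)
  define f :: "gl4_gen \<Rightarrow> complex"
    where "f = (\<lambda>g. case g of Entry \<mu> \<nu> \<Rightarrow> (if \<mu> = \<nu> then 1 else 0) | Det_Inv \<Rightarrow> 1)"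
  have "(\<chi> i j. poly_eval f (generic_matrix $ i $ j)) = mat 1"
    by (simp add: generic_matrix_def mat_def f_def vec_eq_iff)
  then have "poly_eval f det_relation = 0"
    by (simp add: det_relation_def poly_eval_diff poly_eval_mult poly_eval_det f_def)
  then have "poly_eval f 1 = 0"
    by (subst q) (simp add: poly_eval_mult)
  then show False
    by simp
qed

instance
proof
  fix a b c :: gl4 and x y :: complex
  show "a + b + c = a + (b + c)" by transfer (simp add: add.assoc)
  show "a + b = b + a" by transfer (simp add: add.commute)
  show "0 + a = a" by transfer simp
  show "- a + a = 0" by transfer simp
  show "a - b = a + - b" by transfer simp
  show "a * b * c = a * (b * c)" by transfer (simp add: mult.assoc)
  show "a * b = b * a" by transfer (simp add: mult.commute)
  show "1 * a = a" by transfer simp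
  show "a * 1 = a" by transfer simp
  show "(a + b) * c = a * c + b * c" by transfer (simp add: distrib_right)
  show "a * (b + c) = a * b + a * c" by transfer (simp add: distrib_left)
  show "(0::gl4) \<noteq> 1" by (rule gl4_zero_neq_one)
  show "x *\<^sub>C (a + b) = x *\<^sub>C a + x *\<^sub>C b" by transfer (simp add: scaleC_add_right)
  show "(x + y) *\<^sub>C a = x *\<^sub>C a + y *\<^sub>C a" by transfer (simp add: scaleC_add_left)
  show "x *\<^sub>C (y *\<^sub>C a) = (x * y) *\<^sub>C a" by transfer (simp add: scaleC_scaleC)
  show "1 *\<^sub>C a = a" by transfer (simp add: scaleC_one)
  show "(x *\<^sub>C a) * b = x *\<^sub>C (a * b)" by transfer (simp add: mult_scaleC_left)
  show "a * (x *\<^sub>C b) = x *\<^sub>C (a * b)" by transfer (simp add: mult_scaleC_right)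
qed

end

lift_definition gl4_gen_elem :: "gl4_gen \<Rightarrow> gl4" is var .

abbreviation a_gl4 :: "4 \<Rightarrow> 4 \<Rightarrow> gl4"
  where "a_gl4 \<mu> \<nu> \<equiv> gl4_gen_elem (Entry \<mu> \<nu>)"

abbreviation det_inv :: gl4
  where "det_inv \<equiv> gl4_gen_elem Det_Inv"

text \<open>The algebra map with the given values on generators; independent of the representative when
  these satisfy \<open>d det a = 1\<close>.\<close>

definition gl4_hom :: "(4 \<Rightarrow> 4 \<Rightarrow> 'c::comm_complex_algebra) \<Rightarrow> 'c \<Rightarrow> gl4 \<Rightarrow> 'c"
  where "gl4_hom f d h =
    poly_eval (\<lambda>g. case g of Entry \<mu> \<nu> \<Rightarrow> f \<mu> \<nu> | Det_Inv \<Rightarrow> d) (rep_gl4 h)"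

definition comult :: "gl4 \<Rightarrow> (gl4, gl4) tensor"
  where "comult = gl4_hom (\<lambda>\<mu> \<nu>. \<Sum>\<alpha>\<in>UNIV. a_gl4 \<mu> \<alpha> \<otimes> a_gl4 \<alpha> \<nu>) (det_inv \<otimes> det_inv)"

definition counit :: "gl4 \<Rightarrow> complex"
  where "counit = gl4_hom (\<lambda>\<mu> \<nu>. if \<mu> = \<nu> then 1 else 0) 1"

text \<open>Sweedler notation: \<open>sweedler2 f h\<close> is \<open>f(h\<^sub>(\<^sub>1\<^sub>), h\<^sub>(\<^sub>2\<^sub>))\<close>, for multilinear \<open>f\<close>.\<close>

definition sweedler2 :: "(gl4 \<Rightarrow> gl4 \<Rightarrow> 'c::complex_algebra) \<Rightarrow> gl4 \<Rightarrow> 'c"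
  where "sweedler2 f h = tensor_lift f (comult h)"

definition sweedler3 :: "(gl4 \<Rightarrow> gl4 \<Rightarrow> gl4 \<Rightarrow> 'c::complex_algebra) \<Rightarrow> gl4 \<Rightarrow> 'c"
  where "sweedler3 f = sweedler2 (\<lambda>x h3. sweedler2 (\<lambda>h1 h2. f h1 h2 h3) x)"

definition antipode :: "gl4 \<Rightarrow> gl4"
  where "antipode = (THE S. clinear S \<and> (\<forall>h.
    sweedler2 (\<lambda>h1 h2. S h1 * h2) h = counit h *\<^sub>C 1 \<and>
    sweedler2 (\<lambda>h1 h2. h1 * S h2) h = counit h *\<^sub>C 1))"

definition conv_inverse1 :: "(gl4 \<Rightarrow> complex) \<Rightarrow> (gl4 \<Rightarrow> complex)"
  where "conv_inverse1 U = (THE V. clinear V \<and> (\<forall>h.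
    sweedler2 (\<lambda>h1 h2. U h1 * V h2) h = counit h \<and>
    sweedler2 (\<lambda>h1 h2. V h1 * U h2) h = counit h))"

definition conv2 ::
  "(gl4 \<Rightarrow> gl4 \<Rightarrow> complex) \<Rightarrow> (gl4 \<Rightarrow> gl4 \<Rightarrow> complex) \<Rightarrow> (gl4 \<Rightarrow> gl4 \<Rightarrow> complex)"
  where "conv2 F G h g =
    sweedler2 (\<lambda>h1 h2. sweedler2 (\<lambda>g1 g2. F h1 g1 * G h2 g2) g) h"

definition conv_inverse2 :: "(gl4 \<Rightarrow> gl4 \<Rightarrow> complex) \<Rightarrow> (gl4 \<Rightarrow> gl4 \<Rightarrow> complex)"
  where "conv_inverse2 F = (THE G. cbilinear G \<and>
    conv2 F G = (\<lambda>h g. counit h * counit g) \<and> conv2 G F = (\<lambda>h g. counit h * counit g))"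

section \<open>The cocycle\<close>

abbreviation I12 :: "4 set" where "I12 \<equiv> {1, 2}"
abbreviation I34 :: "4 set" where "I34 \<equiv> {3, 4}"

text \<open>
  The blocks of the matrix \<open>a\<close> (row index first) are \<open>\<gamma>\<close> on \<open>I12 \<times> I12\<close>, \<open>\<tau>\<close> on \<open>I12 \<times> I34\<close>,
  \<open>\<sigma>\<close> on \<open>I34 \<times> I12\<close> and \<open>\<gamma>'\<close> (\<open>\<gamma>\<close> with a tilde) on \<open>I34 \<times> I34\<close>.
\<close>

text \<open>The parameter \<open>\<theta>\<^sup>A\<^sup>B\<^sub>A\<^sub>'\<^sub>B\<^sub>'\<close> is written \<open>\<theta> A B A' B'\<close>, upper indices first; values outside the
  index range are discarded by the extension by zero.\<close>

definition theta_ext ::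
  "(4 \<Rightarrow> 4 \<Rightarrow> 4 \<Rightarrow> 4 \<Rightarrow> complex) \<Rightarrow> (4 \<Rightarrow> 4 \<Rightarrow> 4 \<Rightarrow> 4 \<Rightarrow> complex)"
  where "theta_ext \<theta> \<mu> \<alpha> \<nu> \<beta> =
    (if \<mu> \<in> I12 \<and> \<alpha> \<in> I12 \<and> \<nu> \<in> I34 \<and> \<beta> \<in> I34 then \<theta> \<mu> \<alpha> \<nu> \<beta> else 0)"

definition theta_minus ::
  "(4 \<Rightarrow> 4 \<Rightarrow> 4 \<Rightarrow> 4 \<Rightarrow> complex) \<Rightarrow> (4 \<Rightarrow> 4 \<Rightarrow> 4 \<Rightarrow> 4 \<Rightarrow> complex)"
  where "theta_minus \<theta> \<mu> \<alpha> \<nu> \<beta> = 1/2 * (theta_ext \<theta> \<mu> \<alpha> \<nu> \<beta> - theta_ext \<theta> \<alpha> \<mu> \<beta> \<nu>)"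

typedef trans_var = "I12 \<times> I34"
  by blast

definition t_var :: "4 \<Rightarrow> 4 \<Rightarrow> trans_var"
  where "t_var A A' = Abs_trans_var (A, A')"

definition restrict_to_translations :: "gl4 \<Rightarrow> trans_var cpoly"
  where "restrict_to_translations = gl4_hom
    (\<lambda>\<mu> \<nu>. if \<mu> \<in> I12 \<and> \<nu> \<in> I34 then var (t_var \<mu> \<nu>) else if \<mu> = \<nu> then 1 else 0) 1"

text \<open>
  \<open>translation_pairing_power \<theta> n h g\<close> is the pairing of \<open>(\<theta>\<^sup>A\<^sup>B\<^sub>A\<^sub>'\<^sub>B\<^sub>' \<partial>\<^sup>A\<^sup>'\<^sub>A \<otimes> \<partial>\<^sup>B\<^sup>'\<^sub>B)\<^sup>n\<close> with
  \<open>h \<otimes> g\<close>: differentiate, then evaluate at zero.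
\<close>

primrec translation_pairing_power ::
  "(4 \<Rightarrow> 4 \<Rightarrow> 4 \<Rightarrow> 4 \<Rightarrow> complex) \<Rightarrow> nat \<Rightarrow> trans_var cpoly \<Rightarrow> trans_var cpoly \<Rightarrow> complex"
  where
    "translation_pairing_power \<theta> 0 h g = poly_eval (\<lambda>_. 0) h * poly_eval (\<lambda>_. 0) g"
  | "translation_pairing_power \<theta> (Suc n) h g =
      (\<Sum>A\<in>I12. \<Sum>B\<in>I12. \<Sum>A'\<in>I34. \<Sum>B'\<in>I34. \<theta> A B A' B' *
        translation_pairing_power \<theta> n
          (partial_deriv (t_var A A') h) (partial_deriv (t_var B B') g))"

text \<open>The exponential series has finitely many nonzero terms, as \<open>h\<close> and \<open>g\<close> are polynomials.\<close>

definition translation_cocycle ::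
  "(4 \<Rightarrow> 4 \<Rightarrow> 4 \<Rightarrow> 4 \<Rightarrow> complex) \<Rightarrow> trans_var cpoly \<Rightarrow> trans_var cpoly \<Rightarrow> complex"
  where "translation_cocycle \<theta> h g =
    suminf (\<lambda>n. (\<i> / 2) ^ n / fact n * translation_pairing_power \<theta> n h g)"

definition F_gl4 :: "(4 \<Rightarrow> 4 \<Rightarrow> 4 \<Rightarrow> 4 \<Rightarrow> complex) \<Rightarrow> gl4 \<Rightarrow> gl4 \<Rightarrow> complex"
  where "F_gl4 \<theta> h g =
    translation_cocycle \<theta> (restrict_to_translations h) (restrict_to_translations g)"

section \<open>The cotwisted Hopf algebra \<open>\<complex>\<^sub>F[GL\<^sub>4]\<close>\<close>

definition twisted_mult ::
  "gl4 \<Rightarrow> (4 \<Rightarrow> 4 \<Rightarrow> 4 \<Rightarrow> 4 \<Rightarrow> complex) \<Rightarrow> gl4 \<Rightarrow> gl4" ("_ \<bullet>\<^bsub>_\<^esub> _" [71, 0, 70] 70)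
  where "h \<bullet>\<^bsub>\<theta>\<^esub> g =
    sweedler3 (\<lambda>h1 h2 h3. sweedler3 (\<lambda>g1 g2 g3.
      (F_gl4 \<theta> h1 g1 * conv_inverse2 (F_gl4 \<theta>) h3 g3) *\<^sub>C (h2 * g2)) g) h"

definition twisted_comm ::
  "(4 \<Rightarrow> 4 \<Rightarrow> 4 \<Rightarrow> 4 \<Rightarrow> complex) \<Rightarrow> gl4 \<Rightarrow> gl4 \<Rightarrow> gl4"
  where "twisted_comm \<theta> h g = h \<bullet>\<^bsub>\<theta>\<^esub> g - g \<bullet>\<^bsub>\<theta>\<^esub> h"

definition twisted_comult :: "(4 \<Rightarrow> 4 \<Rightarrow> 4 \<Rightarrow> 4 \<Rightarrow> complex) \<Rightarrow> gl4 \<Rightarrow> (gl4, gl4) tensor"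
  where "twisted_comult \<theta> = comult"

definition U_gl4 :: "(4 \<Rightarrow> 4 \<Rightarrow> 4 \<Rightarrow> 4 \<Rightarrow> complex) \<Rightarrow> gl4 \<Rightarrow> complex"
  where "U_gl4 \<theta> = sweedler2 (\<lambda>h1 h2. F_gl4 \<theta> h1 (antipode h2))"

definition twisted_antipode :: "(4 \<Rightarrow> 4 \<Rightarrow> 4 \<Rightarrow> 4 \<Rightarrow> complex) \<Rightarrow> gl4 \<Rightarrow> gl4"
  where "twisted_antipode \<theta> = sweedler3 (\<lambda>h1 h2 h3.
    (U_gl4 \<theta> h1 * conv_inverse1 (U_gl4 \<theta>) h3) *\<^sub>C antipode h2)"

section \<open>Presentations by generators and relations\<close>

datatype 'x word = Word (letters: "'x list")

instantiation word :: (type) monoid_add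
begin

definition zero_word :: "'x word"
  where "zero_word = Word []"

definition plus_word :: "'x word \<Rightarrow> 'x word \<Rightarrow> 'x word"
  where "plus_word u v = Word (letters u @ letters v)"

instance
  by standard (simp_all add: zero_word_def plus_word_def)

end

type_synonym 'x free_algebra = "'x word \<Rightarrow>\<^sub>0 complex"

definition letter :: "'x \<Rightarrow> 'x free_algebra"
  where "letter x = Poly_Mapping.single (Word [x]) 1"

definition free_algebra_map ::
  "('h::complex_algebra \<Rightarrow> 'h \<Rightarrow> 'h) \<Rightarrow> ('x \<Rightarrow> 'h) \<Rightarrow> 'x free_algebra \<Rightarrow> 'h"
  where "free_algebra_map m f = linear_extension (\<lambda>w. foldr (\<lambda>x h. m (f x) h) (letters w) 1)"

text \<open>The algebra with product \<open>m\<close> (and unit 1) is generated by the elements \<open>f x\<close>, and the ideal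
  of all relations between them is generated by \<open>R\<close>.\<close>

definition presented_by ::
  "('h::complex_algebra \<Rightarrow> 'h \<Rightarrow> 'h) \<Rightarrow> ('x \<Rightarrow> 'h) \<Rightarrow> 'x free_algebra set \<Rightarrow> bool"
  where "presented_by m f R \<longleftrightarrow>
    (\<forall>p q. free_algebra_map m f (p * q) = m (free_algebra_map m f p) (free_algebra_map m f q)) \<and>
    surj (free_algebra_map m f) \<and>
    {p. free_algebra_map m f p = 0} = gen_ideal R"

abbreviation a_free :: "4 \<Rightarrow> 4 \<Rightarrow> gl4_gen free_algebra"
  where "a_free \<mu> \<nu> \<equiv> letter (Entry \<mu> \<nu>)"

abbreviation free_comm :: "'a::ring_1 \<Rightarrow> 'a \<Rightarrow> 'a"
  where "free_comm x y \<equiv> x * y - y * x"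

text \<open>In order: the relations for \<open>[\<gamma>, \<gamma>]\<close>, \<open>[\<gamma>', \<gamma>']\<close>, \<open>[\<gamma>, \<tau>]\<close>, \<open>[\<gamma>', \<tau>]\<close>, \<open>[\<tau>, \<tau>]\<close>, then the
  vanishing of \<open>[\<gamma>, \<gamma>']\<close>, \<open>[\<gamma>, \<sigma>]\<close>, \<open>[\<gamma>', \<sigma>]\<close>, \<open>[\<tau>, \<sigma>]\<close>, \<open>[\<sigma>, \<sigma>]\<close>.\<close>

definition gl4_relations ::
  "(4 \<Rightarrow> 4 \<Rightarrow> 4 \<Rightarrow> 4 \<Rightarrow> complex) \<Rightarrow> gl4_gen free_algebra set"
  where "gl4_relations \<theta> =
      {free_comm (a_free \<mu> \<nu>) (a_free \<alpha> \<beta>)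
        - (\<Sum>c\<in>I34. \<Sum>d\<in>I34. (\<i> * theta_minus \<theta> \<mu> \<alpha> c d) *\<^sub>C (a_free c \<nu> * a_free d \<beta>))
        | \<mu> \<nu> \<alpha> \<beta>. \<mu> \<in> I12 \<and> \<nu> \<in> I12 \<and> \<alpha> \<in> I12 \<and> \<beta> \<in> I12}
    \<union> {free_comm (a_free \<mu> \<nu>) (a_free \<alpha> \<beta>)
        + (\<Sum>c\<in>I12. \<Sum>d\<in>I12. (\<i> * theta_minus \<theta> c d \<nu> \<beta>) *\<^sub>C (a_free \<alpha> d * a_free \<mu> c))
        | \<mu> \<nu> \<alpha> \<beta>. \<mu> \<in> I34 \<and> \<nu> \<in> I34 \<and> \<alpha> \<in> I34 \<and> \<beta> \<in> I34}
    \<union> {free_comm (a_free \<mu> \<nu>) (a_free \<alpha> \<beta>)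
        - (\<Sum>c\<in>I34. \<Sum>d\<in>I34. (\<i> * theta_minus \<theta> \<mu> \<alpha> c d) *\<^sub>C (a_free c \<nu> * a_free d \<beta>))
        | \<mu> \<nu> \<alpha> \<beta>. \<mu> \<in> I12 \<and> \<nu> \<in> I12 \<and> \<alpha> \<in> I12 \<and> \<beta> \<in> I34}
    \<union> {free_comm (a_free \<mu> \<nu>) (a_free \<alpha> \<beta>)
        + (\<Sum>c\<in>I12. \<Sum>d\<in>I12. (\<i> * theta_minus \<theta> c d \<nu> \<beta>) *\<^sub>C (a_free \<alpha> d * a_free \<mu> c))
        | \<mu> \<nu> \<alpha> \<beta>. \<mu> \<in> I34 \<and> \<nu> \<in> I34 \<and> \<alpha> \<in> I12 \<and> \<beta> \<in> I34}
    \<union> {free_comm (a_free \<mu> \<nu>) (a_free \<alpha> \<beta>)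
        - (\<Sum>c\<in>I34. \<Sum>d\<in>I34. (\<i> * theta_minus \<theta> \<mu> \<alpha> c d) *\<^sub>C (a_free c \<nu> * a_free d \<beta>))
        + (\<Sum>c\<in>I12. \<Sum>d\<in>I12. (\<i> * theta_minus \<theta> c d \<nu> \<beta>) *\<^sub>C (a_free \<alpha> d * a_free \<mu> c))
        | \<mu> \<nu> \<alpha> \<beta>. \<mu> \<in> I12 \<and> \<nu> \<in> I34 \<and> \<alpha> \<in> I12 \<and> \<beta> \<in> I34}
    \<union> {free_comm (a_free \<mu> \<nu>) (a_free \<alpha> \<beta>)
        | \<mu> \<nu> \<alpha> \<beta>. \<mu> \<in> I12 \<and> \<nu> \<in> I12 \<and> \<alpha> \<in> I34 \<and> \<beta> \<in> I34}
    \<union> {free_comm (a_free \<mu> \<nu>) (a_free \<alpha> \<beta>)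
        | \<mu> \<nu> \<alpha> \<beta>. \<mu> \<in> I12 \<and> \<nu> \<in> I12 \<and> \<alpha> \<in> I34 \<and> \<beta> \<in> I12}
    \<union> {free_comm (a_free \<mu> \<nu>) (a_free \<alpha> \<beta>)
        | \<mu> \<nu> \<alpha> \<beta>. \<mu> \<in> I34 \<and> \<nu> \<in> I34 \<and> \<alpha> \<in> I34 \<and> \<beta> \<in> I12}
    \<union> {free_comm (a_free \<mu> \<nu>) (a_free \<alpha> \<beta>)
        | \<mu> \<nu> \<alpha> \<beta>. \<mu> \<in> I12 \<and> \<nu> \<in> I34 \<and> \<alpha> \<in> I34 \<and> \<beta> \<in> I12}
    \<union> {free_comm (a_free \<mu> \<nu>) (a_free \<alpha> \<beta>)
        | \<mu> \<nu> \<alpha> \<beta>. \<mu> \<in> I34 \<and> \<nu> \<in> I12 \<and> \<alpha> \<in> I34 \<and> \<beta> \<in> I12}"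

end

theory Submission
  imports Defs
begin

text \<open>The weight of an entry counts a row index in \<open>I12\<close> and a column index in
  \<open>I34\<close>, the indices that a \<theta> correction replaces. A replaced index falls
  outside that range and cannot be replaced again, so substitutions lower weight, and two row shifts
  (or two column shifts) chained along a common index give 0. This nilpotency is why every operator
  is identity plus shift and every formula is finite. Row and column substitutions restrict to the
  same partial derivative on translations, so an argument of F may be differentiated by either. F is
  made to act through rows and its inverse through columns, and these two actions commute.
  Obstacles: Sweedler sums use a chosen representative, and the antipode and convolution inverses
  are definite descriptions, so multilinearity and uniqueness come before any computation. The
  relation \<open>d det a = 1\<close> is not homogeneous for the weight, so leading terms are
  compared only on words in the entries; that inverting the determinant creates no new relation
  between entries follows from a degree count in d.\<close>

text \<open>
  Write \<open>t\<close> for the parameter \<open>\<theta>\<close>. The cocycle is determined by the recursion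
  \<open>F(x h, g) = (\<i>/2) \<theta> F(h, \<partial> g)\<close> for coordinates \<open>x\<close>, which commutes with all translations, so \<open>F\<^sup>-\<^sup>1\<close> is \<open>F\<close> with \<open>\<theta>\<close> negated. Two commuting families of derivations of
  \<open>\<complex>[GL\<^sub>4]\<close>, the row and column substitutions dual to the translations, turn left twisted
  multiplication by a generator into an explicit operator; products, commutators and associativity
  follow from it. For the presentation, filter by the weight that gives \<open>\<sigma>\<close>, \<open>\<gamma>\<close>, \<open>\<gamma>'\<close>, \<open>\<tau>\<close> the
  values 0, 1, 1, 2: both the twisted product and the relations agree with the commutative ones up
  to lower weight, so a relation among the matrix entries reduces, weight by weight, to one in the
  polynomial ring. The determinant is grouplike and trivial on translations, hence central and
  undeformed, and inverting it commutes with this reduction.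
\<close>

section \<open>Linear maps and tensor products\<close>

type_synonym theta_parameter = "4 \<Rightarrow> 4 \<Rightarrow> 4 \<Rightarrow> 4 \<Rightarrow> complex"

abbreviation "res \<equiv> restrict_to_translations"
abbreviation "pairing \<equiv> translation_pairing_power"
abbreviation "cocycle \<equiv> translation_cocycle"

lemma vector_space_scaleC: "vector_space ((*\<^sub>C) :: complex \<Rightarrow> 'a::complex_algebra \<Rightarrow> 'a)"
  by standard (simp_all add: scaleC_add_left scaleC_add_right scaleC_scaleC scaleC_one)

lemma clinear_iff:
  "clinear f \<longleftrightarrow> (\<forall>x y. f (x + y) = f x + f y) \<and> (\<forall>c x. f (c *\<^sub>C x) = c *\<^sub>C f x)"
  by (auto simp: Vector_Spaces.linear_iff vector_space_scaleC)

lemma clinearI: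
  assumes "\<And>x y. f (x + y) = f x + f y" "\<And>c x. f (c *\<^sub>C x) = c *\<^sub>C f x"
  shows "clinear f"
  using assms by (simp add: clinear_iff)

lemma clinear_add: "clinear f \<Longrightarrow> f (x + y) = f x + f y"
  and clinear_scaleC: "clinear f \<Longrightarrow> f (c *\<^sub>C x) = c *\<^sub>C f x"
  by (simp_all add: clinear_iff)

lemma clinear_zero: "clinear f \<Longrightarrow> f 0 = 0"
  using clinear_scaleC[of f 0 0] by simp

lemma scaleC_minus_one: "(- 1) *\<^sub>C x = - (x::'a::complex_algebra)"
  using scaleC_add_left[of "- 1" 1 x] by (simp add: scaleC_one eq_neg_iff_add_eq_0)

lemma scaleC_uminus_left: "(- c) *\<^sub>C x = - (c *\<^sub>C (x::'a::complex_algebra))"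
  using scaleC_scaleC[of "- 1" c x] by (simp add: scaleC_minus_one)

lemma scaleC_uminus_right: "c *\<^sub>C (- x) = - (c *\<^sub>C (x::'a::complex_algebra))"
  using scaleC_add_right[of c x "- x"] by (simp add: eq_neg_iff_add_eq_0 add.commute)

lemma scaleC_diff_right: "c *\<^sub>C (x - y) = c *\<^sub>C x - c *\<^sub>C (y::'a::complex_algebra)"
  using scaleC_add_right[of c x "- y"] by (simp add: scaleC_uminus_right)

lemma scaleC_diff_left: "(c - d) *\<^sub>C x = c *\<^sub>C x - d *\<^sub>C (x::'a::complex_algebra)"
  using scaleC_add_left[of c "- d" x] by (simp add: scaleC_uminus_left)

lemma scaleC_sum_right: "c *\<^sub>C sum f A = (\<Sum>x\<in>A. c *\<^sub>C (f x :: 'a::complex_algebra))"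
  by (induction A rule: infinite_finite_induct) (simp_all add: scaleC_add_right)

lemma scaleC_sum_left: "sum f A *\<^sub>C (y :: 'a::complex_algebra) = (\<Sum>x\<in>A. f x *\<^sub>C y)"
  by (induction A rule: infinite_finite_induct) (simp_all add: scaleC_add_left)

lemma clinear_uminus: "clinear f \<Longrightarrow> f (- x) = - f x"
  using clinear_scaleC[of f "- 1" x] by (simp add: scaleC_minus_one)

lemma clinear_diff: "clinear f \<Longrightarrow> f (x - y) = f x - f y"
  using clinear_add[of f x "- y"] by (simp add: clinear_uminus)

lemma clinear_sum: "clinear f \<Longrightarrow> f (sum g A) = (\<Sum>x\<in>A. f (g x))"
  by (induction A rule: infinite_finite_induct) (simp_all add: clinear_add clinear_zero)

lemmas clinear_simps = clinear_add clinear_scaleC clinear_zero clinear_uminus clinear_diff clinear_sum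

lemmas scaleC_simps = scaleC_add_left scaleC_add_right scaleC_diff_left scaleC_diff_right
  scaleC_uminus_left scaleC_uminus_right scaleC_scaleC scaleC_one mult_scaleC_left mult_scaleC_right

lemma clinear_linear_extension: "clinear (linear_extension g :: ('m::monoid_add \<Rightarrow>\<^sub>0 complex) \<Rightarrow> _)"
  by (rule clinearI) (simp_all add: linear_extension_add linear_extension_scaleC)

lemma clinear_compose: "clinear f \<Longrightarrow> clinear g \<Longrightarrow> clinear (\<lambda>x. f (g x))"
  by (simp add: clinear_iff)

lemma clinear_mult_left: "clinear ((*) a)"
  and clinear_mult_right: "clinear (\<lambda>x. x * a)"
  and clinear_scale: "clinear ((*\<^sub>C) c)"
  by (simp_all add: clinear_iff distrib_left distrib_right scaleC_simps mult.commute)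

lemma cbilinearI:
  assumes "\<And>x. clinear (f x)" "\<And>y. clinear (\<lambda>x. f x y)"
  shows "cbilinear f"
  using assms by (simp add: cbilinear_def)

lemma cbilinearD: "cbilinear f \<Longrightarrow> clinear (f x)" "cbilinear f \<Longrightarrow> clinear (\<lambda>x. f x y)"
  by (auto simp: cbilinear_def)

section \<open>The universal property of the tensor product\<close>

lemma formal_tens_mult: "formal_tens x y * formal_tens u v = formal_tens (x * u) (y * v)"
  by (simp add: formal_tens_def mult_single)

lemma formal_tensor_induct [case_names zero tens add]:
  fixes t :: "('a::comm_complex_algebra, 'b::comm_complex_algebra) formal_tensor"
  assumes "P 0" "\<And>c x y. P (c *\<^sub>C formal_tens x y)" "\<And>s t. P s \<Longrightarrow> P t \<Longrightarrow> P (s + t)"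
  shows "P t"
proof (induction t rule: poly_mapping_single_induct)
  case (single k c)
  obtain u v where "k = Pair_Key u v" by (cases k)
  then have "Poly_Mapping.single k c = c *\<^sub>C formal_tens u v"
    by (simp add: scaleC_poly_mapping_def formal_tens_def mult_single scaleC_complex_def)
  then show ?case using assms(2) by simp
qed (use assms in auto)

text \<open>Multiplying a bilinearity relation by a pure tensor gives a relation of the same kind,
  so the linear extension of a bilinear map kills all multiples of all relations. Hence
  \<open>tensor_lift\<close> may be computed on any representative.\<close>

lemma linear_extension_bilinearity_relations:
  fixes f :: "'a::comm_complex_algebra \<Rightarrow> 'b::comm_complex_algebra \<Rightarrow> 'c::complex_algebra"
  assumes f: "cbilinear f" and r: "r \<in> gen_ideal bilinearity_relations"
  shows "linear_extension (\<lambda>k. case k of Pair_Key x y \<Rightarrow> f x y) r = 0"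
proof -
  define \<Phi> where "\<Phi> = linear_extension (\<lambda>k. case k of Pair_Key x y \<Rightarrow> f x y)"
  have lin: "clinear \<Phi>"
    by (simp add: \<Phi>_def clinear_linear_extension)
  have tens: "\<Phi> (formal_tens x y) = f x y" for x y
    by (simp add: \<Phi>_def formal_tens_def scaleC_one)
  note f' = cbilinearD[OF f]
  have add: "f (x + x') y = f x y + f x' y" "f (c *\<^sub>C x) y = c *\<^sub>C f x y" for x x' y c
    using f'(2)[of y] by (simp_all add: clinear_iff)
  note bil = add clinear_simps[OF f'(1)]
  have rel: "\<Phi> (r * formal_tens u v) = 0" if "r \<in> bilinearity_relations" for r u v
    using that unfolding bilinearity_relations_def
    by (auto simp: left_diff_distrib formal_tens_mult clinear_simps[OF lin] tens bil
        mult_scaleC_left distrib_right)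
  have rel': "\<Phi> (r * q) = 0" if "r \<in> bilinearity_relations" for r q
    by (induction q rule: formal_tensor_induct)
      (simp_all add: distrib_left clinear_simps[OF lin] mult_scaleC_right rel[OF that])
  \<comment> \<open>Strengthened to all multiples \<open>x * q\<close>: the ideal closure multiplies
    by arbitrary factors, which commutativity collects in q.\<close>
  have "\<Phi> (x * q) = 0" if "x \<in> gen_ideal bilinearity_relations" for x q
    using that
  proof (induction arbitrary: q)
    case (mult x p p')
    have "p * x * p' * q = x * (p * p' * q)"
      by (simp add: ac_simps)
    then show ?case
      by (simp only: mult.IH)
  qed (simp_all add: distrib_right clinear_simps[OF lin] rel')
  from this[OF r, of 1] show ?thesis
    by (simp add: \<Phi>_def)
qed

lemma tensor_lift_abs:
  assumes "cbilinear f"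
  shows "tensor_lift f (abs_tensor p) = linear_extension (\<lambda>k. case k of Pair_Key x y \<Rightarrow> f x y) p"
proof -
  have "rep_tensor (abs_tensor p) - p \<in> gen_ideal bilinearity_relations"
    using Quotient_rep_abs[OF Quotient_tensor, of p] by (simp add: gen_ideal.zero)
  from linear_extension_bilinearity_relations[OF assms this] show ?thesis
    by (simp add: tensor_lift_def linear_extension_diff)
qed

lemma tensor_lift_tens [simp]: "cbilinear f \<Longrightarrow> tensor_lift f (x \<otimes> y) = f x y"
  by (simp add: tens.abs_eq tensor_lift_abs formal_tens_def scaleC_one)

lemma tensor_abs_surj: obtains p where "t = abs_tensor p"
  using that[of "rep_tensor t"] Quotient_abs_rep[OF Quotient_tensor, of t] by simp

lemma clinear_tensor_lift:
  assumes "cbilinear f"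
  shows "clinear (tensor_lift f)"
proof (rule clinearI)
  fix c and s t :: "('a, 'b) tensor"
  obtain p where "s = abs_tensor p"
    by (rule tensor_abs_surj)
  moreover obtain q where "t = abs_tensor q"
    by (rule tensor_abs_surj)
  ultimately show "tensor_lift f (s + t) = tensor_lift f s + tensor_lift f t"
    "tensor_lift f (c *\<^sub>C s) = c *\<^sub>C tensor_lift f s"
    by (simp_all add: plus_tensor.abs_eq scaleC_tensor.abs_eq tensor_lift_abs[OF assms]
        linear_extension_add linear_extension_scaleC)
qed

lemma tensor_induct [case_names zero tens add]:
  assumes "P 0" "\<And>c x y. P (c *\<^sub>C (x \<otimes> y))" "\<And>s t. P s \<Longrightarrow> P t \<Longrightarrow> P (s + t)"
  shows "P t"
proof -
  have "P (abs_tensor p)" for p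
    by (induction p rule: formal_tensor_induct)
      (use assms in \<open>simp_all add: zero_tensor_def tens.abs_eq
        flip: plus_tensor.abs_eq scaleC_tensor.abs_eq\<close>)
  then show ?thesis
    by (metis tensor_abs_surj)
qed

lemma tens_mult: "(x \<otimes> y) * (u \<otimes> v) = (x * u) \<otimes> (y * v)"
  by (simp add: tens.abs_eq times_tensor.abs_eq formal_tens_mult)

lemma tens_one: "1 \<otimes> 1 = 1"
  by (simp add: tens.abs_eq one_tensor_def formal_tens_def zero_pair_key_def flip: single_one)

lemma cbilinear_tens: "cbilinear (\<otimes>)"
proof (intro cbilinearI clinearI)
  fix x x' :: 'a and y y' :: 'b and c
  have gen: "s = t" if "s = abs_tensor p" "t = abs_tensor q" "p - q \<in> bilinearity_relations"
    for s t :: "('a, 'b) tensor" and p q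
    using that by (simp add: tensor.abs_eq_iff gen_ideal.gen)
  note defs = tens.abs_eq plus_tensor.abs_eq scaleC_tensor.abs_eq
  show "x \<otimes> (y + y') = x \<otimes> y + x \<otimes> y'"
    unfolding defs by (rule gen[OF refl refl], unfold bilinearity_relations_def diff_diff_eq[symmetric]) blast
  show "x \<otimes> (c *\<^sub>C y) = c *\<^sub>C (x \<otimes> y)"
    unfolding defs by (rule gen[OF refl refl], unfold bilinearity_relations_def) blast
  show "(x + x') \<otimes> y = x \<otimes> y + x' \<otimes> y"
    unfolding defs by (rule gen[OF refl refl], unfold bilinearity_relations_def diff_diff_eq[symmetric]) blast
  show "(c *\<^sub>C x) \<otimes> y = c *\<^sub>C (x \<otimes> y)"
    unfolding defs by (rule gen[OF refl refl], unfold bilinearity_relations_def) blast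
qed

text \<open>As \<open>comult\<close> is multiplicative, this turns a generator multiplied onto the
  argument of a Sweedler sum into a change of the summand; the Hopf identities below become
  inductions over generators.\<close>

lemma tensor_lift_tens_mult:
  assumes f: "cbilinear f"
  shows "tensor_lift f ((x \<otimes> y) * t) = tensor_lift (\<lambda>u v. f (x * u) (y * v)) t"
proof -
  note f' = cbilinearD[OF f]
  have g: "cbilinear (\<lambda>u v. f (x * u) (y * v))"
    by (intro cbilinearI clinear_compose[OF f'(1)] clinear_compose[OF f'(2)] clinear_mult_left)
  note lin = clinear_simps[OF clinear_tensor_lift[OF f]] clinear_simps[OF clinear_tensor_lift[OF g]]
  show ?thesis
    by (induction t rule: tensor_induct)
      (simp_all add: distrib_left lin mult_scaleC_right tens_mult tensor_lift_tens f g)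
qed

section \<open>Homomorphisms from polynomials and from the coordinate algebra\<close>

lemma monomial_induct [case_names zero add]:
  fixes m :: "'v \<Rightarrow>\<^sub>0 nat"
  assumes "P 0" "\<And>v m. P m \<Longrightarrow> P (Poly_Mapping.single v 1 + m)"
  shows "P m"
proof -
  have *: "P (Poly_Mapping.single v k + m)" if "P m" for v k m
  proof (induction k)
    case (Suc k)
    have "Poly_Mapping.single v (Suc k) = Poly_Mapping.single v 1 + Poly_Mapping.single v k"
      by (simp flip: single_add)
    then show ?case
      using assms(2)[OF Suc, of v] by (simp only: add.assoc)
  qed (simp add: that)
  \<comment> \<open>The general starting monomial n is needed because the induction splits m into
    two summands instead of removing one variable.\<close>
  have "\<forall>n. P n \<longrightarrow> P (m + n)"
  proof (induction m rule: poly_mapping_single_induct)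
    case (add p q)
    then show ?case
      by (simp add: add.assoc)
  qed (use * in simp_all)
  from this[rule_format, OF assms(1)] show ?thesis
    by simp
qed

lemma cpoly_induct [case_names one var add scale]:
  fixes p :: "'v cpoly"
  assumes one: "P 1" and var: "\<And>v p. P p \<Longrightarrow> P (var v * p)"
    and add: "\<And>p q. P p \<Longrightarrow> P q \<Longrightarrow> P (p + q)" and scale: "\<And>c p. P p \<Longrightarrow> P (c *\<^sub>C p)"
  shows "P p"
proof -
  have "P (Poly_Mapping.single m 1)" for m
  proof (induction m rule: monomial_induct)
    case (add v m)
    have "Poly_Mapping.single (Poly_Mapping.single v 1 + m) 1 = var v * Poly_Mapping.single m 1"
      by (simp add: var_def mult_single)
    with var[OF add] show ?case by simp
  qed (use one in simp)
  from scale[OF this] have single: "P (Poly_Mapping.single m c)" for m c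
    by (simp add: scaleC_poly_mapping_def mult_single scaleC_complex_def)
  show ?thesis
    by (induction p rule: poly_mapping_single_induct) (use single[of 0 0] single add in auto)
qed

lemma clinear_poly_eval: "clinear (poly_eval f)"
  unfolding poly_eval_def by (rule clinear_linear_extension)

lemma poly_eval_scaleC: "poly_eval f (c *\<^sub>C p) = c *\<^sub>C poly_eval f p"
  by (rule clinear_scaleC[OF clinear_poly_eval])

lemma gl4_abs_surj: obtains p where "h = abs_gl4 p"
  using that[of "rep_gl4 h"] Quotient_abs_rep[OF Quotient_gl4, of h] by simp

text \<open>Monomials arise by multiplying 1 by generators on the left; zero is covered by
  \<open>scale\<close> with c = 0. Two expressions with the same recursion under left multiplication
  by generators are thereby equal.\<close>

lemma gl4_induct [case_names one entry det_inv add scale]: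
  assumes one: "P 1" and entry: "\<And>i j h. P h \<Longrightarrow> P (a_gl4 i j * h)"
    and det_inv: "\<And>h. P h \<Longrightarrow> P (det_inv * h)"
    and add: "\<And>h g. P h \<Longrightarrow> P g \<Longrightarrow> P (h + g)" and scale: "\<And>c h. P h \<Longrightarrow> P (c *\<^sub>C h)"
  shows "P h"
proof -
  have "P (abs_gl4 p)" for p
  proof (induction p rule: cpoly_induct)
    case (var v p)
    have "abs_gl4 (var v * p) = gl4_gen_elem v * abs_gl4 p"
      by (simp add: times_gl4.abs_eq gl4_gen_elem.abs_eq)
    with var show ?case
      by (cases v) (simp_all add: entry det_inv)
  qed (use one add scale in \<open>simp_all flip: one_gl4_def plus_gl4.abs_eq scaleC_gl4.abs_eq\<close>)
  then show ?thesis
    by (metis gl4_abs_surj)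
qed

definition algebra_hom :: "('a::complex_algebra \<Rightarrow> 'b::complex_algebra) \<Rightarrow> bool"
  where "algebra_hom f \<longleftrightarrow> clinear f \<and> f 1 = 1 \<and> (\<forall>x y. f (x * y) = f x * f y)"

lemma algebra_homD:
  assumes "algebra_hom f"
  shows "clinear f" "f 1 = 1" "f (x * y) = f x * f y"
  using assms by (simp_all add: algebra_hom_def)

lemma algebra_hom_abs_gl4: "algebra_hom abs_gl4"
  by (simp add: algebra_hom_def clinear_iff plus_gl4.abs_eq scaleC_gl4.abs_eq times_gl4.abs_eq
      one_gl4_def)

lemma algebra_hom_prod:
  fixes f :: "'a::comm_complex_algebra \<Rightarrow> 'b::comm_complex_algebra"
  assumes "algebra_hom f"
  shows "f (prod g A) = (\<Prod>x\<in>A. f (g x))"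
  by (induction A rule: infinite_finite_induct) (simp_all add: algebra_homD[OF assms])

lemma algebra_hom_of_int:
  fixes f :: "'a::complex_algebra \<Rightarrow> 'b::complex_algebra"
  assumes "algebra_hom f"
  shows "f (of_int k) = of_int k"
proof -
  note lin = clinear_simps[OF algebra_homD(1)[OF assms]] algebra_homD(2)[OF assms]
  have nat: "f (of_nat n) = of_nat n" for n
    by (induction n) (simp_all add: lin)
  show ?thesis
    by (cases k) (simp_all add: nat lin)
qed

lemma algebra_hom_det:
  fixes f :: "'a::comm_complex_algebra \<Rightarrow> 'b::comm_complex_algebra"
  assumes "algebra_hom f"
  shows "f (det A) = det (\<chi> i j. f (A $ i $ j))"
  by (simp add: det_def clinear_sum[OF algebra_homD(1)[OF assms]] algebra_homD[OF assms]
      algebra_hom_prod[OF assms] algebra_hom_of_int[OF assms])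

lemma gl4_hom_abs:
  assumes "d * det (\<chi> i j. f i j) = 1"
  shows "gl4_hom f d (abs_gl4 p) =
    poly_eval (\<lambda>g. case g of Entry i j \<Rightarrow> f i j | Det_Inv \<Rightarrow> d) p"
proof -
  let ?e = "poly_eval (\<lambda>g. case g of Entry i j \<Rightarrow> f i j | Det_Inv \<Rightarrow> d)"
  have "det_relation dvd rep_gl4 (abs_gl4 p) - p"
    using Quotient_rep_abs[OF Quotient_gl4, of p] by simp
  then obtain q where q: "rep_gl4 (abs_gl4 p) - p = det_relation * q"
    by (rule dvdE)
  have "?e det_relation = 0"
    using assms by (simp add: det_relation_def poly_eval_diff poly_eval_mult poly_eval_det
        generic_matrix_def)
  then have "?e (rep_gl4 (abs_gl4 p) - p) = 0"
    by (simp add: q poly_eval_mult)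
  then show ?thesis
    by (simp add: gl4_hom_def poly_eval_diff)
qed

lemma algebra_hom_gl4_hom:
  assumes "d * det (\<chi> i j. f i j) = 1"
  shows "algebra_hom (gl4_hom f d)"
proof -
  have *: "gl4_hom f d (x + y) = gl4_hom f d x + gl4_hom f d y"
    "gl4_hom f d (x * y) = gl4_hom f d x * gl4_hom f d y"
    "gl4_hom f d (c *\<^sub>C x) = c *\<^sub>C gl4_hom f d x" for x y c
  proof -
    obtain p q where "x = abs_gl4 p" "y = abs_gl4 q"
      by (metis gl4_abs_surj)
    then show "gl4_hom f d (x + y) = gl4_hom f d x + gl4_hom f d y"
      "gl4_hom f d (x * y) = gl4_hom f d x * gl4_hom f d y"
      "gl4_hom f d (c *\<^sub>C x) = c *\<^sub>C gl4_hom f d x"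
      by (simp_all add: plus_gl4.abs_eq times_gl4.abs_eq scaleC_gl4.abs_eq gl4_hom_abs[OF assms]
          poly_eval_add poly_eval_mult poly_eval_scaleC)
  qed
  have "gl4_hom f d 1 = 1"
    by (simp add: one_gl4_def gl4_hom_abs[OF assms])
  with * show ?thesis
    by (simp add: algebra_hom_def clinear_iff)
qed

lemma gl4_hom_gens:
  assumes "d * det (\<chi> i j. f i j) = 1"
  shows "gl4_hom f d (a_gl4 i j) = f i j" "gl4_hom f d det_inv = d"
  by (simp_all add: gl4_gen_elem.abs_eq gl4_hom_abs[OF assms])

definition a_matrix :: "gl4 ^ 4 ^ 4"
  where "a_matrix = (\<chi> i j. a_gl4 i j)"

lemma abs_gl4_det: "abs_gl4 (det generic_matrix) = det a_matrix"
  by (simp add: algebra_hom_det[OF algebra_hom_abs_gl4] a_matrix_def generic_matrix_def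
      gl4_gen_elem.abs_eq)

lemma det_inv_det: "det_inv * det a_matrix = 1"
proof -
  have "abs_gl4 (var Det_Inv * det generic_matrix) = abs_gl4 1"
    by (simp add: gl4.abs_eq_iff flip: det_relation_def)
  then show ?thesis
    by (simp add: algebra_homD[OF algebra_hom_abs_gl4] abs_gl4_det gl4_gen_elem.abs_eq)
qed

lemma counit_wd: "1 * det ((\<chi> i j. if i = j then 1 else 0) :: complex ^ 4 ^ 4) = 1"
  unfolding mult_1_left by (rule det_I[unfolded mat_def])

lemma algebra_hom_counit: "algebra_hom counit"
  unfolding counit_def by (rule algebra_hom_gl4_hom[OF counit_wd])

lemma counit_gens [simp]: "counit (a_gl4 i j) = (if i = j then 1 else 0)" "counit det_inv = 1"
  unfolding counit_def by (simp_all add: gl4_hom_gens[OF counit_wd])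

lemmas counit_simps [simp] = algebra_homD(2)[OF algebra_hom_counit] algebra_homD(3)[OF algebra_hom_counit]
  clinear_simps[OF algebra_homD(1)[OF algebra_hom_counit]]

lemma algebra_hom_tens: "algebra_hom (\<lambda>x. x \<otimes> 1)" "algebra_hom (\<lambda>y. 1 \<otimes> y)"
  by (simp_all add: algebra_hom_def cbilinearD[OF cbilinear_tens] tens_one tens_mult)

text \<open>The matrix of coproducts is the matrix product of \<open>a \<otimes> 1\<close> and
  \<open>1 \<otimes> a\<close>, so its determinant is \<open>det a \<otimes> det a\<close>.\<close>

lemma comult_wd: "(det_inv \<otimes> det_inv) * det (\<chi> m n. \<Sum>k\<in>UNIV. a_gl4 m k \<otimes> a_gl4 k n) = 1"
proof -
  have "(\<chi> m n. \<Sum>k\<in>UNIV. a_gl4 m k \<otimes> a_gl4 k n) =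
      (\<chi> i j. a_matrix $ i $ j \<otimes> 1) ** (\<chi> i j. 1 \<otimes> a_matrix $ i $ j)"
    by (simp add: vec_eq_iff matrix_matrix_mult_def a_matrix_def tens_mult)
  then have "det (\<chi> m n. \<Sum>k\<in>UNIV. a_gl4 m k \<otimes> a_gl4 k n) = det a_matrix \<otimes> det a_matrix"
    by (simp only: det_mul algebra_hom_det[OF algebra_hom_tens(1), symmetric]
        algebra_hom_det[OF algebra_hom_tens(2), symmetric] tens_mult mult_1_left mult_1_right)
  then show ?thesis
    by (simp add: tens_mult det_inv_det tens_one)
qed

lemma algebra_hom_comult: "algebra_hom comult"
  unfolding comult_def by (rule algebra_hom_gl4_hom[OF comult_wd])

lemma comult_gens:
  "comult (a_gl4 i j) = (\<Sum>k\<in>UNIV. a_gl4 i k \<otimes> a_gl4 k j)" "comult det_inv = det_inv \<otimes> det_inv"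
  unfolding comult_def by (simp_all add: gl4_hom_gens[OF comult_wd])

text \<open>The matrix is unipotent. A nonzero product in the Leibniz formula forces the permutation
  to fix \<open>I34\<close> pointwise, and injectivity then forces it to fix \<open>I12\<close>,
  which leaves the identity.\<close>

lemma det_restriction:
  fixes t :: "4 \<Rightarrow> 4 \<Rightarrow> 'a::comm_ring_1"
  shows "det (\<chi> m n. if m \<in> I12 \<and> n \<in> I34 then t m n else if m = n then 1 else 0) = 1"
proof -
  define M where "M = (\<lambda>m n. if m \<in> I12 \<and> n \<in> I34 then t m n else if m = n then 1 else 0)"
  have M: "j = i \<or> i \<in> I12 \<and> j \<in> I34" if "M i j \<noteq> 0" for i j
    using that unfolding M_def by presburger
  have diag: "M i i = 1" for i
    by (auto simp: M_def)
  have I: "i \<in> I12 \<or> i \<in> I34" for i :: 4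
    using exhaust_4[of i] by auto
  have disj: "I12 \<inter> I34 = {}"
    by simp
  have zero: "of_int (sign p) * (\<Prod>i\<in>UNIV. M i (p i)) = 0" if p: "p permutes UNIV" "p \<noteq> id" for p
  proof -
    have "(\<Prod>i\<in>UNIV. M i (p i)) = 0"
    proof (rule ccontr)
      assume *: "(\<Prod>i\<in>UNIV. M i (p i)) \<noteq> 0"
      have nz: "M i (p i) \<noteq> 0" for i
      proof
        assume "M i (p i) = 0"
        then have "(\<Prod>i\<in>UNIV. M i (p i)) = 0"
          by (intro prod_zero) auto
        with * show False ..
      qed
      have inj: "inj p"
        using p(1) by (rule permutes_inj)
      have 34: "p i = i" if "i \<in> I34" for i
        using M[OF nz[of i]] that disj by blast
      have 12: "p i = i" if "i \<in> I12" for i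
        using M[OF nz[of i]] 34[of "p i"] injD[OF inj, of "p i" i] by blast
      have "p i = i" for i
        using I 12 34 by blast
      then have "p = id"
        by (simp add: fun_eq_iff)
      with p(2) show False ..
    qed
    then show ?thesis
      by simp
  qed
  have "det (\<chi> m n. M m n) =
      (\<Sum>p\<in>{p. p permutes UNIV}. of_int (sign p) * (\<Prod>i\<in>UNIV. M i (p i)))"
    by (simp only: det_def vec_lambda_beta)
  also have "\<dots> = (\<Sum>p\<in>{id}. of_int (sign p) * (\<Prod>i\<in>UNIV. M i (p i)))"
    using zero by (intro sum.mono_neutral_right) (auto simp: finite_permutations permutes_id)
  also have "\<dots> = 1"
    by (simp add: diag sign_id)
  finally show ?thesis
    by (simp only: M_def)
qed

lemma restrict_wd: "1 * det (\<chi> i j. if i \<in> I12 \<and> j \<in> I34 then var (t_var i j)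
    else if i = j then 1 else 0) = 1"
  unfolding mult_1_left by (rule det_restriction)

lemma algebra_hom_restrict: "algebra_hom res"
  unfolding restrict_to_translations_def by (rule algebra_hom_gl4_hom[OF restrict_wd])

lemma restrict_gens:
  "res (a_gl4 i j) =
    (if i \<in> I12 \<and> j \<in> I34 then var (t_var i j) else if i = j then 1 else 0)"
  "res det_inv = 1"
  unfolding restrict_to_translations_def by (simp_all only: gl4_hom_gens[OF restrict_wd])

lemmas restrict_simps = algebra_homD(2)[OF algebra_hom_restrict]
  algebra_homD(3)[OF algebra_hom_restrict] clinear_simps[OF algebra_homD(1)[OF algebra_hom_restrict]]

section \<open>Sweedler notation\<close>

lemma cbilinear_iff:
  "cbilinear f \<longleftrightarrow> (\<forall>x x' y. f (x + x') y = f x y + f x' y) \<and> (\<forall>c x y. f (c *\<^sub>C x) y = c *\<^sub>C f x y)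
    \<and> (\<forall>x y y'. f x (y + y') = f x y + f x y') \<and> (\<forall>c x y. f x (c *\<^sub>C y) = c *\<^sub>C f x y)"
  unfolding cbilinear_def clinear_iff by blast

definition ctrilinear ::
  "('a::complex_algebra \<Rightarrow> 'b::complex_algebra \<Rightarrow> 'd::complex_algebra \<Rightarrow> 'c::complex_algebra) \<Rightarrow> bool"
  where "ctrilinear f \<longleftrightarrow>
      (\<forall>x x' y z. f (x + x') y z = f x y z + f x' y z) \<and> (\<forall>c x y z. f (c *\<^sub>C x) y z = c *\<^sub>C f x y z)
    \<and> (\<forall>x y y' z. f x (y + y') z = f x y z + f x y' z) \<and> (\<forall>c x y z. f x (c *\<^sub>C y) z = c *\<^sub>C f x y z)
    \<and> (\<forall>x y z z'. f x y (z + z') = f x y z + f x y z') \<and> (\<forall>c x y z. f x y (c *\<^sub>C z) = c *\<^sub>C f x y z)"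

text \<open>A Sweedler sum is a finite sum over one representative, so it is linear in the summand f
  without any hypothesis on f. Bilinearity of f matters only for varying h.\<close>

lemma sweedler2_eq_sum:
  "sweedler2 f h = (\<Sum>k\<in>Poly_Mapping.keys (rep_tensor (comult h)).
    Poly_Mapping.lookup (rep_tensor (comult h)) k *\<^sub>C (case k of Pair_Key x y \<Rightarrow> f x y))"
  by (simp add: sweedler2_def tensor_lift_def linear_extension_def)

lemma clinear_sweedler2:
  assumes "clinear u"
  shows "u (sweedler2 f h) = sweedler2 (\<lambda>x y. u (f x y)) h"
  by (auto simp: sweedler2_eq_sum clinear_simps[OF assms] intro!: sum.cong split: pair_key.split)

lemma sweedler2_fun_add: "sweedler2 (\<lambda>x y. f x y + g x y) h = sweedler2 f h + sweedler2 g h"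
  unfolding sweedler2_eq_sum
  by (subst sum.distrib[symmetric], rule sum.cong)
    (simp_all add: scaleC_add_right split: pair_key.split)

lemma sweedler2_fun_scaleC: "sweedler2 (\<lambda>x y. c *\<^sub>C f x y) h = c *\<^sub>C sweedler2 f h"
  by (rule clinear_sweedler2[OF clinear_scale, symmetric])

lemma sweedler2_fun_mult_left: "sweedler2 (\<lambda>x y. c * f x y) h = c * sweedler2 f h"
  by (rule clinear_sweedler2[OF clinear_mult_left, symmetric])

lemma sweedler2_fun_mult_right: "sweedler2 (\<lambda>x y. f x y * c) h = sweedler2 f h * c"
  by (rule clinear_sweedler2[OF clinear_mult_right, symmetric])

lemma sweedler2_fun_scaleC_right: "sweedler2 (\<lambda>x y. f x y *\<^sub>C v) h = sweedler2 f h *\<^sub>C v"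
  by (rule clinear_sweedler2[symmetric, of "\<lambda>c. c *\<^sub>C v"])
    (simp add: clinear_iff scaleC_simps scaleC_complex_def)

lemma sweedler2_fun_zero: "sweedler2 (\<lambda>x y. 0) h = 0"
  using sweedler2_fun_scaleC[of 0 "\<lambda>x y. 0" h] by simp

lemma sweedler2_fun_sum: "sweedler2 (\<lambda>x y. \<Sum>i\<in>A. f i x y) h = (\<Sum>i\<in>A. sweedler2 (f i) h)"
  by (induction A rule: infinite_finite_induct) (simp_all add: sweedler2_fun_add sweedler2_fun_zero)

lemma sweedler2_fun_uminus: "sweedler2 (\<lambda>x y. - f x y) h = - sweedler2 f h"
  using sweedler2_fun_scaleC[of "- 1" f h] by (simp add: scaleC_minus_one)

lemma sweedler2_fun_diff: "sweedler2 (\<lambda>x y. f x y - g x y) h = sweedler2 f h - sweedler2 g h"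
  using sweedler2_fun_add[of f "\<lambda>x y. - g x y" h] by (simp add: sweedler2_fun_uminus)

lemma sweedler2_if: "sweedler2 (\<lambda>x y. if P then f x y else g x y) h = (if P then sweedler2 f h else sweedler2 g h)"
  by simp

lemmas sweedler2_fun = sweedler2_fun_add sweedler2_fun_scaleC sweedler2_fun_mult_left
  sweedler2_fun_mult_right sweedler2_fun_scaleC_right sweedler2_fun_zero sweedler2_fun_sum
  sweedler2_fun_uminus sweedler2_fun_diff

text \<open>Interchange of two finite sums, valid for arbitrary f.\<close>

lemma sweedler2_swap:
  "sweedler2 (\<lambda>x y. sweedler2 (\<lambda>u v. f x y u v) g) h = sweedler2 (\<lambda>u v. sweedler2 (\<lambda>x y. f x y u v) h) g"
proof -
  have "sweedler2 (\<lambda>x y. sweedler2 (\<lambda>u v. f x y u v) g) h =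
      (\<Sum>l\<in>Poly_Mapping.keys (rep_tensor (comult g)). Poly_Mapping.lookup (rep_tensor (comult g)) l *\<^sub>C
        sweedler2 (\<lambda>x y. case l of Pair_Key u v \<Rightarrow> f x y u v) h)"
    by (simp only: sweedler2_eq_sum[of _ g] sweedler2_fun)
  also have "\<dots> = sweedler2 (\<lambda>u v. sweedler2 (\<lambda>x y. f x y u v) h) g"
    unfolding sweedler2_eq_sum[of _ g] by (auto intro!: sum.cong split: pair_key.split)
  finally show ?thesis .
qed

lemma clinear_sweedler2_elem:
  assumes "cbilinear f"
  shows "clinear (sweedler2 f)"
  unfolding sweedler2_def
  by (rule clinear_compose[OF clinear_tensor_lift[OF assms] algebra_homD(1)[OF algebra_hom_comult]])

lemmas sweedler2_elem = clinear_simps[OF clinear_sweedler2_elem]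

lemma sweedler2_one: "cbilinear f \<Longrightarrow> sweedler2 f 1 = f 1 1"
  by (simp add: sweedler2_def algebra_homD(2)[OF algebra_hom_comult] flip: tens_one)

lemma sweedler2_entry:
  assumes "cbilinear f"
  shows "sweedler2 f (a_gl4 i j * h) = (\<Sum>k\<in>UNIV. sweedler2 (\<lambda>x y. f (a_gl4 i k * x) (a_gl4 k j * y)) h)"
  by (simp add: sweedler2_def algebra_homD(3)[OF algebra_hom_comult] comult_gens sum_distrib_right
      clinear_sum[OF clinear_tensor_lift[OF assms]] tensor_lift_tens_mult[OF assms])

lemma sweedler2_det_inv:
  assumes "cbilinear f"
  shows "sweedler2 f (det_inv * h) = sweedler2 (\<lambda>x y. f (det_inv * x) (det_inv * y)) h"
  by (simp add: sweedler2_def algebra_homD(3)[OF algebra_hom_comult] comult_gens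
      tensor_lift_tens_mult[OF assms])

lemmas bilin = cbilinear_iff distrib_left distrib_right scaleC_simps sweedler2_fun sweedler2_elem
  scaleC_complex_def

lemma sweedler2_counit:
  assumes "clinear f"
  shows "sweedler2 (\<lambda>x y. counit x *\<^sub>C f y) h = f h" "sweedler2 (\<lambda>x y. counit y *\<^sub>C f x) h = f h"
proof -
  have b: "cbilinear (\<lambda>x y. counit x *\<^sub>C y)" "cbilinear (\<lambda>x y. counit y *\<^sub>C x)"
    by (simp_all add: bilin mult.commute)
  have m: "sweedler2 (\<lambda>x y. counit x *\<^sub>C (a * y)) h = a * sweedler2 (\<lambda>x y. counit x *\<^sub>C y) h"
    "sweedler2 (\<lambda>x y. counit y *\<^sub>C (a * x)) h = a * sweedler2 (\<lambda>x y. counit y *\<^sub>C x) h" for a h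
    by (simp_all add: sweedler2_fun_mult_left flip: mult_scaleC_right)
  note simps = m sweedler2_if sweedler2_one sweedler2_entry sweedler2_det_inv sweedler2_elem b mult_scaleC_right
    sweedler2_fun scaleC_one if_distrib[of "\<lambda>c. c * _"] if_distrib[of "\<lambda>c. c *\<^sub>C _"]
    if_distribR scaleC_scaleC[symmetric]
  have "sweedler2 (\<lambda>x y. counit x *\<^sub>C y) h = h"
    by (induction h rule: gl4_induct) (simp_all add: simps cong: if_cong)
  then have "f (sweedler2 (\<lambda>x y. counit x *\<^sub>C y) h) = f h" by simp
  then show "sweedler2 (\<lambda>x y. counit x *\<^sub>C f y) h = f h"
    by (simp add: clinear_sweedler2[OF assms] clinear_simps[OF assms])
  have "sweedler2 (\<lambda>x y. counit y *\<^sub>C x) h = h"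
    by (induction h rule: gl4_induct) (simp_all add: simps cong: if_cong)
  then have "f (sweedler2 (\<lambda>x y. counit y *\<^sub>C x) h) = f h" by simp
  then show "sweedler2 (\<lambda>x y. counit y *\<^sub>C f x) h = f h"
    by (simp add: clinear_sweedler2[OF assms] clinear_simps[OF assms])
qed

lemma ctrilinear_cbilinear:
  assumes "ctrilinear f"
  shows "cbilinear (\<lambda>u v. f u v z)" "cbilinear (f x)"
    "cbilinear (\<lambda>x z. sweedler2 (\<lambda>u v. f u v z) x)" "cbilinear (\<lambda>u y. sweedler2 (f u) y)"
proof -
  show f: "cbilinear (\<lambda>u v. f u v z)" "cbilinear (f x)" for x z
    using assms by (auto simp add: ctrilinear_def bilin)
  have "f (x + x') = (\<lambda>v z. f x v z + f x' v z)" "f (c *\<^sub>C x) = (\<lambda>v z. c *\<^sub>C f x v z)" for x x' c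
    using assms by (auto simp: fun_eq_iff ctrilinear_def)
  then show "cbilinear (\<lambda>u y. sweedler2 (f u) y)"
    using f by (auto simp: cbilinear_iff sweedler2_fun sweedler2_elem)
  show "cbilinear (\<lambda>x z. sweedler2 (\<lambda>u v. f u v z) x)"
    using assms f by (auto simp: ctrilinear_def cbilinear_iff sweedler2_fun sweedler2_elem)
qed

lemma ctrilinear_mult: "ctrilinear f \<Longrightarrow> ctrilinear (\<lambda>u v z. f (a * u) (b * v) (c * z))"
  by (simp add: ctrilinear_def distrib_left mult_scaleC_right)

text \<open>The induction must keep f arbitrary: a generator in front of h is absorbed into f, which
  stays trilinear, and the two intermediate matrix indices are summed in either order.\<close>

lemma coassoc:
  assumes "ctrilinear f"
  shows "sweedler2 (\<lambda>x z. sweedler2 (\<lambda>u v. f u v z) x) h = sweedler2 (\<lambda>u y. sweedler2 (\<lambda>v z. f u v z) y) h"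
  using assms
proof (induction h arbitrary: f rule: gl4_induct)
  case one
  note f = ctrilinear_cbilinear[OF one.prems]
  show ?case by (simp add: sweedler2_one f)
next
  case (entry i j h)
  note f = ctrilinear_cbilinear[OF entry.prems] and m = ctrilinear_mult[OF entry.prems]
  note b = ctrilinear_cbilinear(1,2)[OF m]
  have "sweedler2 (\<lambda>x z. sweedler2 (\<lambda>u v. f u v z) x) (a_gl4 i j * h) =
    (\<Sum>k\<in>UNIV. \<Sum>l\<in>UNIV. sweedler2 (\<lambda>x z. sweedler2 (\<lambda>u v.
      f (a_gl4 i l * u) (a_gl4 l k * v) (a_gl4 k j * z)) x) h)"
    by (simp add: sweedler2_entry f b sweedler2_fun)
  also have "\<dots> = (\<Sum>l\<in>UNIV. \<Sum>k\<in>UNIV. sweedler2 (\<lambda>u y. sweedler2 (\<lambda>v z.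
      f (a_gl4 i l * u) (a_gl4 l k * v) (a_gl4 k j * z)) y) h)"
    unfolding entry.IH[OF m] by (rule sum.swap)
  also have "\<dots> = sweedler2 (\<lambda>u y. sweedler2 (\<lambda>v z. f u v z) y) (a_gl4 i j * h)"
    by (simp add: sweedler2_entry f b sweedler2_fun)
  finally show ?case .
next
  case (det_inv h)
  note f = ctrilinear_cbilinear[OF det_inv.prems] and m = ctrilinear_mult[OF det_inv.prems]
  note b = ctrilinear_cbilinear(1,2)[OF m]
  show ?case
    by (simp add: sweedler2_det_inv f b det_inv.IH[OF m])
next
  case (add h g)
  note f = ctrilinear_cbilinear[OF add.prems]
  show ?case by (simp add: sweedler2_elem f add)
next
  case (scale c h)
  note f = ctrilinear_cbilinear[OF scale.prems]
  show ?case by (simp add: sweedler2_elem f scale)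
qed

lemma sweedler3_alt:
  "ctrilinear f \<Longrightarrow> sweedler3 f h = sweedler2 (\<lambda>u y. sweedler2 (\<lambda>v z. f u v z) y) h"
  by (simp add: sweedler3_def coassoc)

lemma sweedler3_entry:
  assumes "ctrilinear f"
  shows "sweedler3 f (a_gl4 i j * h) = (\<Sum>k\<in>UNIV. \<Sum>l\<in>UNIV.
    sweedler3 (\<lambda>x y z. f (a_gl4 i k * x) (a_gl4 k l * y) (a_gl4 l j * z)) h)"
proof -
  note f = ctrilinear_cbilinear[OF assms] and m = ctrilinear_mult[OF assms]
  note b = ctrilinear_cbilinear(1,2)[OF m]
  show ?thesis
    unfolding sweedler3_alt[OF assms] sweedler3_alt[OF m]
    by (simp add: sweedler2_entry f b sweedler2_fun)
qed

lemma sweedler3_det_inv: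
  assumes "ctrilinear f"
  shows "sweedler3 f (det_inv * h) =
    sweedler3 (\<lambda>x y z. f (det_inv * x) (det_inv * y) (det_inv * z)) h"
proof -
  note f = ctrilinear_cbilinear[OF assms] and m = ctrilinear_mult[OF assms]
  note b = ctrilinear_cbilinear(1,2)[OF m]
  show ?thesis
    unfolding sweedler3_alt[OF assms] sweedler3_alt[OF m]
    by (simp add: sweedler2_det_inv f b)
qed

lemma clinear_sweedler3: "clinear u \<Longrightarrow> u (sweedler3 f h) = sweedler3 (\<lambda>x y z. u (f x y z)) h"
  by (simp add: sweedler3_def clinear_sweedler2)

lemma clinear_sweedler3_elem: "ctrilinear f \<Longrightarrow> clinear (sweedler3 f)"
  unfolding sweedler3_def by (intro clinear_sweedler2_elem ctrilinear_cbilinear)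

lemma sweedler3_grouplike:
  assumes "ctrilinear f" "comult g = g \<otimes> g"
  shows "sweedler3 f g = f g g g"
  using ctrilinear_cbilinear[OF assms(1)] by (simp add: sweedler3_def sweedler2_def assms(2))

section \<open>Functionals acting by contraction with one leg of the coproduct\<close>

definition lact :: "(gl4 \<Rightarrow> complex) \<Rightarrow> gl4 \<Rightarrow> gl4"
  where "lact u h = sweedler2 (\<lambda>x y. u x *\<^sub>C y) h"

definition ract :: "(gl4 \<Rightarrow> complex) \<Rightarrow> gl4 \<Rightarrow> gl4"
  where "ract u h = sweedler2 (\<lambda>x y. u y *\<^sub>C x) h"

lemma cbilinear_act:
  assumes "clinear u"
  shows "cbilinear (\<lambda>x y. u x *\<^sub>C (y::gl4))" "cbilinear (\<lambda>x y. u y *\<^sub>C (x::gl4))"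
  by (simp_all add: cbilinear_iff clinear_simps[OF assms] scaleC_simps scaleC_complex_def mult.commute)

lemma clinear_act: "clinear u \<Longrightarrow> clinear (lact u)" "clinear u \<Longrightarrow> clinear (ract u)"
  unfolding lact_def[abs_def] ract_def[abs_def]
  by (rule clinear_sweedler2_elem, erule cbilinear_act)+

lemma sweedler2_lact:
  assumes f: "cbilinear f" and u: "clinear u"
  shows "sweedler2 f (lact u h) = sweedler2 (\<lambda>x y. f (lact u x) y) h"
proof -
  have "ctrilinear (\<lambda>x y z. u x *\<^sub>C f y z)"
    using f by (simp add: ctrilinear_def cbilinear_iff clinear_simps[OF u] scaleC_simps
        scaleC_complex_def mult.commute)
  from coassoc[OF this, of h] show ?thesis
    by (simp add: lact_def clinear_sweedler2[OF clinear_sweedler2_elem[OF f]] sweedler2_elem[OF f]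
        clinear_sweedler2[OF cbilinearD(2)[OF f]] clinear_simps[OF cbilinearD(2)[OF f]] sweedler2_fun)
qed

lemma sweedler2_ract:
  assumes f: "cbilinear f" and u: "clinear u"
  shows "sweedler2 f (ract u h) = sweedler2 (\<lambda>x y. f x (ract u y)) h"
proof -
  have "ctrilinear (\<lambda>x y z. u z *\<^sub>C f x y)"
    using f by (simp add: ctrilinear_def cbilinear_iff clinear_simps[OF u] scaleC_simps
        scaleC_complex_def mult.commute)
  from coassoc[OF this, of h] show ?thesis
    by (simp add: ract_def clinear_sweedler2[OF clinear_sweedler2_elem[OF f]] sweedler2_elem[OF f]
        clinear_sweedler2[OF cbilinearD(1)[OF f]] clinear_simps[OF cbilinearD(1)[OF f]] sweedler2_fun)
qed

text \<open>Both sides contract u with the middle leg of the threefold coproduct. This moves an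
  operator from one leg to the other, exchanging row and column actions.\<close>

lemma sweedler2_ract_lact:
  assumes f: "cbilinear f" and u: "clinear u"
  shows "sweedler2 (\<lambda>x y. f (ract u x) y) h = sweedler2 (\<lambda>x y. f x (lact u y)) h"
proof -
  have "ctrilinear (\<lambda>x y z. u y *\<^sub>C f x z)"
    using f by (simp add: ctrilinear_def cbilinear_iff clinear_simps[OF u] scaleC_simps
        scaleC_complex_def mult.commute)
  from coassoc[OF this, of h] show ?thesis
    by (simp add: ract_def lact_def clinear_sweedler2[OF cbilinearD(1)[OF f]]
        clinear_simps[OF cbilinearD(1)[OF f]]
        clinear_sweedler2[OF cbilinearD(2)[OF f]] clinear_simps[OF cbilinearD(2)[OF f]])
qed

lemma sweedler3_lact:
  assumes "ctrilinear f" "clinear u"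
  shows "sweedler3 f (lact u h) = sweedler3 (\<lambda>x y z. f (lact u x) y z) h"
  unfolding sweedler3_def
  by (simp add: sweedler2_lact ctrilinear_cbilinear assms)

lemma sweedler3_ract:
  assumes "ctrilinear f" "clinear u"
  shows "sweedler3 f (ract u h) = sweedler3 (\<lambda>x y z. f x y (ract u z)) h"
  unfolding sweedler3_def
  by (simp add: sweedler2_ract ctrilinear_cbilinear assms)

lemma lact_ract:
  assumes "clinear u" "clinear v"
  shows "lact u (ract v h) = ract v (lact u h)"
proof -
  have "lact u (ract v h) = sweedler2 (\<lambda>x y. u x *\<^sub>C ract v y) h"
    unfolding lact_def by (rule sweedler2_ract[OF cbilinear_act(1)[OF assms(1)] assms(2)])
  then show ?thesis
    by (simp add: lact_def clinear_sweedler2 clinear_simps clinear_act assms)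
qed

text \<open>The monoid argument g = g (f k) = (g f) k = k. Values in a general algebra serve both
  the antipode, where f is the identity map, and inverses of functionals.\<close>

lemma convolution_inverse_unique:
  fixes f g k :: "gl4 \<Rightarrow> 'c::comm_complex_algebra"
  assumes lin: "clinear f" "clinear g" "clinear k"
    and gf: "\<And>h. sweedler2 (\<lambda>x y. g x * f y) h = counit h *\<^sub>C 1"
    and fk: "\<And>h. sweedler2 (\<lambda>x y. f x * k y) h = counit h *\<^sub>C 1"
  shows "g = k"
proof
  fix h
  have tri: "ctrilinear (\<lambda>x y z. g x * f y * k z)"
    by (simp add: ctrilinear_def clinear_simps[OF lin(1)] clinear_simps[OF lin(2)]
        clinear_simps[OF lin(3)] distrib_left distrib_right scaleC_simps)
  have "g h = sweedler2 (\<lambda>x y. g x * (counit y *\<^sub>C 1)) h"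
    by (simp add: scaleC_simps sweedler2_counit lin)
  also have "\<dots> = sweedler2 (\<lambda>u y. sweedler2 (\<lambda>v z. g u * f v * k z) y) h"
    by (simp only: fk[symmetric] sweedler2_fun_mult_left mult.assoc)
  also have "\<dots> = sweedler2 (\<lambda>x z. sweedler2 (\<lambda>u v. g u * f v) x * k z) h"
    by (simp only: coassoc[OF tri, symmetric] sweedler2_fun_mult_right)
  also have "\<dots> = k h"
    by (simp add: gf scaleC_simps sweedler2_counit lin)
  finally show "g h = k h" .
qed

lemma sweedler2_counit_id:
  "sweedler2 (\<lambda>x y. counit x *\<^sub>C y) h = h" "sweedler2 (\<lambda>x y. counit y *\<^sub>C x) h = h"
  using sweedler2_counit[of "\<lambda>x. x" h] by (simp_all add: clinear_iff)

section \<open>The translation cocycle\<close>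

lemma clinear_partial_deriv: "clinear (partial_deriv v)"
  unfolding partial_deriv_def by (rule clinear_linear_extension)

lemmas partial_deriv_simps = clinear_simps[OF clinear_partial_deriv]

lemma partial_deriv_single:
  "partial_deriv u (Poly_Mapping.single m c) =
    Poly_Mapping.single (m - Poly_Mapping.single u 1) (c * of_nat (Poly_Mapping.lookup m u))"
  by (simp add: partial_deriv_def scaleC_poly_mapping_def mult_single scaleC_complex_def)

lemma partial_deriv_one [simp]: "partial_deriv u 1 = 0"
  by (simp add: partial_deriv_single flip: single_one)

lemma partial_deriv_var_mult:
  "partial_deriv u (var v * p) = (if u = v then p else 0) + var v * partial_deriv u p"
proof (induction p rule: poly_mapping_single_induct)
  case (single m c)
  have *: "Poly_Mapping.single v 1 + m - Poly_Mapping.single u 1 =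
      (if u = v then m else Poly_Mapping.single v 1 + (m - Poly_Mapping.single u 1))"
    by (rule poly_mapping_eqI) (auto simp: lookup_minus lookup_add lookup_single when_def)
  \<comment> \<open>Subtraction of exponents is truncated, so it can be undone only for a nonzero
    exponent; for exponent 0 the derivative has coefficient 0.\<close>
  have **: "Poly_Mapping.single v 1 + (m - Poly_Mapping.single v 1) = m"
    if "Poly_Mapping.lookup m v \<noteq> 0"
    using that by (intro poly_mapping_eqI) (auto simp: lookup_minus lookup_add lookup_single when_def)
  show ?case
  proof (cases "u = v")
    case True
    show ?thesis
    proof (cases "Poly_Mapping.lookup m v = 0")
      case False
      with True show ?thesis
        using * ** by (simp add: var_def mult_single partial_deriv_single lookup_add algebra_simps
            flip: single_add)
    qed (use True * in \<open>simp add: var_def mult_single partial_deriv_single lookup_add\<close>)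
  next
    case False
    with * show ?thesis
      by (simp add: var_def mult_single partial_deriv_single lookup_add lookup_single)
  qed
qed (simp_all add: distrib_left partial_deriv_simps)

lemma partial_deriv_commute: "partial_deriv u (partial_deriv v p) = partial_deriv v (partial_deriv u p)"
  by (induction p rule: cpoly_induct)
    (simp_all add: partial_deriv_simps partial_deriv_var_mult)

lemma trans_var_cases:
  obtains A A' where "A \<in> I12" "A' \<in> I34" "v = t_var A A'"
proof -
  obtain A A' where "Rep_trans_var v = (A, A')" "A \<in> I12" "A' \<in> I34"
    using Rep_trans_var[of v] by auto
  with that show ?thesis
    by (metis Rep_trans_var_inverse t_var_def)
qed

lemma t_var_eq_iff:
  "A \<in> I12 \<Longrightarrow> A' \<in> I34 \<Longrightarrow> B \<in> I12 \<Longrightarrow> B' \<in> I34 \<Longrightarrow> t_var A A' = t_var B B' \<longleftrightarrow> A = B \<and> A' = B'"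
  unfolding t_var_def by (subst Abs_trans_var_inject) auto

lemma sum_t_var_eq:
  fixes f :: "4 \<Rightarrow> 4 \<Rightarrow> 'c::comm_monoid_add"
  assumes "A \<in> I12" "A' \<in> I34"
  shows "(\<Sum>B\<in>I12. \<Sum>B'\<in>I34. if t_var B B' = t_var A A' then f B B' else 0) = f A A'"
proof -
  have "(\<Sum>B\<in>I12. \<Sum>B'\<in>I34. if t_var B B' = t_var A A' then f B B' else 0) =
      (\<Sum>B\<in>I12. \<Sum>B'\<in>I34. if B' = A' then (if B = A then f B B' else 0) else 0)"
    using assms by (intro sum.cong refl) (auto simp add: t_var_eq_iff)
  also have "\<dots> = f A A'"
    using assms by (simp only: sum.delta finite.insertI finite.emptyI if_True)
  finally show ?thesis .
qed

context
  fixes t :: theta_parameter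
begin

lemma clinear_pairing:
  "clinear (\<lambda>h. pairing t n h g)" "clinear (pairing t n h)"
proof -
  have "(\<forall>h h' g. pairing t n (h + h') g =
        pairing t n h g + pairing t n h' g) \<and>
      (\<forall>c h g. pairing t n (c *\<^sub>C h) g = c *\<^sub>C pairing t n h g) \<and>
      (\<forall>h g g'. pairing t n h (g + g') =
        pairing t n h g + pairing t n h g') \<and>
      (\<forall>c h g. pairing t n h (c *\<^sub>C g) = c *\<^sub>C pairing t n h g)"
    by (induction n)
      (simp_all add: poly_eval_add poly_eval_scaleC scaleC_complex_def distrib_left distrib_right
        partial_deriv_simps sum.distrib sum_distrib_left mult.left_commute del: sum.insert sum.empty)
  then show "clinear (\<lambda>h. pairing t n h g)"
    "clinear (pairing t n h)"
    by (simp_all add: clinear_iff)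
qed

lemmas pairing_simps =
  clinear_simps[OF clinear_pairing(1)]
  clinear_simps[OF clinear_pairing(2)]

text \<open>The commutator of \<theta> \<partial> \<otimes> \<partial> with multiplication by a
  coordinate in the first slot is a derivative in the second slot, which commutes with everything in
  sight. An nth power therefore yields this commutator n times, and the remaining term vanishes at
  the origin.\<close>

lemma pairing_var:
  assumes "A \<in> I12" "A' \<in> I34"
  shows "pairing t n (var (t_var A A') * h) g =
    of_nat n * (\<Sum>B\<in>I12. \<Sum>B'\<in>I34. t A B A' B' *
      pairing t (n - 1) h (partial_deriv (t_var B B') g))"
proof (induction n arbitrary: h g)
  case 0
  then show ?case by (simp add: poly_eval_mult)
next
  case (Suc n)
  let ?P = "pairing t" and ?D = "\<lambda>B B'. partial_deriv (t_var B B')"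
  have "?P (Suc n) (var (t_var A A') * h) g =
      (\<Sum>C\<in>I12. \<Sum>B\<in>I12. \<Sum>C'\<in>I34. \<Sum>B'\<in>I34. (if t_var C C' = t_var A A' then t C B C' B' * ?P n h (?D B B' g) else 0))
    + (\<Sum>C\<in>I12. \<Sum>B\<in>I12. \<Sum>C'\<in>I34. \<Sum>B'\<in>I34. t C B C' B' * ?P n (var (t_var A A') * ?D C C' h) (?D B B' g))"
    by (simp add: partial_deriv_var_mult pairing_simps distrib_left sum.distrib
        if_distrib[of "\<lambda>h. ?P n h _"] if_distrib[of "\<lambda>h. _ * h"] cong: if_cong del: sum.insert sum.empty)
  also have "(\<Sum>C\<in>I12. \<Sum>B\<in>I12. \<Sum>C'\<in>I34. \<Sum>B'\<in>I34. (if t_var C C' = t_var A A' then t C B C' B' * ?P n h (?D B B' g) else 0))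
    = (\<Sum>C\<in>I12. \<Sum>C'\<in>I34. (if t_var C C' = t_var A A' then
        \<Sum>B\<in>I12. \<Sum>B'\<in>I34. t C B C' B' * ?P n h (?D B B' g) else 0))"
  proof (rule sum.cong[OF refl], rule trans[OF sum.swap], rule sum.cong[OF refl])
    fix C C'
    show "(\<Sum>B\<in>I12. \<Sum>B'\<in>I34. if t_var C C' = t_var A A' then t C B C' B' * ?P n h (?D B B' g) else 0) =
      (if t_var C C' = t_var A A' then \<Sum>B\<in>I12. \<Sum>B'\<in>I34. t C B C' B' * ?P n h (?D B B' g) else 0)"
      by (cases "t_var C C' = t_var A A'") simp_all
  qed
  also have "\<dots> = (\<Sum>B\<in>I12. \<Sum>B'\<in>I34. t A B A' B' * ?P n h (?D B B' g))"
    by (rule sum_t_var_eq[OF assms])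
  also have "(\<Sum>C\<in>I12. \<Sum>B\<in>I12. \<Sum>C'\<in>I34. \<Sum>B'\<in>I34. t C B C' B' * ?P n (var (t_var A A') * ?D C C' h) (?D B B' g))
    = of_nat n * (\<Sum>E\<in>I12. \<Sum>E'\<in>I34. t A E A' E' *
        (\<Sum>C\<in>I12. \<Sum>B\<in>I12. \<Sum>C'\<in>I34. \<Sum>B'\<in>I34. t C B C' B' * ?P (n - 1) (?D C C' h) (?D B B' (?D E E' g))))"
    unfolding Suc.IH
    by (simp add: algebra_simps partial_deriv_commute)
  \<comment> \<open>For n = 0 the truncated n - 1 is harmless because of the factor n; otherwise the
    inner sum is the defining recursion of the nth power.\<close>
  also have "\<dots> = of_nat n * (\<Sum>E\<in>I12. \<Sum>E'\<in>I34. t A E A' E' * ?P n h (?D E E' g))"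
    by (cases n) simp_all
  finally show ?case
    by (simp add: distrib_right del: sum.insert sum.empty translation_pairing_power.simps)
qed

text \<open>The bound depends on h alone: each coordinate factor costs one more power, uniformly in
  g.\<close>

lemma pairing_eventually_zero:
  "\<exists>N. \<forall>n\<ge>N. \<forall>g. pairing t n h g = 0"
proof (induction h rule: cpoly_induct)
  case one
  have "pairing t n 1 g = 0" if "n \<ge> 1" for n g
    using that by (cases n) (simp_all add: pairing_simps)
  then show ?case by blast
next
  case (var v p)
  then obtain N where N: "\<And>n g. n \<ge> N \<Longrightarrow> pairing t n p g = 0"
    by blast
  obtain A A' where v: "A \<in> I12" "A' \<in> I34" "v = t_var A A'"
    by (rule trans_var_cases)
  have "pairing t n (var v * p) g = 0" if "n \<ge> Suc N" for n g
  proof -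
    have "n - 1 \<ge> N"
      using that by simp
    then show ?thesis
      by (simp add: v(3) pairing_var[OF v(1,2)] N)
  qed
  then show ?case by blast
next
  case (add p q)
  then obtain N M where "\<forall>n\<ge>N. \<forall>g. pairing t n p g = 0"
    "\<forall>n\<ge>M. \<forall>g. pairing t n q g = 0"
    by blast
  then show ?case
    by (intro exI[of _ "max N M"]) (simp add: pairing_simps)
next
  case (scale c p)
  then show ?case
    unfolding pairing_simps by (metis scaleC_zero_right)
qed

lemma summable_cocycle:
  "summable (\<lambda>n. (\<i> / 2) ^ n / fact n * pairing t n h g)"
proof -
  obtain N where "\<And>n g. n \<ge> N \<Longrightarrow> pairing t n h g = 0"
    using pairing_eventually_zero[of h] by blast
  then show ?thesis
    by (intro summable_finite[of "{..<N}"]) auto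
qed

lemma cbilinear_cocycle: "cbilinear (cocycle t)"
proof -
  have "(\<i> / 2) ^ n / fact n * (c * x) = c * ((\<i> / 2) ^ n / fact n * x)" for n and c x :: complex
    by (rule mult.left_commute)
  then show ?thesis
    unfolding cbilinear_iff translation_cocycle_def
    by (simp only: pairing_simps distrib_left scaleC_complex_def
        suminf_mult suminf_add[symmetric] summable_cocycle simp_thms)
qed

lemma cocycle_one: "cocycle t 1 g = poly_eval (\<lambda>_. 0) g"
proof -
  have "pairing t n 1 g = 0" if "n \<noteq> 0" for n
    using that by (cases n) (simp_all add: pairing_simps)
  then show ?thesis
    unfolding translation_cocycle_def by (subst suminf_finite[of "{0}"]) auto
qed

text \<open>In degree n + 1 the factor n + 1 from \<open>pairing_var\<close> cancels against the
  factorial, and the degree 0 term vanishes because coordinates are 0 at the origin.\<close>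

lemma cocycle_var:
  assumes "A \<in> I12" "A' \<in> I34"
  shows "cocycle t (var (t_var A A') * h) g =
    (\<Sum>B\<in>I12. \<Sum>B'\<in>I34. \<i> / 2 * t A B A' B' * cocycle t h (partial_deriv (t_var B B') g))"
proof -
  let ?a = "\<lambda>n h g. (\<i> / 2) ^ n / fact n * pairing t n h g"
  let ?D = "\<lambda>B B'. partial_deriv (t_var B B')"
  have step: "?a (Suc n) (var (t_var A A') * h) g =
      (\<Sum>B\<in>I12. \<Sum>B'\<in>I34. \<i> / 2 * t A B A' B' * ?a n h (?D B B' g))" for n
  proof -
    have c: "(\<i> / 2) ^ Suc n / fact (Suc n) * (of_nat (Suc n) * x) = \<i> / 2 * ((\<i> / 2) ^ n / fact n * x)" for x :: complex
      by (simp add: field_simps del: of_nat_Suc)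
    show ?thesis
      unfolding pairing_var[OF assms] c
      by (simp add: sum_distrib_left mult.left_commute mult.assoc del: sum.insert sum.empty)
  qed
  have "cocycle t (var (t_var A A') * h) g = suminf (\<lambda>n. ?a (Suc n) (var (t_var A A') * h) g)"
    unfolding translation_cocycle_def
    using suminf_split_head[OF summable_cocycle, of "var (t_var A A') * h" g]
    by (simp add: poly_eval_mult)
  also have "\<dots> = suminf (\<lambda>n. \<Sum>B\<in>I12. \<Sum>B'\<in>I34. \<i> / 2 * t A B A' B' * ?a n h (?D B B' g))"
    by (simp only: step)
  also have "suminf (\<lambda>n. \<Sum>B\<in>I12. \<Sum>B'\<in>I34. \<i> / 2 * t A B A' B' * ?a n h (?D B B' g)) =
      (\<Sum>B\<in>I12. \<Sum>B'\<in>I34. suminf (\<lambda>n. \<i> / 2 * t A B A' B' * ?a n h (?D B B' g)))"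
    by (simp only: suminf_sum summable_sum summable_mult summable_cocycle)
  also have "\<dots> = (\<Sum>B\<in>I12. \<Sum>B'\<in>I34. \<i> / 2 * t A B A' B' * cocycle t h (?D B B' g))"
    by (simp only: suminf_mult summable_cocycle translation_cocycle_def)
  finally show ?thesis .
qed

end

lemma sum_swap4:
  "(\<Sum>a\<in>S. \<Sum>b\<in>S. \<Sum>c\<in>T. \<Sum>d\<in>T. f a b c d) = (\<Sum>a\<in>S. \<Sum>b\<in>S. \<Sum>c\<in>T. \<Sum>d\<in>T. f b a d c)"
  by (rule trans[OF sum.swap], rule sum.cong[OF refl], rule sum.cong[OF refl], rule sum.swap)

text \<open>Exchanging the arguments transposes \<theta> in both index pairs; this carries every
  rule for the first argument over to the second.\<close>

lemma cocycle_swap: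
  "cocycle t h g = cocycle (\<lambda>A B A' B'. t B A B' A') g h"
proof -
  have "pairing t n h g = pairing (\<lambda>A B A' B'. t B A B' A') n g h" for n
  proof (induction n arbitrary: h g)
    case (Suc n)
    show ?case
      unfolding translation_pairing_power.simps Suc.IH by (rule sum_swap4)
  qed (simp add: mult.commute)
  then show ?thesis
    by (simp add: translation_cocycle_def)
qed

section \<open>The pulled back cocycle\<close>

text \<open>The translation generator pulled back to the matrix group: a tangent vector at the
  identity, dual to the entry (A, A').\<close>

definition ell :: "4 \<Rightarrow> 4 \<Rightarrow> gl4 \<Rightarrow> complex"
  where "ell A A' h = poly_eval (\<lambda>_. 0) (partial_deriv (t_var A A') (res h))"

lemma clinear_ell: "clinear (ell A A')"
  by (simp add: clinear_iff ell_def restrict_simps partial_deriv_simps poly_eval_add poly_eval_scaleC)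

lemma poly_eval_restrict: "poly_eval (\<lambda>_. 0) (res h) = counit h"
  by (induction h rule: gl4_induct)
    (auto simp: restrict_simps restrict_gens poly_eval_add poly_eval_mult poly_eval_scaleC
      simp del: One_nat_def)

lemma partial_deriv_res_a_mult:
  assumes "A \<in> I12" "A' \<in> I34"
  shows "partial_deriv (t_var A A') (res (a_gl4 i j * h)) =
    (if i = A \<and> j = A' then res h else 0) +
    res (a_gl4 i j) * partial_deriv (t_var A A') (res h)"
proof -
  have "A \<noteq> A'" "A \<notin> I34" "A' \<notin> I12"
    using assms by auto
  with assms show ?thesis
    by (auto simp: restrict_simps restrict_gens partial_deriv_var_mult t_var_eq_iff partial_deriv_simps)
qed

lemma ell_a_mult:
  assumes "A \<in> I12" "A' \<in> I34"
  shows "ell A A' (a_gl4 i j * h) =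
    (if i = A \<and> j = A' then counit h else 0) + (if i = j then ell A A' h else 0)"
proof -
  have "A \<noteq> A'"
    using assms by auto
  then show ?thesis
    by (auto simp: ell_def partial_deriv_res_a_mult[OF assms] poly_eval_add poly_eval_mult
        poly_eval_restrict)
qed

lemma ell_gens:
  assumes "A \<in> I12" "A' \<in> I34"
  shows "ell A A' 1 = 0" "ell A A' (a_gl4 i j) = (if i = A \<and> j = A' then 1 else 0)"
    "ell A A' (det_inv * h) = ell A A' h"
proof -
  show 1: "ell A A' 1 = 0" "ell A A' (det_inv * h) = ell A A' h"
    by (simp_all add: ell_def restrict_simps restrict_gens)
  show "ell A A' (a_gl4 i j) = (if i = A \<and> j = A' then 1 else 0)"
    using ell_a_mult[OF assms, of i j 1]
    by (simp only: 1 mult_1_right algebra_homD(2)[OF algebra_hom_counit] if_cancel add_0_right)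
qed

text \<open>The derivations \<open>row_deriv A A'\<close> and \<open>col_deriv A A'\<close> replace row \<open>A\<close> of the matrix \<open>a\<close> by
  row \<open>A'\<close> and column \<open>A'\<close> by column \<open>A\<close>, respectively.\<close>

definition row_deriv :: "4 \<Rightarrow> 4 \<Rightarrow> gl4 \<Rightarrow> gl4"
  where "row_deriv A A' = lact (ell A A')"

definition col_deriv :: "4 \<Rightarrow> 4 \<Rightarrow> gl4 \<Rightarrow> gl4"
  where "col_deriv A A' = ract (ell A A')"

lemma clinear_deriv: "clinear (row_deriv A A')" "clinear (col_deriv A A')"
  unfolding row_deriv_def col_deriv_def by (intro clinear_act clinear_ell)+

lemmas deriv_simps = clinear_simps[OF clinear_deriv(1)] clinear_simps[OF clinear_deriv(2)]

lemma deriv_gens: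
  assumes "A \<in> I12" "A' \<in> I34"
  shows "row_deriv A A' 1 = 0" "col_deriv A A' 1 = 0"
    "row_deriv A A' (det_inv * h) = det_inv * row_deriv A A' h"
    "col_deriv A A' (det_inv * h) = det_inv * col_deriv A A' h"
    "row_deriv A A' (a_gl4 i j * h) = (if i = A then a_gl4 A' j * h else 0) + a_gl4 i j * row_deriv A A' h"
    "col_deriv A A' (a_gl4 i j * h) = (if j = A' then a_gl4 i A * h else 0) + a_gl4 i j * col_deriv A A' h"
proof -
  note b = cbilinear_act[OF clinear_ell]
  show "row_deriv A A' 1 = 0" "col_deriv A A' 1 = 0"
    by (simp_all add: row_deriv_def col_deriv_def lact_def ract_def sweedler2_one b ell_gens[OF assms])
  have m: "sweedler2 (\<lambda>x y. u x *\<^sub>C (a * y)) h = a * sweedler2 (\<lambda>x y. u x *\<^sub>C y) h"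
    "sweedler2 (\<lambda>x y. u y *\<^sub>C (a * x)) h = a * sweedler2 (\<lambda>x y. u y *\<^sub>C x) h" for a h and u :: "gl4 \<Rightarrow> complex"
    by (simp_all add: sweedler2_fun_mult_left flip: mult_scaleC_right)
  show "row_deriv A A' (det_inv * h) = det_inv * row_deriv A A' h"
    "col_deriv A A' (det_inv * h) = det_inv * col_deriv A A' h"
    by (simp_all add: row_deriv_def col_deriv_def lact_def ract_def sweedler2_det_inv b m ell_gens[OF assms])
  have ne: "A \<noteq> A'"
    using assms by auto
  note simps = row_deriv_def col_deriv_def lact_def ract_def sweedler2_entry b ell_a_mult[OF assms]
    scaleC_add_left sweedler2_fun_add if_distrib[of "\<lambda>c. c *\<^sub>C _"] sweedler2_if m
    sum.distrib sweedler2_counit_id sweedler2_fun_zero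
  show "row_deriv A A' (a_gl4 i j * h) = (if i = A then a_gl4 A' j * h else 0) + a_gl4 i j * row_deriv A A' h"
    by (cases "i = A") (simp_all add: simps cong: if_cong)
  show "col_deriv A A' (a_gl4 i j * h) = (if j = A' then a_gl4 i A * h else 0) + a_gl4 i j * col_deriv A A' h"
    by (cases "j = A'") (simp_all add: simps cong: if_cong)
qed

text \<open>Translations form a commutative group, so left and right invariant derivations coincide
  after restriction: the substituted row or column restricts to one of the identity matrix.\<close>

lemma restrict_deriv:
  assumes "A \<in> I12" "A' \<in> I34"
  shows "res (row_deriv A A' h) = partial_deriv (t_var A A') (res h)"
    "res (col_deriv A A' h) = partial_deriv (t_var A A') (res h)"
proof -
  have ne: "A \<notin> I34" "A' \<notin> I12" "A \<noteq> A'"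
    using assms by auto
  have a: "res (a_gl4 A' j) = (if j = A' then 1 else 0)"
    "res (a_gl4 i A) = (if i = A then 1 else 0)" for i j
    by (simp_all only: restrict_gens ne simp_thms if_False eq_commute[of A'])
  show "res (row_deriv A A' h) = partial_deriv (t_var A A') (res h)"
    "res (col_deriv A A' h) = partial_deriv (t_var A A') (res h)"
    by (induction h rule: gl4_induct)
      (simp_all add: deriv_gens[OF assms] deriv_simps restrict_simps restrict_gens(2) partial_deriv_simps
        a partial_deriv_res_a_mult[OF assms, unfolded restrict_simps])
qed

lemma cbilinear_F: "cbilinear (F_gl4 t)"
  using cbilinear_cocycle[of t]
  by (simp add: cbilinear_iff F_gl4_def restrict_simps)

lemmas clinear_F = cbilinearD[OF cbilinear_F]
lemmas F_simps = clinear_simps[OF clinear_F(1)] clinear_simps[OF clinear_F(2)]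

lemma F_one:
  assumes "res u = 1"
  shows "F_gl4 t u g = counit g" "F_gl4 t g u = counit g"
  using cocycle_swap[of t "res g" 1]
  by (simp_all add: F_gl4_def assms cocycle_one poly_eval_restrict)

lemma F_det_inv_mult: "F_gl4 t (det_inv * h) g = F_gl4 t h g"
  by (simp add: F_gl4_def restrict_simps restrict_gens)

text \<open>Using the extension of \<theta> by zero makes one recursion serve all four blocks:
  outside the block \<tau> an entry restricts to a Kronecker delta and the \<theta> term
  vanishes.\<close>

lemma F_a_mult:
  "F_gl4 t (a_gl4 i j * h) g = (if i = j then F_gl4 t h g else 0) +
    (\<Sum>B\<in>I12. \<Sum>B'\<in>I34. \<i> / 2 * theta_ext t i B j B' * F_gl4 t h (row_deriv B B' g))"
proof (cases "i \<in> I12 \<and> j \<in> I34")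
  case True
  then have "i \<noteq> j"
    by auto
  then have "F_gl4 t (a_gl4 i j * h) g = (\<Sum>B\<in>I12. \<Sum>B'\<in>I34. \<i> / 2 * t i B j B' * F_gl4 t h (row_deriv B B' g))"
    using True unfolding F_gl4_def restrict_simps restrict_gens
    by (simp only: simp_thms if_True cocycle_var)
      (intro sum.cong refl, simp only: restrict_deriv)
  also have "\<dots> = (\<Sum>B\<in>I12. \<Sum>B'\<in>I34. \<i> / 2 * theta_ext t i B j B' * F_gl4 t h (row_deriv B B' g))"
    using True by (intro sum.cong refl) (simp add: theta_ext_def)
  finally show ?thesis
    using \<open>i \<noteq> j\<close> by simp
next
  case False
  then have "theta_ext t i B j B' = 0" for B B'
    unfolding theta_ext_def by metis
  moreover have "res (a_gl4 i j) = (if i = j then 1 else 0)"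
    unfolding restrict_gens using False by (rule if_not_P)
  ultimately show ?thesis
    using clinear_zero[OF clinear_F(2), of t] by (simp add: F_gl4_def restrict_simps)
qed

lemma F_deriv_swap:
  assumes "A \<in> I12" "A' \<in> I34"
  shows "F_gl4 t h (col_deriv A A' g) = F_gl4 t h (row_deriv A A' g)"
  by (simp add: F_gl4_def restrict_deriv[OF assms])

lemma counit_row_deriv:
  assumes "A \<in> I12" "A' \<in> I34"
  shows "counit (row_deriv A A' g) = ell A A' g"
  by (simp add: ell_def restrict_deriv[OF assms] flip: poly_eval_restrict)

lemma F_a:
  "F_gl4 t (a_gl4 i j) g = (if i = j then counit g else 0) +
    (\<Sum>B\<in>I12. \<Sum>B'\<in>I34. \<i> / 2 * theta_ext t i B j B' * ell B B' g)"
  using F_a_mult[of t i j 1 g]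
  by (simp add: F_one restrict_simps counit_row_deriv del: sum.insert)

text \<open>The functional \<open>F_gl4 t (a_gl4 i j)\<close> as an operator. Over all i and j it
  forms a matrix of operators, the identity plus the nilpotent \<open>row_shift\<close>.\<close>

definition row_act :: "theta_parameter \<Rightarrow> 4 \<Rightarrow> 4 \<Rightarrow> gl4 \<Rightarrow> gl4"
  where "row_act t i j = lact (F_gl4 t (a_gl4 i j))"

definition col_act :: "theta_parameter \<Rightarrow> 4 \<Rightarrow> 4 \<Rightarrow> gl4 \<Rightarrow> gl4"
  where "col_act t i j = ract (F_gl4 t (a_gl4 i j))"

definition row_shift :: "theta_parameter \<Rightarrow> 4 \<Rightarrow> 4 \<Rightarrow> gl4 \<Rightarrow> gl4"
  where "row_shift t i j g = (\<Sum>B\<in>I12. \<Sum>B'\<in>I34. (\<i> / 2 * theta_ext t i B j B') *\<^sub>C row_deriv B B' g)"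

definition col_shift :: "theta_parameter \<Rightarrow> 4 \<Rightarrow> 4 \<Rightarrow> gl4 \<Rightarrow> gl4"
  where "col_shift t i j g = (\<Sum>B\<in>I12. \<Sum>B'\<in>I34. (\<i> / 2 * theta_ext t i B j B') *\<^sub>C col_deriv B B' g)"

lemma act_eq_shift:
  "row_act t i j g = (if i = j then g else 0) + row_shift t i j g"
  "col_act t i j g = (if i = j then g else 0) + col_shift t i j g"
  by (simp_all only: row_act_def row_shift_def col_act_def col_shift_def lact_def ract_def F_a
      scaleC_add_left sweedler2_fun scaleC_sum_left scaleC_scaleC[symmetric] row_deriv_def col_deriv_def
      if_distrib[of "\<lambda>c. c *\<^sub>C _"] scaleC_zero_left sweedler2_if scaleC_one cong: if_cong sum.cong_simp)
   (simp_all add: scaleC_scaleC sweedler2_counit_id)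

lemma clinear_act_shift:
  "clinear (row_act t i j)" "clinear (col_act t i j)"
  "clinear (row_shift t i j)" "clinear (col_shift t i j)"
  unfolding row_act_def col_act_def
  by (intro clinear_act clinear_F, intro clinear_act clinear_F)
    (simp_all add: clinear_iff row_shift_def col_shift_def deriv_simps scaleC_simps sum.distrib
      scaleC_sum_right mult.commute del: sum.insert)

text \<open>A generator leaves the first argument of F and becomes an operator on the second. Both
  versions hold since F does not distinguish row from column derivations; which one is chosen
  decides the leg to which the operator can be moved.\<close>

lemma F_a_mult_act:
  "F_gl4 t (a_gl4 i j * h) g = F_gl4 t h (row_act t i j g)"
  "F_gl4 t (a_gl4 i j * h) g = F_gl4 t h (col_act t i j g)"
  by (simp_all add: F_a_mult act_eq_shift row_shift_def col_shift_def F_simps F_deriv_swap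
      scaleC_complex_def)

section \<open>The convolution inverse of the cocycle\<close>

abbreviation neg_theta :: "theta_parameter \<Rightarrow> theta_parameter"
  where "neg_theta t \<equiv> (\<lambda>A B A' B'. - t A B A' B')"

lemmas row_act_simps = clinear_simps[OF clinear_act_shift(1)]
lemmas row_shift_simps = clinear_simps[OF clinear_act_shift(3)]
lemma shift_zero:
  assumes "i \<notin> I12 \<or> j \<notin> I34"
  shows "row_shift t i j g = 0" "col_shift t i j g = 0"
proof -
  have "theta_ext t i B j B' = 0" for B B'
    using assms unfolding theta_ext_def by metis
  then show "row_shift t i j g = 0" "col_shift t i j g = 0"
    by (simp_all add: row_shift_def col_shift_def)
qed

lemma shift_neg:
  "row_shift (neg_theta t) i j g = - row_shift t i j g"
  "col_shift (neg_theta t) i j g = - col_shift t i j g"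
proof -
  have "theta_ext (neg_theta t) i B j B' = - theta_ext t i B j B'" for B B'
    by (simp add: theta_ext_def)
  then show "row_shift (neg_theta t) i j g = - row_shift t i j g"
    "col_shift (neg_theta t) i j g = - col_shift t i j g"
    by (simp_all add: row_shift_def col_shift_def scaleC_uminus_left)
qed

lemma not_I12_or_not_I34: "k \<notin> I12 \<or> k \<notin> I34"
  by auto

text \<open>A product of two shifts would need the middle index in both \<open>I12\<close> and
  \<open>I34\<close>. Only terms with at most one shift survive, so matrix multiplication of the
  operators becomes a Leibniz rule for the shifts.\<close>

lemma sum_act_bilinear:
  fixes f :: "gl4 \<Rightarrow> gl4 \<Rightarrow> 'c::complex_algebra"
  assumes f: "cbilinear f"
  shows "(\<Sum>k\<in>UNIV. f (row_act t i k h) (row_act t' k j g)) =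
      (if i = j then f h g else 0) + f h (row_shift t' i j g) + f (row_shift t i j h) g"
    "(\<Sum>k\<in>UNIV. f (col_act t k j h) (col_act t' i k g)) =
      (if i = j then f h g else 0) + f h (col_shift t' i j g) + f (col_shift t i j h) g"
proof -
  note lin = clinear_simps[OF cbilinearD(1)[OF f]] clinear_simps[OF cbilinearD(2)[OF f]]
  have "f (row_act t i k h) (row_act t' k j g) =
      (if k = i then f h (row_act t' i j g) else 0) + (if k = j then f (row_shift t i j h) g else 0)" for k
  proof -
    have "f (row_shift t i k h) (row_shift t' k j g) = 0"
      using not_I12_or_not_I34[of k] shift_zero[of i k] shift_zero[of k j] lin by metis
    then show ?thesis
      by (auto simp: act_eq_shift lin)
  qed
  then show "(\<Sum>k\<in>UNIV. f (row_act t i k h) (row_act t' k j g)) =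
      (if i = j then f h g else 0) + f h (row_shift t' i j g) + f (row_shift t i j h) g"
    by (simp add: sum.distrib act_eq_shift lin)
  have "f (col_act t k j h) (col_act t' i k g) =
      (if k = i then f (col_act t i j h) g else 0) + (if k = j then f h (col_shift t' i j g) else 0)" for k
  proof -
    have "f (col_shift t k j h) (col_shift t' i k g) = 0"
      using not_I12_or_not_I34[of k] shift_zero[of i k] shift_zero[of k j] lin by metis
    then show ?thesis
      by (auto simp: act_eq_shift lin)
  qed
  then show "(\<Sum>k\<in>UNIV. f (col_act t k j h) (col_act t' i k g)) =
      (if i = j then f h g else 0) + f h (col_shift t' i j g) + f (col_shift t i j h) g"
    by (simp add: sum.distrib act_eq_shift lin)
qed

text \<open>The identity (1 + N)(1 - N) = 1 for the operator matrix N of shifts, whose square is 0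
  by the index argument.\<close>

lemma row_act_inverse:
  "(\<Sum>k\<in>UNIV. row_act (neg_theta t) k j (row_act t i k g)) = (if i = j then g else 0)"
proof -
  have "row_act (neg_theta t) k j (row_act t i k g) =
      (if k = j then row_act t i j g else 0) + (if k = i then row_shift (neg_theta t) i j g else 0)" for k
  proof -
    have "row_shift (neg_theta t) k j (row_shift t i k g) = 0"
      using not_I12_or_not_I34[of k] shift_zero(1)[of i k] shift_zero(1)[of k j] row_shift_simps(3) by metis
    then show ?thesis
      by (auto simp: act_eq_shift row_shift_simps)
  qed
  then show ?thesis
    by (simp add: sum.distrib act_eq_shift shift_neg)
qed

lemma cbilinear_FG:
  "cbilinear (\<lambda>g1 g2. F_gl4 t h1 g1 * F_gl4 t' h2 g2)"
  "cbilinear (\<lambda>h1 h2. sweedler2 (\<lambda>g1 g2. F_gl4 t h1 g1 * F_gl4 t' h2 g2) g)"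
  by (simp_all add: bilin F_simps mult.assoc mult.left_commute)

text \<open>A generator in front of h acts through F by columns on the first leg of g. This equals a
  row action on the second leg, where it meets the inverse row action coming from the negated
  parameter.\<close>

lemma conv2_F: "conv2 (F_gl4 t) (F_gl4 (neg_theta t)) h g = counit h * counit g"
proof (induction h arbitrary: g rule: gl4_induct)
  case one
  show ?case
    using sweedler2_counit(1)[OF algebra_homD(1)[OF algebra_hom_counit], of g]
    by (simp add: conv2_def sweedler2_one cbilinear_FG F_one restrict_simps scaleC_complex_def)
next
  case (entry i j h)
  let ?F = "F_gl4 t" and ?G = "F_gl4 (neg_theta t)"
  have step: "(\<Sum>k\<in>UNIV. sweedler2 (\<lambda>g1 g2. ?F (a_gl4 i k * x) g1 * ?G (a_gl4 k j * y) g2) g) =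
      (if i = j then sweedler2 (\<lambda>g1 g2. ?F x g1 * ?G y g2) g else 0)" for x y
  proof -
    have "sweedler2 (\<lambda>g1 g2. ?F (a_gl4 i k * x) g1 * ?G (a_gl4 k j * y) g2) g =
        sweedler2 (\<lambda>g1 g2. ?F x g1 * ?G y (row_act (neg_theta t) k j (row_act t i k g2))) g" for k
    proof -
      have "sweedler2 (\<lambda>g1 g2. ?F (a_gl4 i k * x) g1 * ?G (a_gl4 k j * y) g2) g =
          sweedler2 (\<lambda>g1 g2. ?F x (ract (?F (a_gl4 i k)) g1) * ?G y (row_act (neg_theta t) k j g2)) g"
        by (simp add: F_a_mult_act(2)[of t] F_a_mult_act(1)[of "neg_theta t"] col_act_def)
      also have "\<dots> = sweedler2 (\<lambda>g1 g2. ?F x g1 * ?G y (row_act (neg_theta t) k j (row_act t i k g2))) g"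
        unfolding row_act_def[of t]
        by (rule sweedler2_ract_lact[OF _ clinear_F(1)]) (simp add: bilin F_simps row_act_simps)
      finally show ?thesis .
    qed
    then show ?thesis
      by (simp add: row_act_inverse if_distrib F_simps sweedler2_fun_zero cong: if_cong
          flip: sweedler2_fun_sum sum_distrib_left clinear_sum[OF clinear_F(1)])
  qed
  show ?case
    using entry.IH[of g]
    by (simp add: conv2_def sweedler2_entry cbilinear_FG step sweedler2_if sweedler2_fun_zero
        flip: sweedler2_fun_sum[where h = h])
next
  case (det_inv h)
  then show ?case
    by (simp add: conv2_def sweedler2_det_inv cbilinear_FG F_det_inv_mult)
qed (simp_all add: conv2_def sweedler2_elem cbilinear_FG algebra_simps scaleC_complex_def)


text \<open>Coassociativity in each argument, with the two Sweedler sums interchanged before and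
  after. It gives the uniqueness behind \<open>conv_inverse2\<close>.\<close>

lemma conv2_assoc:
  assumes F: "cbilinear F" and G: "cbilinear G" and H: "cbilinear H"
  shows "conv2 (conv2 F G) H = conv2 F (conv2 G H)"
proof (intro ext)
  fix h g
  note lin = clinear_simps[OF cbilinearD(1)[OF F]] clinear_simps[OF cbilinearD(2)[OF F]]
    clinear_simps[OF cbilinearD(1)[OF G]] clinear_simps[OF cbilinearD(2)[OF G]]
    clinear_simps[OF cbilinearD(1)[OF H]] clinear_simps[OF cbilinearD(2)[OF H]]
  define T where "T u v z p q c = F u p * G v q * H z c" for u v z p q c
  have T: "ctrilinear (\<lambda>p q c. T u v z p q c)" for u v z
    by (simp add: ctrilinear_def T_def lin algebra_simps scaleC_complex_def)
  have T': "ctrilinear (\<lambda>u v z. sweedler2 (\<lambda>a c. sweedler2 (\<lambda>p q. T u v z p q c) a) g)"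
    by (simp add: ctrilinear_def T_def lin distrib_left distrib_right sweedler2_fun scaleC_simps)
  have "conv2 (conv2 F G) H h g =
      sweedler2 (\<lambda>x z. sweedler2 (\<lambda>a c. sweedler2 (\<lambda>u v. sweedler2 (\<lambda>p q. T u v z p q c) a) x) g) h"
    by (simp add: conv2_def T_def sweedler2_fun_mult_right)
  also have "\<dots> = sweedler2 (\<lambda>x z. sweedler2 (\<lambda>u v. sweedler2 (\<lambda>a c. sweedler2 (\<lambda>p q. T u v z p q c) a) g) x) h"
    by (subst sweedler2_swap) (rule refl)
  also have "\<dots> = sweedler2 (\<lambda>u y. sweedler2 (\<lambda>v z. sweedler2 (\<lambda>p b. sweedler2 (\<lambda>q c. T u v z p q c) b) g) y) h"
    by (subst coassoc[OF T']) (simp only: coassoc[OF T])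
  also have "\<dots> = sweedler2 (\<lambda>u y. sweedler2 (\<lambda>p b. sweedler2 (\<lambda>v z. sweedler2 (\<lambda>q c. T u v z p q c) b) y) g) h"
    by (subst sweedler2_swap) (rule refl)
  also have "\<dots> = conv2 F (conv2 G H) h g"
    by (simp add: conv2_def T_def sweedler2_fun_mult_left mult.assoc)
  finally show "conv2 (conv2 F G) H h g = conv2 F (conv2 G H) h g" .
qed

lemma conv2_unit:
  assumes "cbilinear F"
  shows "conv2 F (\<lambda>h g. counit h * counit g) = F" "conv2 (\<lambda>h g. counit h * counit g) F = F"
proof -
  have "sweedler2 (\<lambda>h1 h2. sweedler2 (\<lambda>g1 g2. counit h2 *\<^sub>C (counit g2 *\<^sub>C F h1 g1)) g) h = F h g"
    "sweedler2 (\<lambda>h1 h2. sweedler2 (\<lambda>g1 g2. counit h1 *\<^sub>C (counit g1 *\<^sub>C F h2 g2)) g) h = F h g" for h g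
    by (simp_all add: sweedler2_fun_scaleC sweedler2_counit cbilinearD[OF assms])
  then show "conv2 F (\<lambda>h g. counit h * counit g) = F" "conv2 (\<lambda>h g. counit h * counit g) F = F"
    by (simp_all add: conv2_def fun_eq_iff scaleC_complex_def mult_ac)
qed

lemma conv_inverse2_F: "conv_inverse2 (F_gl4 t) = F_gl4 (neg_theta t)"
proof -
  have inv: "conv2 (F_gl4 t) (F_gl4 (neg_theta t)) = (\<lambda>h g. counit h * counit g)"
    "conv2 (F_gl4 (neg_theta t)) (F_gl4 t) = (\<lambda>h g. counit h * counit g)"
    using conv2_F[of t] conv2_F[of "neg_theta t"] by (simp_all add: fun_eq_iff)
  show ?thesis
    unfolding conv_inverse2_def
  proof (rule the_equality)
    fix G assume G: "cbilinear G \<and> conv2 (F_gl4 t) G = (\<lambda>h g. counit h * counit g) \<and>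
      conv2 G (F_gl4 t) = (\<lambda>h g. counit h * counit g)"
    have "G = conv2 G (conv2 (F_gl4 t) (F_gl4 (neg_theta t)))"
      using G by (simp add: inv conv2_unit)
    also have "\<dots> = F_gl4 (neg_theta t)"
      using G by (simp add: cbilinear_F conv2_unit flip: conv2_assoc)
    finally show "G = F_gl4 (neg_theta t)" .
  qed (use inv cbilinear_F in simp)
qed

section \<open>The twisted product\<close>

definition twist_kernel ::
  "theta_parameter \<Rightarrow> gl4 \<Rightarrow> gl4 \<Rightarrow> gl4 \<Rightarrow> gl4 \<Rightarrow> gl4"
  where "twist_kernel t g h1 h2 h3 = sweedler3 (\<lambda>g1 g2 g3.
    (F_gl4 t h1 g1 * F_gl4 (neg_theta t) h3 g3) *\<^sub>C (h2 * g2)) g"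

lemma twisted_mult_eq: "h \<bullet>\<^bsub>t\<^esub> g = sweedler3 (twist_kernel t g) h"
  by (simp add: twisted_mult_def twist_kernel_def[abs_def] conv_inverse2_F)

lemma ctrilinear_FF:
  "ctrilinear (\<lambda>g1 g2 g3. (F_gl4 t h1 g1 * F_gl4 t' h3 g3) *\<^sub>C (h2 * g2))"
  by (simp add: ctrilinear_def F_simps distrib_left distrib_right scaleC_simps scaleC_complex_def mult_ac)

lemma ctrilinear_twist_kernel: "ctrilinear (twist_kernel t g)"
proof -
  have 1: "(c *\<^sub>C x) *\<^sub>C v = c *\<^sub>C (x *\<^sub>C v)" and 2: "(x * y) *\<^sub>C (c *\<^sub>C v) = c *\<^sub>C ((x * y) *\<^sub>C v)"
    for c x y :: complex and v :: gl4
    by (simp_all add: scaleC_complex_def scaleC_scaleC mult_ac)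
  show ?thesis
    unfolding ctrilinear_def twist_kernel_def sweedler3_def
    by (simp only: F_simps distrib_left distrib_right scaleC_add_left scaleC_add_right
        mult_scaleC_left mult_scaleC_right 1 2 sweedler2_fun_add sweedler2_fun_scaleC simp_thms)
qed

lemma clinear_twist_kernel: "clinear (\<lambda>g. twist_kernel t g h1 h2 h3)"
  unfolding twist_kernel_def by (rule clinear_sweedler3_elem[OF ctrilinear_FF])

lemma cbilinear_twisted_mult: "cbilinear (\<lambda>h g. h \<bullet>\<^bsub>t\<^esub> g)"
  by (simp add: cbilinear_iff twisted_mult_eq clinear_simps[OF clinear_sweedler3_elem[OF ctrilinear_twist_kernel]])
    (simp add: sweedler3_def clinear_simps[OF clinear_twist_kernel] sweedler2_fun)

lemmas twisted_simps = clinear_simps[OF cbilinearD(1)[OF cbilinear_twisted_mult]]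
  clinear_simps[OF cbilinearD(2)[OF cbilinear_twisted_mult]]

text \<open>F is turned into a row operator on the first leg of g and its inverse into a column
  operator on the third. Operators on the outer legs come from operators on g itself, so only g
  changes.\<close>

lemma twist_kernel_a_mult:
  "twist_kernel t g (a_gl4 i k * h1) (a_gl4 k l * h2) (a_gl4 l j * h3) =
    a_gl4 k l * twist_kernel t (row_act t i k (col_act (neg_theta t) l j g)) h1 h2 h3"
proof -
  let ?f = "\<lambda>g1 g2 g3. (F_gl4 t h1 g1 * F_gl4 (neg_theta t) h3 g3) *\<^sub>C (a_gl4 k l * h2 * g2)"
  have "twist_kernel t g (a_gl4 i k * h1) (a_gl4 k l * h2) (a_gl4 l j * h3) =
      sweedler3 (\<lambda>g1 g2 g3. ?f (row_act t i k g1) g2 (col_act (neg_theta t) l j g3)) g"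
    unfolding twist_kernel_def F_a_mult_act(1)[of t] F_a_mult_act(2)[of "neg_theta t"] ..
  also have "\<dots> = sweedler3 ?f (row_act t i k (col_act (neg_theta t) l j g))"
  proof -
    have "ctrilinear (\<lambda>g1 g2 g3. ?f g1 g2 (col_act (neg_theta t) l j g3))"
      using ctrilinear_FF[of t h1 "neg_theta t" "a_gl4 l j * h3" "a_gl4 k l * h2"]
      by (simp only: F_a_mult_act(2))
    from sweedler3_lact[OF this clinear_F(1)] sweedler3_ract[OF ctrilinear_FF clinear_F(1)]
    show ?thesis
      by (simp only: row_act_def col_act_def lact_ract[OF clinear_F(1) clinear_F(1)])
  qed
  also have "\<dots> = a_gl4 k l * twist_kernel t (row_act t i k (col_act (neg_theta t) l j g)) h1 h2 h3"
    by (simp add: twist_kernel_def clinear_sweedler3[OF clinear_mult_left] mult_scaleC_right mult.assoc)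
  finally show ?thesis .
qed

text \<open>The recursion that replaces the Sweedler definition of the product from here on.\<close>

lemma twisted_mult_entry:
  "(a_gl4 i j * h) \<bullet>\<^bsub>t\<^esub> g = (\<Sum>k\<in>UNIV. \<Sum>l\<in>UNIV.
    a_gl4 k l * (h \<bullet>\<^bsub>t\<^esub> row_act t i k (col_act (neg_theta t) l j g)))"
  unfolding twisted_mult_eq sweedler3_entry[OF ctrilinear_twist_kernel] twist_kernel_a_mult
  by (simp add: clinear_sweedler3[OF clinear_mult_left])

lemma twisted_mult_det_inv: "(det_inv * h) \<bullet>\<^bsub>t\<^esub> g = det_inv * (h \<bullet>\<^bsub>t\<^esub> g)"
  unfolding twisted_mult_eq sweedler3_det_inv[OF ctrilinear_twist_kernel]
  by (simp add: clinear_sweedler3[OF clinear_mult_left] twist_kernel_def F_det_inv_mult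
      mult_scaleC_right mult.assoc)

text \<open>A grouplike element restricting to 1 on translations pairs under F by the counit alone,
  so both twists disappear. It is applied to 1, to the determinant and to its inverse.\<close>

lemma twisted_mult_grouplike:
  assumes "comult u = u \<otimes> u" "res u = 1"
  shows "u \<bullet>\<^bsub>t\<^esub> g = u * g" "g \<bullet>\<^bsub>t\<^esub> u = u * g"
proof -
  have "(counit g1 * counit g3) *\<^sub>C (u * g2) = u * (counit g3 *\<^sub>C (counit g1 *\<^sub>C g2))" for g1 g2 g3
    by (simp add: scaleC_simps mult.commute)
  then have *: "sweedler3 (\<lambda>g1 g2 g3. (counit g1 * counit g3) *\<^sub>C (u * g2)) g = u * g"
    by (simp only: sweedler3_def sweedler2_fun_mult_left sweedler2_fun_scaleC sweedler2_counit_id)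
  then show "u \<bullet>\<^bsub>t\<^esub> g = u * g"
    by (simp add: twisted_mult_eq sweedler3_grouplike[OF ctrilinear_twist_kernel assms(1)]
        twist_kernel_def F_one assms)
  have "twist_kernel t u = (\<lambda>h1 h2 h3. (counit h1 * counit h3) *\<^sub>C (u * h2))"
    unfolding twist_kernel_def sweedler3_grouplike[OF ctrilinear_FF assms(1)]
    by (simp add: fun_eq_iff F_one assms mult.commute)
  with * show "g \<bullet>\<^bsub>t\<^esub> u = u * g"
    by (simp only: twisted_mult_eq)
qed

lemma twisted_mult_one [simp]: "1 \<bullet>\<^bsub>t\<^esub> g = g" "g \<bullet>\<^bsub>t\<^esub> 1 = g"
  using twisted_mult_grouplike[of 1] by (simp_all add: algebra_homD(2)[OF algebra_hom_comult]
      restrict_simps tens_one)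

lemma comult_det: "comult (det a_matrix) = det a_matrix \<otimes> det a_matrix"
proof -
  have 1: "(det_inv \<otimes> det_inv) * comult (det a_matrix) = 1"
    using arg_cong[OF det_inv_det, of comult] by (simp add: algebra_homD[OF algebra_hom_comult] comult_gens)
  have 2: "(det a_matrix \<otimes> det a_matrix) * (det_inv \<otimes> det_inv) = 1"
    by (simp add: tens_mult mult.commute[of _ det_inv] det_inv_det tens_one)
  \<comment> \<open>The determinant inherits being grouplike from \<open>det_inv\<close>, by
    uniqueness of inverses.\<close>
  have "comult (det a_matrix) =
      (det a_matrix \<otimes> det a_matrix) * ((det_inv \<otimes> det_inv) * comult (det a_matrix))"
    unfolding mult.assoc[symmetric] 2 by simp
  then show ?thesis
    unfolding 1 by simp
qed

lemma restrict_det: "res (det a_matrix) = 1"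
  using arg_cong[OF det_inv_det, of res] by (simp add: restrict_simps restrict_gens)

section \<open>Derivations of the twisted product, and associativity\<close>

lemma row_deriv_commute:
  assumes "A \<in> I12" "A' \<in> I34" "B \<in> I12" "B' \<in> I34"
  shows "row_deriv A A' (row_deriv B B' g) = row_deriv B B' (row_deriv A A' g)"
    "col_deriv A A' (col_deriv B B' g) = col_deriv B B' (col_deriv A A' g)"
proof -
  have "A' \<noteq> B" "B' \<noteq> A"
    using assms by auto
  then show "row_deriv A A' (row_deriv B B' g) = row_deriv B B' (row_deriv A A' g)"
    "col_deriv A A' (col_deriv B B' g) = col_deriv B B' (col_deriv A A' g)"
    by (induction g rule: gl4_induct)
      (simp_all add: deriv_gens(1-4)[OF assms(1,2)] deriv_gens(1-4)[OF assms(3,4)]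
        deriv_gens(5,6)[OF assms(1,2)] deriv_gens(5,6)[OF assms(3,4)] deriv_simps)
qed

lemma row_col_deriv_commute: "row_deriv A A' (col_deriv B B' g) = col_deriv B B' (row_deriv A A' g)"
  unfolding row_deriv_def col_deriv_def by (rule lact_ract[OF clinear_ell clinear_ell])

lemma deriv_act_commute:
  assumes "A \<in> I12" "A' \<in> I34"
  shows "row_deriv A A' (row_act t i j g) = row_act t i j (row_deriv A A' g)"
    "row_deriv A A' (col_act t i j g) = col_act t i j (row_deriv A A' g)"
    "col_deriv A A' (row_act t i j g) = row_act t i j (col_deriv A A' g)"
    "col_deriv A A' (col_act t i j g) = col_act t i j (col_deriv A A' g)"
  by (simp_all add: act_eq_shift row_shift_def col_shift_def deriv_simps row_deriv_commute[OF assms]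
      row_col_deriv_commute)

lemma act_trivial:
  assumes "i \<notin> I12 \<or> j \<notin> I34"
  shows "row_act t i j g = (if i = j then g else 0)" "col_act t i j g = (if i = j then g else 0)"
  by (simp_all only: act_eq_shift shift_zero[OF assms] add_0_right)

text \<open>The derivations commute with all operators in the recursion for the product, so they
  differentiate it as they do the commutative one, apart from the term hitting the
  prefactor.\<close>

lemma deriv_twisted_mult:
  assumes "A \<in> I12" "A' \<in> I34"
  shows "row_deriv A A' (h \<bullet>\<^bsub>t\<^esub> g) = row_deriv A A' h \<bullet>\<^bsub>t\<^esub> g + h \<bullet>\<^bsub>t\<^esub> row_deriv A A' g"
    "col_deriv A A' (h \<bullet>\<^bsub>t\<^esub> g) = col_deriv A A' h \<bullet>\<^bsub>t\<^esub> g + h \<bullet>\<^bsub>t\<^esub> col_deriv A A' g"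
proof -
  have ne: "A \<notin> I34" "A' \<notin> I12"
    using assms by auto
  \<comment> \<open>Operators starting at A' or ending at A are Kronecker deltas. Hence the term
    where the derivation hits the prefactor is the recursion for the generator with substituted row
    or column.\<close>
  note triv = act_trivial[OF disjI1[OF ne(2)]] act_trivial[OF disjI2[OF ne(1)]]
  show "row_deriv A A' (h \<bullet>\<^bsub>t\<^esub> g) = row_deriv A A' h \<bullet>\<^bsub>t\<^esub> g + h \<bullet>\<^bsub>t\<^esub> row_deriv A A' g"
  proof (induction h arbitrary: g rule: gl4_induct)
    case (entry i j h)
    have "row_deriv A A' ((a_gl4 i j * h) \<bullet>\<^bsub>t\<^esub> g) =
        (\<Sum>k\<in>UNIV. \<Sum>l\<in>UNIV. (if k = A then a_gl4 A' l * (h \<bullet>\<^bsub>t\<^esub> row_act t i A (col_act (neg_theta t) l j g)) else 0)) +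
        ((a_gl4 i j * row_deriv A A' h) \<bullet>\<^bsub>t\<^esub> g + (a_gl4 i j * h) \<bullet>\<^bsub>t\<^esub> row_deriv A A' g)"
      by (simp add: twisted_mult_entry deriv_simps deriv_gens[OF assms] entry.IH deriv_act_commute[OF assms]
          distrib_left sum.distrib cong: if_cong)
    also have "(\<Sum>k\<in>UNIV. \<Sum>l\<in>UNIV. (if k = A then a_gl4 A' l * (h \<bullet>\<^bsub>t\<^esub> row_act t i A (col_act (neg_theta t) l j g)) else 0)) =
        (\<Sum>l\<in>UNIV. a_gl4 A' l * (h \<bullet>\<^bsub>t\<^esub> row_act t i A (col_act (neg_theta t) l j g)))"
      by (subst sum.swap) simp
    also have "\<dots> = (if i = A then (a_gl4 A' j * h) \<bullet>\<^bsub>t\<^esub> g else 0)"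
    proof -
      have "(\<Sum>k\<in>UNIV. \<Sum>l\<in>UNIV. if A' = k then a_gl4 k l * (h \<bullet>\<^bsub>t\<^esub> col_act (neg_theta t) l j g) else 0) =
          (\<Sum>l\<in>UNIV. a_gl4 A' l * (h \<bullet>\<^bsub>t\<^esub> col_act (neg_theta t) l j g))"
        by (subst sum.swap) simp
      then show ?thesis
        by (simp add: twisted_mult_entry triv twisted_simps if_distrib[of "\<lambda>x. _ \<bullet>\<^bsub>t\<^esub> x"]
            if_distrib[of "\<lambda>x. _ * x"] cong: if_cong)
    qed
    finally show ?case
      by (simp add: deriv_gens[OF assms] twisted_simps)
  qed (simp_all add: deriv_simps deriv_gens[OF assms] twisted_mult_det_inv distrib_left
      twisted_simps scaleC_add_right)
  show "col_deriv A A' (h \<bullet>\<^bsub>t\<^esub> g) = col_deriv A A' h \<bullet>\<^bsub>t\<^esub> g + h \<bullet>\<^bsub>t\<^esub> col_deriv A A' g"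
  proof (induction h arbitrary: g rule: gl4_induct)
    case (entry i j h)
    have "col_deriv A A' ((a_gl4 i j * h) \<bullet>\<^bsub>t\<^esub> g) =
        (\<Sum>k\<in>UNIV. \<Sum>l\<in>UNIV. (if l = A' then a_gl4 k A * (h \<bullet>\<^bsub>t\<^esub> row_act t i k (col_act (neg_theta t) A' j g)) else 0)) +
        ((a_gl4 i j * col_deriv A A' h) \<bullet>\<^bsub>t\<^esub> g + (a_gl4 i j * h) \<bullet>\<^bsub>t\<^esub> col_deriv A A' g)"
      by (simp add: twisted_mult_entry deriv_simps deriv_gens[OF assms] entry.IH deriv_act_commute[OF assms]
          distrib_left sum.distrib cong: if_cong)
    also have "(\<Sum>k\<in>UNIV. \<Sum>l\<in>UNIV. (if l = A' then a_gl4 k A * (h \<bullet>\<^bsub>t\<^esub> row_act t i k (col_act (neg_theta t) A' j g)) else 0)) =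
        (if j = A' then (a_gl4 i A * h) \<bullet>\<^bsub>t\<^esub> g else 0)"
      by (simp add: twisted_mult_entry triv twisted_simps row_act_simps if_distrib[of "\<lambda>x. _ \<bullet>\<^bsub>t\<^esub> x"]
            if_distrib[of "\<lambda>x. _ * x"] if_distrib[of "row_act _ _ _"] cong: if_cong)
    finally show ?case
      by (simp add: deriv_gens[OF assms] twisted_simps)
  qed (simp_all add: deriv_simps deriv_gens[OF assms] twisted_mult_det_inv distrib_left
      twisted_simps scaleC_add_right)
qed

lemma shift_twisted_mult:
  "row_shift t' i j (h \<bullet>\<^bsub>t\<^esub> g) = row_shift t' i j h \<bullet>\<^bsub>t\<^esub> g + h \<bullet>\<^bsub>t\<^esub> row_shift t' i j g"
  "col_shift t' i j (h \<bullet>\<^bsub>t\<^esub> g) = col_shift t' i j h \<bullet>\<^bsub>t\<^esub> g + h \<bullet>\<^bsub>t\<^esub> col_shift t' i j g"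
  by (simp_all add: row_shift_def col_shift_def deriv_twisted_mult twisted_simps scaleC_add_right
      add_ac)

text \<open>Since shifts are derivations of the twisted product and two chained shifts vanish, the
  operator matrices are compatible with it as a matrix coproduct; for columns the order of the
  indices is reversed.\<close>

lemma act_twisted_mult:
  "row_act t' i j (h \<bullet>\<^bsub>t\<^esub> g) = (\<Sum>k\<in>UNIV. row_act t' i k h \<bullet>\<^bsub>t\<^esub> row_act t' k j g)"
  "col_act t' i j (h \<bullet>\<^bsub>t\<^esub> g) = (\<Sum>k\<in>UNIV. col_act t' k j h \<bullet>\<^bsub>t\<^esub> col_act t' i k g)"
  unfolding sum_act_bilinear[OF cbilinear_twisted_mult]
  by (simp_all add: act_eq_shift shift_twisted_mult add_ac)

lemma twisted_mult_a:
  "a_gl4 i j \<bullet>\<^bsub>t\<^esub> g = (\<Sum>k\<in>UNIV. \<Sum>l\<in>UNIV.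
    a_gl4 k l * row_act t i k (col_act (neg_theta t) l j g))"
  using twisted_mult_entry[of i j 1 t g] by simp

lemma sum_rotate4:
  "(\<Sum>a\<in>A. \<Sum>b\<in>B. \<Sum>c\<in>C. \<Sum>d\<in>D. f a b c d) = (\<Sum>c\<in>C. \<Sum>d\<in>D. \<Sum>b\<in>B. \<Sum>a\<in>A. f a b c d)"
proof -
  have "(\<Sum>a\<in>A. \<Sum>b\<in>B. \<Sum>c\<in>C. \<Sum>d\<in>D. f a b c d) = (\<Sum>b\<in>B. \<Sum>a\<in>A. \<Sum>c\<in>C. \<Sum>d\<in>D. f a b c d)"
    by (rule sum.swap)
  also have "\<dots> = (\<Sum>b\<in>B. \<Sum>c\<in>C. \<Sum>d\<in>D. \<Sum>a\<in>A. f a b c d)"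
    by (rule sum.cong[OF refl], rule trans[OF sum.swap], rule sum.cong[OF refl], rule sum.swap)
  also have "\<dots> = (\<Sum>c\<in>C. \<Sum>d\<in>D. \<Sum>b\<in>B. \<Sum>a\<in>A. f a b c d)"
    by (rule trans[OF sum.swap], rule sum.cong[OF refl], rule sum.swap)
  finally show ?thesis .
qed

text \<open>Only a generator on the left is treated: this suffices for evaluating words from the
  left, and no cocycle identity for F is required.\<close>

lemma twisted_mult_a_assoc: "(a_gl4 i j \<bullet>\<^bsub>t\<^esub> h) \<bullet>\<^bsub>t\<^esub> g = a_gl4 i j \<bullet>\<^bsub>t\<^esub> (h \<bullet>\<^bsub>t\<^esub> g)"
proof -
  let ?R = "row_act t" and ?C = "col_act (neg_theta t)"
  have comm: "?R k k' (?C l l' x) = ?C l l' (?R k k' x)" for k k' l l' x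
    unfolding row_act_def col_act_def by (rule lact_ract[OF clinear_F(1) clinear_F(1)])
  have "(a_gl4 i j \<bullet>\<^bsub>t\<^esub> h) \<bullet>\<^bsub>t\<^esub> g = (\<Sum>k\<in>UNIV. \<Sum>l\<in>UNIV. \<Sum>k'\<in>UNIV. \<Sum>l'\<in>UNIV.
      a_gl4 k' l' * (?R i k (?C l j h) \<bullet>\<^bsub>t\<^esub> ?R k k' (?C l' l g)))"
    by (simp only: twisted_mult_a twisted_simps twisted_mult_entry)
  also have "\<dots> = (\<Sum>k'\<in>UNIV. \<Sum>l'\<in>UNIV. \<Sum>l\<in>UNIV. \<Sum>k\<in>UNIV.
      a_gl4 k' l' * (?R i k (?C l j h) \<bullet>\<^bsub>t\<^esub> ?R k k' (?C l' l g)))"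
    by (rule sum_rotate4)
  also have "\<dots> = a_gl4 i j \<bullet>\<^bsub>t\<^esub> (h \<bullet>\<^bsub>t\<^esub> g)"
    by (simp only: twisted_mult_a act_twisted_mult row_act_simps sum_distrib_left)
  finally show ?thesis .
qed

section \<open>Products of generators\<close>

text \<open>The product of (1 + row shift) and (1 - column shift), the sign coming from the inverse
  cocycle; the summation ranges shrink to where shifts can be nonzero.\<close>

lemma twisted_mult_a_expand:
  "a_gl4 i j \<bullet>\<^bsub>t\<^esub> g = a_gl4 i j * g + (\<Sum>k\<in>I34. a_gl4 k j * row_shift t i k g)
    - (\<Sum>l\<in>I12. a_gl4 i l * col_shift t l j g)
    - (\<Sum>k\<in>I34. \<Sum>l\<in>I12. a_gl4 k l * row_shift t i k (col_shift t l j g))"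
proof -
  have 1: "(\<Sum>k\<in>UNIV. f k * row_shift t i k g) = (\<Sum>k\<in>I34. f k * row_shift t i k g)" for f g
    by (rule sum.mono_neutral_right) (use shift_zero(1) in \<open>simp_all del: insert_iff\<close>)
  have 2: "(\<Sum>l\<in>UNIV. f l * col_shift t l j g) = (\<Sum>l\<in>I12. f l * col_shift t l j g)" for f
    by (rule sum.mono_neutral_right) (use shift_zero(2) in \<open>simp_all del: insert_iff\<close>)
  have 3: "(\<Sum>l\<in>UNIV. f l * row_shift t i k (col_shift t l j g)) =
      (\<Sum>l\<in>I12. f l * row_shift t i k (col_shift t l j g))" for f k
    by (rule sum.mono_neutral_right) (use shift_zero(2) row_shift_simps(3) in \<open>simp_all del: insert_iff\<close>)
  have "(\<Sum>k\<in>UNIV. \<Sum>l\<in>UNIV. a_gl4 k l * row_act t i k (col_act (neg_theta t) l j g)) =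
      (\<Sum>k\<in>UNIV. \<Sum>l\<in>UNIV. (if l = j then if i = k then a_gl4 i j * g else 0 else 0)
        + (if l = j then a_gl4 k j * row_shift t i k g else 0)
        - (if i = k then a_gl4 i l * col_shift t l j g else 0)
        - a_gl4 k l * row_shift t i k (col_shift t l j g))"
    by (intro sum.cong refl) (simp add: act_eq_shift shift_neg row_shift_simps algebra_simps)
  also have "\<dots> = a_gl4 i j * g + (\<Sum>k\<in>UNIV. a_gl4 k j * row_shift t i k g)
    - (\<Sum>k\<in>UNIV. \<Sum>l\<in>UNIV. (if i = k then a_gl4 i l * col_shift t l j g else 0))
    - (\<Sum>k\<in>UNIV. \<Sum>l\<in>UNIV. a_gl4 k l * row_shift t i k (col_shift t l j g))"
    by (simp add: sum.distrib sum_subtractf)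
  also have "(\<Sum>k\<in>UNIV. \<Sum>l\<in>UNIV. (if i = k then a_gl4 i l * col_shift t l j g else 0)) =
      (\<Sum>l\<in>UNIV. a_gl4 i l * col_shift t l j g)"
    by (subst sum.swap) simp
  also have "(\<Sum>k\<in>UNIV. \<Sum>l\<in>UNIV. a_gl4 k l * row_shift t i k (col_shift t l j g)) =
      (\<Sum>k\<in>I34. \<Sum>l\<in>I12. a_gl4 k l * row_shift t i k (col_shift t l j g))"
    unfolding 3 by (subst sum.swap, unfold 1, rule sum.swap)
  finally show ?thesis
    unfolding twisted_mult_a 1 2 .
qed

lemma shift_a:
  "row_shift t i j (a_gl4 p q) = (\<Sum>d\<in>I34. (\<i> / 2 * theta_ext t i p j d) *\<^sub>C a_gl4 d q)"
  "col_shift t i j (a_gl4 p q) = (\<Sum>b\<in>I12. (\<i> / 2 * theta_ext t i b j q) *\<^sub>C a_gl4 p b)"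
proof -
  have d: "row_deriv B B' (a_gl4 p q) = (if p = B then a_gl4 B' q else 0)"
    "col_deriv B B' (a_gl4 p q) = (if q = B' then a_gl4 p B else 0)" if "B \<in> I12" "B' \<in> I34" for B B'
    using deriv_gens(5,6)[OF that, of p q 1] deriv_gens(1,2)[OF that] by simp_all
  have "row_shift t i j (a_gl4 p q) =
      (\<Sum>B\<in>I12. \<Sum>B'\<in>I34. if B = p then (\<i> / 2 * theta_ext t i p j B') *\<^sub>C a_gl4 B' q else 0)"
    unfolding row_shift_def by (intro sum.cong refl) (simp add: d del: insert_iff)
  also have "\<dots> = (\<Sum>B'\<in>I34. \<Sum>B\<in>I12. if B = p then (\<i> / 2 * theta_ext t i p j B') *\<^sub>C a_gl4 B' q else 0)"
    by (rule sum.swap)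
  also have "\<dots> = (\<Sum>d\<in>I34. (\<i> / 2 * theta_ext t i p j d) *\<^sub>C a_gl4 d q)"
    by (intro sum.cong refl) (simp only: sum.delta finite.insertI finite.emptyI theta_ext_def, simp del: insert_iff)
  finally show "row_shift t i j (a_gl4 p q) = (\<Sum>d\<in>I34. (\<i> / 2 * theta_ext t i p j d) *\<^sub>C a_gl4 d q)" .
  have "col_shift t i j (a_gl4 p q) =
      (\<Sum>B\<in>I12. \<Sum>B'\<in>I34. if B' = q then (\<i> / 2 * theta_ext t i B j q) *\<^sub>C a_gl4 p B else 0)"
    unfolding col_shift_def by (intro sum.cong refl) (simp add: d del: insert_iff)
  also have "\<dots> = (\<Sum>d\<in>I12. (\<i> / 2 * theta_ext t i d j q) *\<^sub>C a_gl4 p d)"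
    by (intro sum.cong refl) (simp only: sum.delta finite.insertI finite.emptyI theta_ext_def, simp del: insert_iff)
  finally show "col_shift t i j (a_gl4 p q) = (\<Sum>b\<in>I12. (\<i> / 2 * theta_ext t i b j q) *\<^sub>C a_gl4 p b)" .
qed

definition row_term :: "theta_parameter \<Rightarrow> 4 \<Rightarrow> 4 \<Rightarrow> 4 \<Rightarrow> 4 \<Rightarrow> gl4"
  where "row_term t i j k l =
    (\<Sum>c\<in>I34. \<Sum>d\<in>I34. (\<i> / 2 * theta_ext t i k c d) *\<^sub>C (a_gl4 c j * a_gl4 d l))"

definition col_term :: "theta_parameter \<Rightarrow> 4 \<Rightarrow> 4 \<Rightarrow> 4 \<Rightarrow> 4 \<Rightarrow> gl4"
  where "col_term t i j k l =
    (\<Sum>c\<in>I12. \<Sum>d\<in>I12. (\<i> / 2 * theta_ext t c d j l) *\<^sub>C (a_gl4 i c * a_gl4 k d))"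

definition mixed_term :: "theta_parameter \<Rightarrow> 4 \<Rightarrow> 4 \<Rightarrow> 4 \<Rightarrow> 4 \<Rightarrow> gl4"
  where "mixed_term t i j k l =
    (\<Sum>a\<in>I34. \<Sum>b\<in>I34. \<Sum>c\<in>I12. \<Sum>d\<in>I12.
      (1/4 * theta_ext t i k a b * theta_ext t c d j l) *\<^sub>C (a_gl4 a c * a_gl4 b d))"

lemma twisted_mult_gens:
  "a_gl4 i j \<bullet>\<^bsub>t\<^esub> a_gl4 r l =
    a_gl4 i j * a_gl4 r l + row_term t i j r l - col_term t i j r l + mixed_term t i j r l"
proof -
  let ?k = "\<lambda>a b c d. - ((\<i> / 2 * theta_ext t i r a b) * (\<i> / 2 * theta_ext t c d j l))"
  \<comment> \<open>The coefficient 1/4 is minus the square of \<i>/2.\<close>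
  have k: "?k a b c d = 1/4 * theta_ext t i r a b * theta_ext t c d j l" for a b c d
    by (simp add: field_simps)
  have "- (\<Sum>a\<in>I34. \<Sum>c\<in>I12. a_gl4 a c * row_shift t i a (col_shift t c j (a_gl4 r l))) =
      (\<Sum>a\<in>I34. \<Sum>c\<in>I12. \<Sum>d\<in>I12. \<Sum>b\<in>I34. ?k a b c d *\<^sub>C (a_gl4 a c * a_gl4 b d))"
    by (simp only: shift_a row_shift_simps sum_distrib_left mult_scaleC_right scaleC_scaleC scaleC_sum_right
        scaleC_uminus_left sum_negf mult.commute)
  also have "\<dots> = mixed_term t i j r l"
    unfolding mixed_term_def k
    by (rule sum.cong[OF refl], rule trans[OF sum.cong[OF refl sum.swap] sum.swap])
  finally show ?thesis
    unfolding twisted_mult_a_expand row_term_def col_term_def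
    by (simp only: shift_a sum_distrib_left mult_scaleC_right diff_conv_add_uminus)
qed

lemma theta_ext_zero:
  "i \<notin> I12 \<or> k \<notin> I12 \<or> j \<notin> I34 \<or> l \<notin> I34 \<Longrightarrow> theta_ext t i k j l = 0"
  unfolding theta_ext_def by metis

lemma terms_zero:
  "i \<notin> I12 \<or> k \<notin> I12 \<Longrightarrow> row_term t i j k l = 0"
  "j \<notin> I34 \<or> l \<notin> I34 \<Longrightarrow> col_term t i j k l = 0"
  "i \<notin> I12 \<or> k \<notin> I12 \<or> j \<notin> I34 \<or> l \<notin> I34 \<Longrightarrow> mixed_term t i j k l = 0"
proof -
  note z = theta_ext_zero[of _ _ _ _ t]
  show "i \<notin> I12 \<or> k \<notin> I12 \<Longrightarrow> row_term t i j k l = 0"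
    unfolding row_term_def by (intro sum.neutral ballI) (use z[of i k] in auto)
  show "j \<notin> I34 \<or> l \<notin> I34 \<Longrightarrow> col_term t i j k l = 0"
    unfolding col_term_def by (intro sum.neutral ballI) (use z[of _ _ j l] in auto)
  show "i \<notin> I12 \<or> k \<notin> I12 \<or> j \<notin> I34 \<or> l \<notin> I34 \<Longrightarrow> mixed_term t i j k l = 0"
    unfolding mixed_term_def by (intro sum.neutral ballI) (use z[of i k] z[of _ _ j l] in auto)
qed

lemma index_disjoint: "i \<in> I12 \<Longrightarrow> i \<notin> I34" "i \<in> I34 \<Longrightarrow> i \<notin> I12"
  by auto

lemma twisted_gens_row:
  "j \<notin> I34 \<or> l \<notin> I34 \<Longrightarrow> a_gl4 i j \<bullet>\<^bsub>t\<^esub> a_gl4 k l = a_gl4 i j * a_gl4 k l + row_term t i j k l"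
  unfolding twisted_mult_gens using terms_zero(2,3) by (metis add.right_neutral diff_zero)

lemma twisted_gens_col:
  "i \<notin> I12 \<or> k \<notin> I12 \<Longrightarrow> a_gl4 i j \<bullet>\<^bsub>t\<^esub> a_gl4 k l = a_gl4 i j * a_gl4 k l - col_term t i j k l"
  unfolding twisted_mult_gens using terms_zero(1,3) by (metis add.right_neutral)

lemma twisted_gens_plain:
  "i \<notin> I12 \<or> k \<notin> I12 \<Longrightarrow> j \<notin> I34 \<or> l \<notin> I34 \<Longrightarrow> a_gl4 i j \<bullet>\<^bsub>t\<^esub> a_gl4 k l = a_gl4 i j * a_gl4 k l"
  unfolding twisted_gens_row using terms_zero(1) by (metis add.right_neutral)

text \<open>In the commutative product, exchanging the two factors amounts to transposing \<theta>,
  so the antisymmetric part of \<theta> gives a difference of two \<theta> terms.\<close>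

lemma sum_theta_minus:
  "(\<Sum>c\<in>I34. \<Sum>d\<in>I34. (\<i> * theta_minus t i k c d) *\<^sub>C (a_gl4 c j * a_gl4 d l)) =
    row_term t i j k l - row_term t k l i j"
  "(\<Sum>c\<in>I12. \<Sum>d\<in>I12. (\<i> * theta_minus t c d j l) *\<^sub>C (a_gl4 i c * a_gl4 k d)) =
    col_term t i j k l - col_term t k l i j"
proof -
  have c: "\<i> * theta_minus t i k c d = \<i> / 2 * theta_ext t i k c d - \<i> / 2 * theta_ext t k i d c" for i k c d
    by (simp add: theta_minus_def algebra_simps)
  have "row_term t k l i j = (\<Sum>c\<in>I34. \<Sum>d\<in>I34. (\<i> / 2 * theta_ext t k i d c) *\<^sub>C (a_gl4 c j * a_gl4 d l))"
    unfolding row_term_def by (subst sum.swap) (simp only: mult.commute[of "a_gl4 _ j"])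
  then show "(\<Sum>c\<in>I34. \<Sum>d\<in>I34. (\<i> * theta_minus t i k c d) *\<^sub>C (a_gl4 c j * a_gl4 d l)) =
    row_term t i j k l - row_term t k l i j"
    by (simp only: c scaleC_diff_left sum_subtractf row_term_def[of t i])
  have "col_term t k l i j = (\<Sum>c\<in>I12. \<Sum>d\<in>I12. (\<i> / 2 * theta_ext t d c l j) *\<^sub>C (a_gl4 i c * a_gl4 k d))"
    unfolding col_term_def by (subst sum.swap) (simp only: mult.commute[of "a_gl4 i _"])
  then show "(\<Sum>c\<in>I12. \<Sum>d\<in>I12. (\<i> * theta_minus t c d j l) *\<^sub>C (a_gl4 i c * a_gl4 k d)) =
    col_term t i j k l - col_term t k l i j"
    by (simp only: c scaleC_diff_left sum_subtractf col_term_def[of t i])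
qed

text \<open>The commutation relations have twisted products on the right, and their own \<theta>
  corrections must account for the quadratic terms. Four products of \<theta> arise on the right;
  two cancel after exchanging c with d and e with f. This depends on the reversed order of factors
  in the column sum.\<close>

lemma mixed_term_comm:
  "mixed_term t i j r s - mixed_term t r s i j =
    - (\<Sum>c\<in>I34. \<Sum>d\<in>I34. (\<i> * theta_minus t i r c d) *\<^sub>C col_term t c j d s)
    - (\<Sum>c\<in>I12. \<Sum>d\<in>I12. (\<i> * theta_minus t c d j s) *\<^sub>C row_term t r d i c)"
proof -
  define X where "X k = (\<Sum>c\<in>I34. \<Sum>d\<in>I34. \<Sum>e\<in>I12. \<Sum>f\<in>I12. k c d e f *\<^sub>C (a_gl4 c e * a_gl4 d f))"
    for k :: theta_parameter
  let ?t = "theta_ext t" and ?m = "theta_minus t"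
  have add: "X k + X l = X (\<lambda>c d e f. k c d e f + l c d e f)" and minus: "- X k = X (\<lambda>c d e f. - k c d e f)" for k l
    unfolding X_def by (simp_all only: scaleC_add_left sum.distrib scaleC_uminus_left sum_negf)
  have swap: "X k = X (\<lambda>c d e f. k d c f e)" for k
    unfolding X_def by (rule trans[OF sum_swap4]) (simp only: mult.commute)
  have 1: "(\<Sum>c\<in>I34. \<Sum>d\<in>I34. (\<i> * ?m i r c d) *\<^sub>C col_term t c j d s) =
      X (\<lambda>c d e f. \<i> * ?m i r c d * (\<i> / 2 * ?t e f j s))"
    unfolding X_def col_term_def by (simp only: scaleC_sum_right scaleC_scaleC)
  have 2: "(\<Sum>c\<in>I12. \<Sum>d\<in>I12. (\<i> * ?m c d j s) *\<^sub>C row_term t r d i c) =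
      X (\<lambda>c d e f. \<i> * ?m f e j s * (\<i> / 2 * ?t r i c d))"
    unfolding X_def row_term_def scaleC_sum_right scaleC_scaleC by (rule sum_rotate4)
  have 3: "mixed_term t i j r s = X (\<lambda>c d e f. 1/4 * ?t i r c d * ?t e f j s)" for i j r s
    unfolding X_def mixed_term_def ..
  have "- X (\<lambda>c d e f. \<i> * ?m i r c d * (\<i> / 2 * ?t e f j s)) - X (\<lambda>c d e f. \<i> * ?m f e j s * (\<i> / 2 * ?t r i c d)) =
      X (\<lambda>c d e f. (1/4 * ?t i r c d * ?t e f j s + - (1/4 * ?t r i c d * ?t e f s j))
        + (1/4 * ?t r i c d * ?t f e j s + - (1/4 * ?t r i d c * ?t e f j s)))"
    unfolding diff_conv_add_uminus minus add
    by (rule arg_cong[where f = X], intro ext) (simp add: theta_minus_def field_simps)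
  also have "\<dots> = X (\<lambda>c d e f. 1/4 * ?t i r c d * ?t e f j s) - X (\<lambda>c d e f. 1/4 * ?t r i c d * ?t e f s j)
      + (X (\<lambda>c d e f. 1/4 * ?t r i c d * ?t f e j s) - X (\<lambda>c d e f. 1/4 * ?t r i d c * ?t e f j s))"
    by (simp only: add minus diff_conv_add_uminus)
  also have "X (\<lambda>c d e f. 1/4 * ?t r i c d * ?t f e j s) = X (\<lambda>c d e f. 1/4 * ?t r i d c * ?t e f j s)"
    by (rule swap)
  finally show ?thesis
    unfolding 1 2 3 by simp
qed

text \<open>One formula for all entries; the individual relations follow by discarding the sums in
  which \<open>theta_minus\<close> vanishes.\<close>

lemma twisted_comm_row_col:
  "twisted_comm t (a_gl4 i j) (a_gl4 k l) =
    (\<Sum>c\<in>I34. \<Sum>d\<in>I34. (\<i> * theta_minus t i k c d) *\<^sub>C (a_gl4 c j \<bullet>\<^bsub>t\<^esub> a_gl4 d l))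
    - (\<Sum>c\<in>I12. \<Sum>d\<in>I12. (\<i> * theta_minus t c d j l) *\<^sub>C (a_gl4 k d \<bullet>\<^bsub>t\<^esub> a_gl4 i c))"
proof -
  have "(\<Sum>c\<in>I34. \<Sum>d\<in>I34. (\<i> * theta_minus t i k c d) *\<^sub>C (a_gl4 c j \<bullet>\<^bsub>t\<^esub> a_gl4 d l)) =
      (\<Sum>c\<in>I34. \<Sum>d\<in>I34. (\<i> * theta_minus t i k c d) *\<^sub>C (a_gl4 c j * a_gl4 d l - col_term t c j d l))"
    by (intro sum.cong refl) (simp only: twisted_gens_col index_disjoint simp_thms)
  moreover have "(\<Sum>c\<in>I12. \<Sum>d\<in>I12. (\<i> * theta_minus t c d j l) *\<^sub>C (a_gl4 k d \<bullet>\<^bsub>t\<^esub> a_gl4 i c)) =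
      (\<Sum>c\<in>I12. \<Sum>d\<in>I12. (\<i> * theta_minus t c d j l) *\<^sub>C (a_gl4 i c * a_gl4 k d + row_term t k d i c))"
    by (intro sum.cong refl)
      (simp only: twisted_gens_row index_disjoint simp_thms mult.commute[of "a_gl4 k _"])
  ultimately show ?thesis
    using mixed_term_comm[of t i j k l]
    by (simp only: scaleC_diff_right scaleC_add_right sum_subtractf sum.distrib sum_theta_minus
        twisted_comm_def twisted_mult_gens) (simp add: algebra_simps)
qed

lemma theta_minus_zero:
  "i \<notin> I12 \<or> k \<notin> I12 \<or> j \<notin> I34 \<or> l \<notin> I34 \<Longrightarrow> theta_minus t i k j l = 0"
  by (elim disjE) (simp_all add: theta_minus_def theta_ext_zero del: insert_iff)

lemma twisted_comm_row:
  assumes "j \<in> I12 \<or> l \<in> I12"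
  shows "twisted_comm t (a_gl4 i j) (a_gl4 k l) =
    (\<Sum>c\<in>I34. \<Sum>d\<in>I34. (\<i> * theta_minus t i k c d) *\<^sub>C (a_gl4 c j \<bullet>\<^bsub>t\<^esub> a_gl4 d l))"
proof -
  have "theta_minus t c d j l = 0" for c d
    using assms by (intro theta_minus_zero) auto
  then show ?thesis
    unfolding twisted_comm_row_col by simp
qed

lemma twisted_comm_col:
  assumes "i \<in> I34 \<or> k \<in> I34"
  shows "twisted_comm t (a_gl4 i j) (a_gl4 k l) =
    - (\<Sum>c\<in>I12. \<Sum>d\<in>I12. (\<i> * theta_minus t c d j l) *\<^sub>C (a_gl4 k d \<bullet>\<^bsub>t\<^esub> a_gl4 i c))"
proof -
  have "theta_minus t i k c d = 0" for c d
    using assms by (intro theta_minus_zero) auto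
  then show ?thesis
    unfolding twisted_comm_row_col by simp
qed

lemma twisted_comm_zero:
  assumes "i \<in> I34 \<or> k \<in> I34" "j \<in> I12 \<or> l \<in> I12"
  shows "twisted_comm t (a_gl4 i j) (a_gl4 k l) = 0"
proof -
  have "theta_minus t c d j l = 0" for c d
    using assms by (intro theta_minus_zero) auto
  then show ?thesis
    unfolding twisted_comm_col[OF assms(1)] by simp
qed

section \<open>The antipode\<close>

text \<open>Cramer's rule over a commutative ring: \<open>r k (axis j 1)\<close> is a cofactor, and
  expanding with the wrong row gives a determinant with two equal rows.\<close>

lemma exists_matrix_right_inverse:
  fixes A :: "'a::comm_ring_1 ^ 'n ^ 'n"
  assumes "d * det A = 1"
  shows "\<exists>B. A ** B = mat 1"
proof -
  define r where "r k x = det (\<chi> i. if i = k then x else A $ i)" for k and x :: "'a ^ 'n"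
  have row: "(\<Sum>j\<in>UNIV. A $ i $ j * r k (axis j 1)) = (if i = k then det A else 0)" for i k
  proof -
    have "(\<Sum>j\<in>UNIV. A $ i $ j * r k (axis j 1)) = r k (\<Sum>j\<in>UNIV. A $ i $ j *s axis j 1)"
      by (simp only: r_def det_linear_row_sum[OF finite] det_row_mul)
    also have "\<dots> = r k (A $ i)"
      by (simp only: basis_expansion)
    also have "\<dots> = (if i = k then det A else 0)"
    proof (cases "i = k")
      case True
      then have "(\<chi> l. if l = k then A $ i else A $ l) = A"
        by (simp add: vec_eq_iff)
      with True show ?thesis
        by (simp only: r_def simp_thms if_True)
    next
      case False
      then have "r k (A $ i) = 0"
        unfolding r_def by (intro det_identical_rows[of i k]) (auto simp: row_def)
      with False show ?thesis
        by simp
    qed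
    finally show ?thesis .
  qed
  define B where "B = (\<chi> j k. d * r k (axis j 1))"
  have "(A ** B) $ i $ k = d * (\<Sum>j\<in>UNIV. A $ i $ j * r k (axis j 1))" for i k
    by (simp add: matrix_matrix_mult_def B_def sum_distrib_left mult.left_commute)
  then have "A ** B = mat 1"
    by (simp add: vec_eq_iff row mat_def assms)
  then show ?thesis ..
qed

lemma exists_matrix_inverse:
  fixes A :: "'a::comm_ring_1 ^ 'n ^ 'n"
  assumes "d * det A = 1"
  shows "\<exists>B. A ** B = mat 1 \<and> B ** A = mat 1"
proof -
  obtain B where B: "A ** B = mat 1"
    using exists_matrix_right_inverse[OF assms] by blast
  \<comment> \<open>A left inverse comes from a right inverse of the transpose; the two one-sided
    inverses then agree.\<close>
  obtain C where "transpose A ** C = mat 1"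
    using exists_matrix_right_inverse[of d "transpose A"] assms by auto
  then have C: "transpose C ** A = mat 1"
    by (metis matrix_transpose_mul transpose_mat transpose_transpose)
  have "transpose C = transpose C ** (A ** B)"
    by (simp add: B)
  also have "\<dots> = B"
    by (simp add: C matrix_mul_assoc)
  finally show ?thesis
    using B C by blast
qed

text \<open>The inverse matrix defines an algebra map S. The antipode identities hold on generators
  and propagate to products because the target is commutative, and uniqueness of convolution
  inverses identifies S with the definite description.\<close>

lemma antipode_properties:
  "algebra_hom antipode" "(\<Sum>k\<in>UNIV. a_gl4 i k * antipode (a_gl4 k j)) = (if i = j then 1 else 0)"
  "antipode det_inv = det a_matrix"
proof -
  obtain B where B: "a_matrix ** B = mat 1" "B ** a_matrix = mat 1"
    using exists_matrix_inverse[OF det_inv_det] by blast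
  have "det a_matrix * det B = 1"
    using arg_cong[OF B(1), of det] by (simp add: det_mul)
  then have wd: "det a_matrix * det (\<chi> i j. B $ i $ j) = 1"
    by simp
  define S where "S = gl4_hom (\<lambda>i j. B $ i $ j) (det a_matrix)"
  have hom: "algebra_hom S"
    unfolding S_def by (rule algebra_hom_gl4_hom[OF wd])
  have gens: "S (a_gl4 i j) = B $ i $ j" "S det_inv = det a_matrix" for i j
    unfolding S_def by (simp_all add: gl4_hom_gens[OF wd])
  note S = algebra_homD[OF hom] clinear_simps[OF algebra_homD(1)[OF hom]]
  have sum: "(\<Sum>k\<in>UNIV. a_gl4 i k * S (a_gl4 k j)) = (if i = j then 1 else 0)"
    "(\<Sum>k\<in>UNIV. S (a_gl4 i k) * a_gl4 k j) = (if i = j then 1 else 0)" for i j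
    using arg_cong[OF B(1), of "\<lambda>M. M $ i $ j"] arg_cong[OF B(2), of "\<lambda>M. M $ i $ j"]
    by (simp_all add: gens matrix_matrix_mult_def a_matrix_def mat_def)
  have b: "cbilinear (\<lambda>x y. S x * y)" "cbilinear (\<lambda>x y. x * S y)"
    by (simp_all add: cbilinear_iff S distrib_left distrib_right scaleC_simps)
  have m: "sweedler2 (\<lambda>x y. a * S x * (b * y)) h = (a * b) * sweedler2 (\<lambda>x y. S x * y) h"
    "sweedler2 (\<lambda>x y. a * x * (b * S y)) h = (a * b) * sweedler2 (\<lambda>x y. x * S y) h" for a b h
    unfolding sweedler2_fun_mult_left[symmetric] by (simp_all only: mult_ac)
  have conv: "sweedler2 (\<lambda>x y. S x * y) h = counit h *\<^sub>C 1" "sweedler2 (\<lambda>x y. x * S y) h = counit h *\<^sub>C 1" for h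
  proof -
    show "sweedler2 (\<lambda>x y. S x * y) h = counit h *\<^sub>C 1"
      by (induction h rule: gl4_induct)
        (simp_all add: sweedler2_one sweedler2_entry sweedler2_det_inv sweedler2_elem b S m gens(2) scaleC_simps scaleC_complex_def scaleC_sum_right[symmetric] sum
          mult.commute[of _ det_inv] det_inv_det)
    show "sweedler2 (\<lambda>x y. x * S y) h = counit h *\<^sub>C 1"
      by (induction h rule: gl4_induct)
        (simp_all add: sweedler2_one sweedler2_entry sweedler2_det_inv sweedler2_elem b S m gens(2) scaleC_simps scaleC_complex_def scaleC_sum_right[symmetric] sum
          det_inv_det)
  qed
  have "antipode = S"
    unfolding antipode_def
  proof (rule the_equality)
    fix T assume T: "clinear T \<and> (\<forall>h. sweedler2 (\<lambda>h1 h2. T h1 * h2) h = counit h *\<^sub>C 1 \<and>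
      sweedler2 (\<lambda>h1 h2. h1 * T h2) h = counit h *\<^sub>C 1)"
    show "T = S"
      by (rule convolution_inverse_unique[of "\<lambda>x. x"]) (use T conv S(1) in \<open>auto simp: clinear_iff\<close>)
  qed (use S(1) conv in blast)
  with hom sum(1) gens(2) show "algebra_hom antipode"
    "(\<Sum>k\<in>UNIV. a_gl4 i k * antipode (a_gl4 k j)) = (if i = j then 1 else 0)"
    "antipode det_inv = det a_matrix"
    by simp_all
qed

lemmas antipode_simps = algebra_homD[OF antipode_properties(1)]
  clinear_simps[OF algebra_homD(1)[OF antipode_properties(1)]]

text \<open>At e = -1 this is the antipode of the additive group; general e keeps U and its inverse
  in one family.\<close>

definition scale_vars :: "complex \<Rightarrow> 'v cpoly \<Rightarrow> 'v cpoly"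
  where "scale_vars e = poly_eval (\<lambda>v. e *\<^sub>C var v)"

lemma scale_vars_simps:
  "scale_vars e 1 = 1" "scale_vars e (p + q) = scale_vars e p + scale_vars e q"
  "scale_vars e (p * q) = scale_vars e p * scale_vars e q" "scale_vars e (c *\<^sub>C p) = c *\<^sub>C scale_vars e p"
  "scale_vars e (var v) = e *\<^sub>C var v" "scale_vars e 0 = 0"
  by (simp_all add: scale_vars_def poly_eval_add poly_eval_mult poly_eval_scaleC)

lemma partial_deriv_scale_vars: "partial_deriv v (scale_vars e p) = e *\<^sub>C scale_vars e (partial_deriv v p)"
  by (induction p rule: cpoly_induct)
    (simp_all add: scale_vars_simps partial_deriv_simps partial_deriv_var_mult scaleC_simps,
     simp add: mult.commute)

lemma restrict_antipode: "res (antipode h) = scale_vars (- 1) (res h)"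
proof (induction h rule: gl4_induct)
  case (entry i j h)
  let ?p = res
  have sum: "(\<Sum>k\<in>UNIV. ?p (a_gl4 i k) * ?p (antipode (a_gl4 k j))) = (if i = j then 1 else 0)" for i j
    using arg_cong[OF antipode_properties(2)[of i j], of ?p] by (simp add: restrict_simps if_distrib cong: if_cong)
  \<comment> \<open>The lower rows of the restricted matrix are those of the identity, hence so are
    the lower rows of its inverse; the upper rows are then solved for.\<close>
  have lower: "?p (antipode (a_gl4 k j)) = (if k = j then 1 else 0)" if "k \<in> I34" for k j
  proof -
    have "?p (a_gl4 k l) = (if k = l then 1 else 0)" for l
      using index_disjoint(2)[OF that] by (simp only: restrict_gens simp_thms if_False)
    then show ?thesis
      using sum[of k j] by (simp add: if_distrib[of "\<lambda>x. x * _"] cong: if_cong)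
  qed
  have "?p (antipode (a_gl4 i j)) = scale_vars (- 1) (?p (a_gl4 i j))"
  proof (cases "i \<in> I34")
    case True
    then have "i \<notin> I12"
      by (rule index_disjoint)
    then show ?thesis
      by (simp only: lower[OF True] restrict_gens) (simp add: scale_vars_simps)
  next
    case False
    then have i: "i \<in> I12"
      using exhaust_4[of i] by auto
    have "?p (a_gl4 i k) * ?p (antipode (a_gl4 k j)) =
        (if k = i then ?p (antipode (a_gl4 i j)) else 0) +
        (if k = j then if j \<in> I34 then var (t_var i j) else 0 else 0)" for k
      using i False lower[of k j] unfolding restrict_gens by (cases "k \<in> I34") (auto simp del: insert_iff)
    then have "?p (antipode (a_gl4 i j)) + (if j \<in> I34 then var (t_var i j) else 0) = (if i = j then 1 else 0)"
      using sum[of i j] by (simp add: sum.distrib del: insert_iff)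
    then have *: "?p (antipode (a_gl4 i j)) = (if i = j then 1 else 0) - (if j \<in> I34 then var (t_var i j) else 0)"
      by (simp only: eq_diff_eq)
    show ?thesis
      unfolding * restrict_gens using i False by (auto simp: scale_vars_simps scaleC_minus_one simp del: insert_iff)
  qed
  with entry show ?case
    by (simp add: antipode_simps restrict_simps scale_vars_simps)
qed (simp_all add: antipode_simps antipode_properties(3) restrict_simps restrict_gens restrict_det
    scale_vars_simps)


text \<open>\<open>U\<close> and its convolution inverse are Gaussian functionals: they are exponentials of
  \<open>\<mp>(\<i>/2) \<theta>\<^sup>A\<^sup>B\<^sub>A\<^sub>'\<^sub>B\<^sub>' \<partial>\<^sup>A\<^sup>'\<^sub>A \<partial>\<^sup>B\<^sup>'\<^sub>B\<close>.\<close>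

definition gauss :: "theta_parameter \<Rightarrow> complex \<Rightarrow> gl4 \<Rightarrow> complex"
  where "gauss t e = sweedler2 (\<lambda>x y. cocycle t (res x)
    (scale_vars e (res y)))"

lemmas clinear_cocycle = cbilinearD[OF cbilinear_cocycle]
lemmas cocycle_simps = clinear_simps[OF clinear_cocycle(1)] clinear_simps[OF clinear_cocycle(2)]

lemma cbilinear_gauss: "cbilinear (\<lambda>x y. cocycle t (res x)
    (scale_vars e (res y)))"
  by (simp add: cbilinear_iff restrict_simps scale_vars_simps cocycle_simps)

lemma clinear_gauss: "clinear (gauss t e)"
  unfolding gauss_def by (rule clinear_sweedler2_elem[OF cbilinear_gauss])

lemmas gauss_simps = clinear_simps[OF clinear_gauss]

lemma gauss_one: "gauss t e 1 = 1"
  by (simp add: gauss_def sweedler2_one cbilinear_gauss restrict_simps scale_vars_simps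
      cocycle_one)

lemma gauss_det_inv: "gauss t e (det_inv * h) = gauss t e h"
  by (simp add: gauss_def sweedler2_det_inv cbilinear_gauss restrict_simps restrict_gens)

text \<open>A row derivation reaches the first leg and a column derivation the second. Moving
  between the legs swaps row with column, which restriction cannot see, so the two agree inside
  \<open>gauss\<close>.\<close>

lemma gauss_deriv:
  assumes "A \<in> I12" "A' \<in> I34"
  shows "gauss t e (row_deriv A A' h) = sweedler2 (\<lambda>x y. cocycle t
      (partial_deriv (t_var A A') (res x)) (scale_vars e (res y))) h"
    "gauss t e (col_deriv A A' h) = sweedler2 (\<lambda>x y. cocycle t
      (res x) (scale_vars e (partial_deriv (t_var A A') (res y)))) h"
    "gauss t e (col_deriv A A' h) = gauss t e (row_deriv A A' h)"
proof -
  let ?f = "\<lambda>x y. cocycle t (res x)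
    (scale_vars e (res y))"
  have row: "gauss t e (row_deriv A A' h) = sweedler2 (\<lambda>x y. ?f (row_deriv A A' x) y) h"
    unfolding gauss_def row_deriv_def by (rule sweedler2_lact[OF cbilinear_gauss clinear_ell])
  have col: "gauss t e (col_deriv A A' h) = sweedler2 (\<lambda>x y. ?f x (col_deriv A A' y)) h"
    unfolding gauss_def col_deriv_def by (rule sweedler2_ract[OF cbilinear_gauss clinear_ell])
  have "sweedler2 (\<lambda>x y. ?f (col_deriv A A' x) y) h = sweedler2 (\<lambda>x y. ?f x (row_deriv A A' y)) h"
    unfolding row_deriv_def col_deriv_def by (rule sweedler2_ract_lact[OF cbilinear_gauss clinear_ell])
  with row col show "gauss t e (row_deriv A A' h) = sweedler2 (\<lambda>x y. cocycle t
      (partial_deriv (t_var A A') (res x)) (scale_vars e (res y))) h"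
    "gauss t e (col_deriv A A' h) = sweedler2 (\<lambda>x y. cocycle t
      (res x) (scale_vars e (partial_deriv (t_var A A') (res y)))) h"
    "gauss t e (col_deriv A A' h) = gauss t e (row_deriv A A' h)"
    by (simp_all only: restrict_deriv[OF assms])
qed

text \<open>The derivative of the quadratic exponent, which involves \<theta> symmetrised over its
  two slots.\<close>

definition gauss_coeff :: "theta_parameter \<Rightarrow> 4 \<Rightarrow> 4 \<Rightarrow> 4 \<Rightarrow> 4 \<Rightarrow> complex"
  where "gauss_coeff t i B j B' = \<i> / 2 * theta_ext t i B j B' + \<i> / 2 * theta_ext t B i B' j"

lemma gauss_coeff_zero: "i \<notin> I12 \<or> j \<notin> I34 \<Longrightarrow> gauss_coeff t i B j B' = 0"
  by (elim disjE) (simp_all add: gauss_coeff_def theta_ext_zero del: insert_iff)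

text \<open>The coordinate lands in either leg. In the second it is scaled by e; in the first it
  differentiates the scaled second leg and again yields e. Both contributions therefore carry the
  same factor.\<close>

lemma gauss_a_mult:
  "gauss t e (a_gl4 i j * h) = (if i = j then gauss t e h else 0) +
    e * (\<Sum>B\<in>I12. \<Sum>B'\<in>I34. gauss_coeff t i B j B' * gauss t e (row_deriv B B' h))"
proof -
  let ?p = res and ?s = "scale_vars e" and ?T = "cocycle t"
  have W: "gauss t e (a_gl4 i j * h) =
      (\<Sum>k\<in>UNIV. sweedler2 (\<lambda>x y. ?T (?p (a_gl4 i k) * ?p x) (?s (?p (a_gl4 k j)) * ?s (?p y))) h)"
    by (simp only: gauss_def sweedler2_entry[OF cbilinear_gauss] restrict_simps scale_vars_simps)
  show ?thesis
  proof (cases "i \<in> I12 \<and> j \<in> I34")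
    case False
    have *: "?p (a_gl4 k l) = (if k = l then 1 else 0)" if "\<not> (k \<in> I12 \<and> l \<in> I34)" for k l
      unfolding restrict_gens using that by (rule if_not_P)
    have "sweedler2 (\<lambda>x y. ?T (?p (a_gl4 i k) * ?p x) (?s (?p (a_gl4 k j)) * ?s (?p y))) h =
        (if k = i then if i = j then gauss t e h else 0 else 0)" for k
    proof (cases "i \<in> I12 \<and> k \<in> I34")
      case True
      then have "k \<noteq> i" "k \<noteq> j" "\<not> (k \<in> I12 \<and> j \<in> I34)"
        using False by auto
      then have "?p (a_gl4 k j) = 0"
        using *[of k j] by presburger
      with \<open>k \<noteq> i\<close> show ?thesis
        by (simp add: scale_vars_simps cocycle_simps sweedler2_fun_zero del: insert_iff)
    next
      case False
      then show ?thesis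
        using *[OF False] *[OF \<open>\<not> (i \<in> I12 \<and> j \<in> I34)\<close>]
        by (cases "i = k") (simp_all add: gauss_def scale_vars_simps cocycle_simps sweedler2_fun_zero
          if_distrib[of ?s] sweedler2_if del: insert_iff)
    qed
    moreover have "gauss_coeff t i B j B' = 0" for B B'
      using False by (intro gauss_coeff_zero) blast
    ultimately show ?thesis
      unfolding W by simp
  next
    case True
    then have ne: "i \<noteq> j" "i \<notin> I34" "j \<notin> I12"
      by auto
    \<comment> \<open>The restricted matrix is unipotent, so only the middle indices k = i and k = j
      contribute.\<close>
    have summand: "sweedler2 (\<lambda>x y. ?T (?p (a_gl4 i k) * ?p x) (?s (?p (a_gl4 k j)) * ?s (?p y))) h =
        (if k = i then e * sweedler2 (\<lambda>x y. ?T (?p x) (var (t_var i j) * ?s (?p y))) h else 0)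
        + (if k = j then sweedler2 (\<lambda>x y. ?T (var (t_var i j) * ?p x) (?s (?p y))) h else 0)" for k
    proof -
      consider "k = i" | "k = j" | "k \<noteq> i" "k \<in> I12" | "k \<noteq> j" "k \<in> I34"
        using exhaust_4[of k] by auto
      then show ?thesis
      proof cases
        case 1
        have "?p (a_gl4 i i) = 1" "?p (a_gl4 i j) = var (t_var i j)"
          unfolding restrict_gens using True ne by (simp_all del: insert_iff)
        with 1 ne show ?thesis
          by (simp add: scale_vars_simps mult_scaleC_left cocycle_simps sweedler2_fun scaleC_complex_def)
      next
        case 2
        have "?p (a_gl4 j j) = 1" "?p (a_gl4 i j) = var (t_var i j)"
          unfolding restrict_gens using True ne by (simp_all del: insert_iff)
        with 2 ne show ?thesis
          by (simp add: scale_vars_simps)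
      next
        case 3
        then have "k \<noteq> j"
          using ne by auto
        have "?p (a_gl4 i k) = 0"
          unfolding restrict_gens using 3 index_disjoint(1)[OF 3(2)] by (simp del: insert_iff)
        with 3 \<open>k \<noteq> j\<close> show ?thesis
          by (simp add: cocycle_simps sweedler2_fun_zero del: insert_iff)
      next
        case 4
        then have "k \<noteq> i"
          using ne by auto
        have "?p (a_gl4 k j) = 0"
          unfolding restrict_gens using 4 index_disjoint(2)[OF 4(2)] by (simp del: insert_iff)
        with 4 \<open>k \<noteq> i\<close> show ?thesis
          by (simp add: cocycle_simps scale_vars_simps sweedler2_fun_zero del: insert_iff)
      qed
    qed
    have 1: "sweedler2 (\<lambda>x y. ?T (var (t_var i j) * ?p x) (?s (?p y))) h =
        (\<Sum>B\<in>I12. \<Sum>B'\<in>I34. \<i> / 2 * theta_ext t i B j B' * (e * gauss t e (row_deriv B B' h)))"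
    proof -
      have "sweedler2 (\<lambda>x y. ?T (var (t_var i j) * ?p x) (?s (?p y))) h =
          (\<Sum>B\<in>I12. \<Sum>B'\<in>I34. \<i> / 2 * t i B j B' * (e * sweedler2 (\<lambda>x y. ?T (?p x) (?s (partial_deriv (t_var B B') (?p y)))) h))"
        using True by (simp only: cocycle_var partial_deriv_scale_vars cocycle_simps
            sweedler2_fun_sum sweedler2_fun_mult_left scaleC_complex_def)
      also have "\<dots> = (\<Sum>B\<in>I12. \<Sum>B'\<in>I34. \<i> / 2 * theta_ext t i B j B' * (e * gauss t e (row_deriv B B' h)))"
        using True by (intro sum.cong refl)
          (simp only: theta_ext_def gauss_deriv(3)[symmetric] gauss_deriv(2) simp_thms if_True)
      finally show ?thesis .
    qed
    have 2: "sweedler2 (\<lambda>x y. ?T (?p x) (var (t_var i j) * ?s (?p y))) h =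
        (\<Sum>B\<in>I12. \<Sum>B'\<in>I34. \<i> / 2 * theta_ext t B i B' j * gauss t e (row_deriv B B' h))"
    proof -
      have "?T q (var (t_var i j) * r) = (\<Sum>B\<in>I12. \<Sum>B'\<in>I34. \<i> / 2 * t B i B' j * ?T (partial_deriv (t_var B B') q) r)" for q r
        using True cocycle_swap[of t _ r]
        by (simp only: cocycle_swap[of t q] cocycle_var)
      then have "sweedler2 (\<lambda>x y. ?T (?p x) (var (t_var i j) * ?s (?p y))) h =
          (\<Sum>B\<in>I12. \<Sum>B'\<in>I34. \<i> / 2 * t B i B' j * sweedler2 (\<lambda>x y. ?T (partial_deriv (t_var B B') (?p x)) (?s (?p y))) h)"
        by (simp only: sweedler2_fun_sum sweedler2_fun_mult_left)
      also have "\<dots> = (\<Sum>B\<in>I12. \<Sum>B'\<in>I34. \<i> / 2 * theta_ext t B i B' j * gauss t e (row_deriv B B' h))"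
        using True by (intro sum.cong refl) (simp only: theta_ext_def gauss_deriv(1) simp_thms if_True)
      finally show ?thesis .
    qed
    have "gauss t e (a_gl4 i j * h) =
        e * (\<Sum>B\<in>I12. \<Sum>B'\<in>I34. \<i> / 2 * theta_ext t B i B' j * gauss t e (row_deriv B B' h))
        + (\<Sum>B\<in>I12. \<Sum>B'\<in>I34. \<i> / 2 * theta_ext t i B j B' * (e * gauss t e (row_deriv B B' h)))"
      unfolding W summand sum.distrib 1 2 by (simp del: sum.insert)
    also have "\<dots> = e * (\<Sum>B\<in>I12. \<Sum>B'\<in>I34. gauss_coeff t i B j B' * gauss t e (row_deriv B B' h))"
      by (simp add: gauss_coeff_def sum_distrib_left sum.distrib algebra_simps del: sum.insert)
    finally show ?thesis
      using ne by simp
  qed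
qed

text \<open>Terms with one derivative have opposite coefficients e and -e and cancel, since a
  derivative may move between the legs; terms with two would need the middle index in both
  \<open>I12\<close> and \<open>I34\<close>.\<close>

lemma gauss_inverse: "sweedler2 (\<lambda>x y. gauss t e x * gauss t (- e) y) h = counit h"
proof (induction h rule: gl4_induct)
  case (entry i j h)
  let ?g = "gauss t e" and ?g' = "gauss t (- e)"
  have b: "cbilinear (\<lambda>x y. ?g x * ?g' y)"
    by (simp add: cbilinear_iff gauss_simps distrib_left distrib_right scaleC_simps)
  have swap: "sweedler2 (\<lambda>x y. ?g (row_deriv B B' x) * ?g' y) h = sweedler2 (\<lambda>x y. ?g x * ?g' (row_deriv B B' y)) h"
    if "B \<in> I12" "B' \<in> I34" for B B'
    using sweedler2_ract_lact[OF b clinear_ell, of B B' h]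
    by (simp only: row_deriv_def[symmetric] col_deriv_def[symmetric] gauss_deriv(3)[OF that])
  let ?P = "\<lambda>i j x. \<Sum>B\<in>I12. \<Sum>B'\<in>I34. gauss_coeff t i B j B' * ?g (row_deriv B B' x)"
  let ?Q = "\<lambda>i j y. \<Sum>B\<in>I12. \<Sum>B'\<in>I34. gauss_coeff t i B j B' * ?g' (row_deriv B B' y)"
  have PQ: "sweedler2 (\<lambda>x y. ?P i j x * ?g' y) h = sweedler2 (\<lambda>x y. ?g x * ?Q i j y) h"
  proof -
    have "sweedler2 (\<lambda>x y. ?P i j x * ?g' y) h =
      (\<Sum>B\<in>I12. \<Sum>B'\<in>I34. gauss_coeff t i B j B' * sweedler2 (\<lambda>x y. ?g (row_deriv B B' x) * ?g' y) h)"
      by (simp only: sum_distrib_right mult.assoc sweedler2_fun_sum sweedler2_fun_mult_left)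
    also have "\<dots> = (\<Sum>B\<in>I12. \<Sum>B'\<in>I34. gauss_coeff t i B j B' * sweedler2 (\<lambda>x y. ?g x * ?g' (row_deriv B B' y)) h)"
      by (intro sum.cong refl) (simp only: swap)
    also have "\<dots> = sweedler2 (\<lambda>x y. ?g x * ?Q i j y) h"
      by (simp only: sum_distrib_left mult.left_commute[of "?g _"] sweedler2_fun_sum sweedler2_fun_mult_left)
    finally show ?thesis .
  qed
  have "?g (a_gl4 i k * x) * ?g' (a_gl4 k j * y) =
      (if k = i then (if i = j then ?g x * ?g' y else 0) - e * (?g x * ?Q i j y) else 0)
      + (if k = j then e * (?P i j x * ?g' y) else 0)" for k x y
  proof -
    have z: "?P i k x * ?Q k j y = 0"
      using not_I12_or_not_I34[of k]
      by (elim disjE) (simp_all add: gauss_coeff_zero del: insert_iff)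
    have "?g (a_gl4 i k * x) * ?g' (a_gl4 k j * y) =
        (if i = k then ?g x else 0) * (if k = j then ?g' y else 0) - (if i = k then ?g x else 0) * (e * ?Q k j y)
        + e * ?P i k x * (if k = j then ?g' y else 0) - e * e * (?P i k x * ?Q k j y)"
      unfolding gauss_a_mult by (simp add: algebra_simps del: sum.insert)
    then show ?thesis
      unfolding z by (auto simp del: sum.insert)
  qed
  then have "sweedler2 (\<lambda>x y. ?g x * ?g' y) (a_gl4 i j * h) =
      sweedler2 (\<lambda>x y. (if i = j then ?g x * ?g' y else 0) - e * (?g x * ?Q i j y) + e * (?P i j x * ?g' y)) h"
    unfolding sweedler2_entry[OF b] sweedler2_fun_sum[symmetric] by (simp add: sum.distrib del: sum.insert)
  also have "\<dots> = (if i = j then counit h else 0)"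
    unfolding sweedler2_fun_add sweedler2_fun_diff sweedler2_fun_mult_left PQ
    using entry by (simp add: sweedler2_fun_zero)
  finally show ?case
    by simp
qed (simp_all add: sweedler2_one sweedler2_det_inv sweedler2_elem cbilinear_iff gauss_simps
    gauss_one gauss_det_inv distrib_left distrib_right scaleC_simps)

lemma U_eq_gauss: "U_gl4 t = gauss t (- 1)"
  by (simp add: U_gl4_def gauss_def F_gl4_def restrict_antipode)

lemma conv_inverse_U: "conv_inverse1 (U_gl4 t) = gauss t 1"
  unfolding conv_inverse1_def U_eq_gauss
proof (rule the_equality)
  show inv: "clinear (gauss t 1) \<and> (\<forall>h. sweedler2 (\<lambda>h1 h2. gauss t (- 1) h1 * gauss t 1 h2) h = counit h \<and>
      sweedler2 (\<lambda>h1 h2. gauss t 1 h1 * gauss t (- 1) h2) h = counit h)"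
    using gauss_inverse[of t 1] gauss_inverse[of t "- 1"] clinear_gauss by simp
  fix V assume "clinear V \<and> (\<forall>h. sweedler2 (\<lambda>h1 h2. gauss t (- 1) h1 * V h2) h = counit h \<and>
      sweedler2 (\<lambda>h1 h2. V h1 * gauss t (- 1) h2) h = counit h)"
  with inv show "V = gauss t 1"
    by (intro convolution_inverse_unique[of "gauss t (- 1)"]) (simp_all add: clinear_gauss scaleC_complex_def)
qed

text \<open>A Gaussian has no linear term. So U and its inverse reduce to the counit on matrix
  entries, and the antipode is undeformed there.\<close>

lemma gauss_a: "gauss t e (a_gl4 i j) = (if i = j then 1 else 0)"
proof -
  have "(\<Sum>B\<in>I12. \<Sum>B'\<in>I34. gauss_coeff t i B j B' * gauss t e (row_deriv B B' 1)) = 0"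
    by (intro sum.neutral ballI) (simp add: deriv_gens gauss_simps del: insert_iff)
  then show ?thesis
    using gauss_a_mult[of t e i j 1] by (simp only: gauss_one mult_1_right mult_zero_right add_0_right)
qed

lemma twisted_antipode_a: "twisted_antipode t (a_gl4 i j) = antipode (a_gl4 i j)"
proof -
  let ?f = "\<lambda>h1 h2 h3. (gauss t (- 1) h1 * gauss t 1 h3) *\<^sub>C antipode h2"
  have tri: "ctrilinear ?f"
    by (simp add: ctrilinear_def gauss_simps antipode_simps distrib_left distrib_right scaleC_simps
        scaleC_complex_def mult_ac)
  have "sweedler3 ?f (a_gl4 i j * 1) = (\<Sum>k\<in>UNIV. \<Sum>l\<in>UNIV. ?f (a_gl4 i k) (a_gl4 k l) (a_gl4 l j))"
    unfolding sweedler3_entry[OF tri]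
    by (subst sweedler3_grouplike[OF ctrilinear_mult[OF tri]])
      (simp_all add: algebra_homD(2)[OF algebra_hom_comult] tens_one)
  also have "\<dots> = (\<Sum>k\<in>UNIV. \<Sum>l\<in>UNIV. if l = j then if k = i then antipode (a_gl4 k l) else 0 else 0)"
    by (intro sum.cong refl) (simp add: gauss_a scaleC_one)
  also have "\<dots> = antipode (a_gl4 i j)"
    by simp
  finally show ?thesis
    by (simp add: twisted_antipode_def conv_inverse_U) (simp add: U_eq_gauss)
qed

section \<open>Free algebras\<close>

definition wmono :: "'x list \<Rightarrow> 'x free_algebra"
  where "wmono w = Poly_Mapping.single (Word w) 1"

lemma wmono_mult: "wmono u * wmono v = wmono (u @ v)"
  by (simp add: wmono_def mult_single plus_word_def)

lemma wmono_Nil: "wmono [] = 1"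
  by (simp add: wmono_def zero_word_def flip: single_one)

lemma letter_eq_wmono: "letter x = wmono [x]"
  by (simp add: letter_def wmono_def)

lemma wmono_Cons: "wmono (x # w) = letter x * wmono w"
  by (simp add: letter_eq_wmono wmono_mult)

definition wspan :: "'x list set \<Rightarrow> 'x free_algebra set"
  where "wspan S = {p. \<forall>w\<in>Poly_Mapping.keys p. letters w \<in> S}"

lemma single_eq_wmono: "Poly_Mapping.single w c = c *\<^sub>C wmono (letters w)"
  by (simp add: wmono_def scaleC_poly_mapping_def scaleC_complex_def mult_single)

lemma lookup_scaleC: "Poly_Mapping.lookup (c *\<^sub>C p) w = c * Poly_Mapping.lookup p w"
  for p :: "'m::monoid_add \<Rightarrow>\<^sub>0 complex"
  by (induction p rule: poly_mapping_single_induct)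
    (simp_all add: scaleC_poly_mapping_def scaleC_complex_def mult_single lookup_single when_def
      scaleC_add_right distrib_left lookup_add)

lemma wspan_zero: "0 \<in> wspan S"
  and wspan_add: "p \<in> wspan S \<Longrightarrow> q \<in> wspan S \<Longrightarrow> p + q \<in> wspan S"
  and wspan_scaleC: "p \<in> wspan S \<Longrightarrow> c *\<^sub>C p \<in> wspan S"
  and wspan_wmono: "w \<in> S \<Longrightarrow> wmono w \<in> wspan S"
  and wspan_mono: "S \<subseteq> S' \<Longrightarrow> wspan S \<subseteq> wspan S'"
  using Poly_Mapping.keys_add[of p q]
  by (auto simp: wspan_def wmono_def in_keys_iff lookup_scaleC)

lemma wspan_uminus: "p \<in> wspan S \<Longrightarrow> - p \<in> wspan S"
  using wspan_scaleC[of p S "- 1"] by (simp add: scaleC_minus_one)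

lemma wspan_diff: "p \<in> wspan S \<Longrightarrow> q \<in> wspan S \<Longrightarrow> p - q \<in> wspan S"
  using wspan_add[OF _ wspan_uminus, of p S q] by simp

lemma wspan_sum: "(\<And>i. i \<in> A \<Longrightarrow> f i \<in> wspan S) \<Longrightarrow> sum f A \<in> wspan S"
  by (induction A rule: infinite_finite_induct) (simp_all add: wspan_zero wspan_add)

lemma wspan_induct [consumes 1, case_names word zero add scale]:
  assumes "p \<in> wspan S" and word: "\<And>w. w \<in> S \<Longrightarrow> P (wmono w)" and zero: "P 0"
    and add: "\<And>p q. P p \<Longrightarrow> P q \<Longrightarrow> P (p + q)" and scale: "\<And>c p. P p \<Longrightarrow> P (c *\<^sub>C p)"
  shows "P p"
  using assms(1)
\<comment> \<open>Adding keys one at a time rules out cancellation, so every word met in the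
  induction lies in S.\<close>
proof (induction p rule: update_induct)
  case (update f a b)
  have "Poly_Mapping.keys (Poly_Mapping.update a b f) = insert a (Poly_Mapping.keys f)"
    using update.hyps by (simp add: keys_update)
  with update have "P f" and a: "letters a \<in> S"
    by (auto simp: wspan_def)
  have "Poly_Mapping.update a b f = f + Poly_Mapping.single a b"
    using update.hyps(1)
    by (intro poly_mapping_eqI)
      (auto simp: lookup_update lookup_add lookup_single when_def in_keys_iff)
  then show ?case
    using add[OF \<open>P f\<close> scale[OF word[OF a]]] by (simp add: single_eq_wmono)
qed (rule zero)

lemma wspan_UNIV [simp]: "wspan UNIV = UNIV"
  by (simp add: wspan_def)

lemma free_algebra_induct [case_names word zero add scale]:
  assumes "\<And>w. P (wmono w)" "P 0" "\<And>p q. P p \<Longrightarrow> P q \<Longrightarrow> P (p + q)" "\<And>c p. P p \<Longrightarrow> P (c *\<^sub>C p)"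
  shows "P p"
  by (rule wspan_induct[of p UNIV]) (use assms in simp_all)

lemma wspan_mult:
  assumes "p \<in> wspan S" "q \<in> wspan S'" and sub: "\<And>u v. u \<in> S \<Longrightarrow> v \<in> S' \<Longrightarrow> u @ v \<in> S''"
  shows "p * q \<in> wspan S''"
  using assms(1)
proof (induction p rule: wspan_induct)
  case (word u)
  show ?case
    using assms(2) by (induction q rule: wspan_induct)
      (simp_all add: wmono_mult wspan_wmono sub word wspan_zero wspan_add wspan_scaleC distrib_left mult_scaleC_right)
qed (simp_all add: wspan_zero wspan_add wspan_scaleC distrib_right mult_scaleC_left)

lemma clinear_free_algebra_map: "clinear (free_algebra_map m f)"
  unfolding free_algebra_map_def by (rule clinear_linear_extension)

lemma free_algebra_map_wmono: "free_algebra_map m f (wmono w) = foldr (\<lambda>x h. m (f x) h) w 1"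
  by (simp add: free_algebra_map_def wmono_def scaleC_one)

text \<open>Words are evaluated by a right fold, so associativity is needed only when the left
  factor is the image of a letter.\<close>

lemma free_algebra_map_mult:
  fixes m :: "'h::complex_algebra \<Rightarrow> 'h \<Rightarrow> 'h"
  assumes m: "cbilinear m" and one: "\<And>g. m 1 g = g" and assoc: "\<And>x h g. m (m (f x) h) g = m (f x) (m h g)"
  shows "free_algebra_map m f (p * q) = m (free_algebra_map m f p) (free_algebra_map m f q)"
proof -
  note lin = clinear_simps[OF clinear_free_algebra_map[of m f]]
    clinear_simps[OF cbilinearD(1)[OF m]] clinear_simps[OF cbilinearD(2)[OF m]]
  have word: "free_algebra_map m f (wmono w * q) = m (free_algebra_map m f (wmono w)) (free_algebra_map m f q)" for w
  proof (induction q rule: free_algebra_induct)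
    case (word v)
    show ?case
      by (induction w) (simp_all add: wmono_mult free_algebra_map_wmono one assoc)
  qed (simp_all add: distrib_left mult_scaleC_right lin)
  show ?thesis
    by (induction p rule: free_algebra_induct) (simp_all add: word distrib_right mult_scaleC_left lin)
qed

lemma gen_ideal_left: "x \<in> gen_ideal S \<Longrightarrow> p * x \<in> gen_ideal S"
  using gen_ideal.mult[of x S p 1] by simp

lemma gen_ideal_right: "x \<in> gen_ideal S \<Longrightarrow> x * p \<in> gen_ideal S"
  using gen_ideal.mult[of x S 1 p] by simp

lemma gen_ideal_mono: "S \<subseteq> S' \<Longrightarrow> gen_ideal S \<subseteq> gen_ideal S'"
proof
  fix x assume "S \<subseteq> S'" "x \<in> gen_ideal S"
  from this(2,1) show "x \<in> gen_ideal S'"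
    by (induction rule: gen_ideal.induct) (auto intro: gen_ideal.intros)
qed

lemma gen_ideal_scaleC: "x \<in> gen_ideal S \<Longrightarrow> c *\<^sub>C x \<in> gen_ideal S" for x :: "'a::complex_algebra"
  using gen_ideal_left[of x S "c *\<^sub>C 1"] by (simp add: mult_scaleC_left)

section \<open>The weight filtration\<close>

text \<open>The number of substitutions still possible on an entry: one if its row can be replaced,
  one if its column can.\<close>

fun wt :: "gl4_gen \<Rightarrow> nat"
  where "wt (Entry i j) = of_bool (i \<in> I12) + of_bool (j \<in> I34)"
  | "wt Det_Inv = 0"

definition weight :: "gl4_gen list \<Rightarrow> nat"
  where "weight w = sum_list (map wt w)"

lemma weight_simps [simp]: "weight [] = 0" "weight (x # w) = wt x + weight w" "weight (u @ v) = weight u + weight v"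
  by (simp_all add: weight_def)

definition entry_words :: "gl4_gen list set"
  where "entry_words = {w. Det_Inv \<notin> set w}"

text \<open>The strict bound makes level 0 trivial, which starts the inductions on weight.\<close>

definition low_words :: "nat \<Rightarrow> gl4_gen list set"
  where "low_words n = {w \<in> entry_words. weight w < n}"

lemma entry_words_simps [simp]:
  "[] \<in> entry_words" "x # w \<in> entry_words \<longleftrightarrow> x \<noteq> Det_Inv \<and> w \<in> entry_words"
  "u @ v \<in> entry_words \<longleftrightarrow> u \<in> entry_words \<and> v \<in> entry_words"
  by (auto simp: entry_words_def)

lemma wspan_low_mono: "m \<le> n \<Longrightarrow> wspan (low_words m) \<subseteq> wspan (low_words n)"
  by (rule wspan_mono) (auto simp: low_words_def)

lemma wspan_low_entry: "wspan (low_words n) \<subseteq> wspan entry_words"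
  by (rule wspan_mono) (auto simp: low_words_def)

lemma wspan_entry_low:
  assumes "p \<in> wspan entry_words"
  obtains n where "p \<in> wspan (low_words n)"
proof -
  have "\<exists>n. p \<in> wspan (low_words n)"
    using assms
  proof (induction p rule: wspan_induct)
    case (word w)
    then have "wmono w \<in> wspan (low_words (Suc (weight w)))"
      by (intro wspan_wmono) (simp add: low_words_def)
    then show ?case ..
  next
    case (add p q)
    then obtain m n where "p \<in> wspan (low_words m)" "q \<in> wspan (low_words n)"
      by blast
    then have "p \<in> wspan (low_words (max m n))" "q \<in> wspan (low_words (max m n))"
      using wspan_low_mono max.cobounded1 max.cobounded2 by blast+
    then show ?case
      using wspan_add by blast
  qed (use wspan_zero wspan_scaleC in blast)+
  with that show ?thesis
    by blast
qed

lemma wspan_low_zero: "p \<in> wspan (low_words 0) \<Longrightarrow> p = 0"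
  by (simp add: wspan_def low_words_def)

section \<open>The filtration of the commutative algebra by weight\<close>

definition comm_map :: "gl4_gen free_algebra \<Rightarrow> gl4"
  where "comm_map = free_algebra_map (*) gl4_gen_elem"

lemmas comm_map_simps = clinear_simps[OF clinear_free_algebra_map[of "(*)" gl4_gen_elem], folded comm_map_def]

lemma cbilinear_mult: "cbilinear ((*) :: 'a::complex_algebra \<Rightarrow> 'a \<Rightarrow> 'a)"
  by (simp add: cbilinear_iff distrib_left distrib_right scaleC_simps)

lemma comm_map_mult: "comm_map (p * q) = comm_map p * comm_map q"
  unfolding comm_map_def by (rule free_algebra_map_mult[OF cbilinear_mult]) (simp_all add: mult.assoc)

lemma comm_map_letter: "comm_map (letter x) = gl4_gen_elem x"
  by (simp add: comm_map_def letter_eq_wmono free_algebra_map_wmono)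

lemma comm_map_one: "comm_map 1 = 1"
  by (simp add: comm_map_def free_algebra_map_wmono flip: wmono_Nil)

lemma comm_map_wmono_Cons: "comm_map (wmono (x # w)) = gl4_gen_elem x * comm_map (wmono w)"
  by (simp add: wmono_Cons comm_map_mult comm_map_letter)

definition low :: "nat \<Rightarrow> gl4 set"
  where "low n = comm_map ` wspan (low_words n)"

lemma low_zero: "0 \<in> low n"
  and low_add: "g \<in> low n \<Longrightarrow> h \<in> low n \<Longrightarrow> g + h \<in> low n"
  and low_diff: "g \<in> low n \<Longrightarrow> h \<in> low n \<Longrightarrow> g - h \<in> low n"
  and low_scaleC: "g \<in> low n \<Longrightarrow> c *\<^sub>C g \<in> low n"
proof -
  note s = comm_map_simps[symmetric]
  show "0 \<in> low n"
    unfolding low_def using imageI[OF wspan_zero, of comm_map] by (simp add: comm_map_simps)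
  assume "g \<in> low n"
  then obtain p where p: "p \<in> wspan (low_words n)" "g = comm_map p"
    by (auto simp: low_def)
  then show "c *\<^sub>C g \<in> low n"
    by (auto simp: low_def s intro!: imageI wspan_scaleC)
  assume "h \<in> low n"
  then obtain q where q: "q \<in> wspan (low_words n)" "h = comm_map q"
    by (auto simp: low_def)
  with p show "g + h \<in> low n" "g - h \<in> low n"
    by (auto simp: low_def s intro!: imageI wspan_add wspan_diff)
qed

lemma low_sum: "(\<And>i. i \<in> A \<Longrightarrow> f i \<in> low n) \<Longrightarrow> sum f A \<in> low n"
  by (induction A rule: infinite_finite_induct) (simp_all add: low_zero low_add)

lemma low_mono: "g \<in> low m \<Longrightarrow> m \<le> n \<Longrightarrow> g \<in> low n"
  unfolding low_def using wspan_low_mono by blast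

lemma low_word: "w \<in> low_words n \<Longrightarrow> comm_map (wmono w) \<in> low n"
  by (simp add: low_def wspan_wmono)

lemma low_a_mult:
  assumes "g \<in> low n"
  shows "a_gl4 i j * g \<in> low (wt (Entry i j) + n)"
proof -
  obtain p where p: "p \<in> wspan (low_words n)" "g = comm_map p"
    using assms by (auto simp: low_def)
  have "letter (Entry i j) * p \<in> wspan (low_words (wt (Entry i j) + n))"
    by (rule wspan_mult[OF wspan_wmono[of "[Entry i j]" "{[Entry i j]}", folded letter_eq_wmono] p(1)])
      (auto simp: low_words_def)
  then have "comm_map (letter (Entry i j) * p) \<in> low (wt (Entry i j) + n)"
    unfolding low_def by (rule imageI)
  then show ?thesis
    by (simp add: comm_map_mult comm_map_letter p(2))
qed

lemma low_induct [consumes 1, case_names word zero add scale]: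
  assumes "g \<in> low n" "\<And>w. w \<in> low_words n \<Longrightarrow> P (comm_map (wmono w))" "P 0"
    "\<And>g h. P g \<Longrightarrow> P h \<Longrightarrow> P (g + h)" "\<And>c g. P g \<Longrightarrow> P (c *\<^sub>C g)"
  shows "P g"
proof -
  obtain p where p: "p \<in> wspan (low_words n)" "g = comm_map p"
    using assms(1) by (auto simp: low_def)
  from p(1) have "P (comm_map p)"
    by (induction p rule: wspan_induct) (simp_all add: comm_map_simps assms)
  with p show ?thesis by simp
qed

lemma deriv_low_word:
  assumes "A \<in> I12" "A' \<in> I34" "w \<in> entry_words"
  shows "row_deriv A A' (comm_map (wmono w)) \<in> low (weight w)"
    "col_deriv A A' (comm_map (wmono w)) \<in> low (weight w)"
  using assms(3)
proof (induction w)
  case (Cons x w)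
  { case 1
    then obtain i j where x: "x = Entry i j" and w: "w \<in> entry_words"
      by (cases x) auto
    have "a_gl4 i j * row_deriv A A' (comm_map (wmono w)) \<in> low (weight (x # w))"
      using low_a_mult[OF Cons.IH(1)[OF w], of i j] by (simp add: x)
    moreover have "comm_map (wmono (Entry A' j # w)) \<in> low (weight (x # w))" if "i = A"
      using assms(1) index_disjoint(2)[OF assms(2)] w
      by (intro low_word) (simp add: x low_words_def that del: insert_iff)
    ultimately show ?case
      by (auto simp: x comm_map_wmono_Cons deriv_gens[OF assms(1,2)] intro: low_add)
  next
    case 2
    then obtain i j where x: "x = Entry i j" and w: "w \<in> entry_words"
      by (cases x) auto
    have "a_gl4 i j * col_deriv A A' (comm_map (wmono w)) \<in> low (weight (x # w))"
      using low_a_mult[OF Cons.IH(2)[OF w], of i j] by (simp add: x)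
    moreover have "comm_map (wmono (Entry i A # w)) \<in> low (weight (x # w))" if "j = A'"
      using assms(2) index_disjoint(1)[OF assms(1)] w
      by (intro low_word) (simp add: x low_words_def that del: insert_iff)
    ultimately show ?case
      by (auto simp: x comm_map_wmono_Cons deriv_gens[OF assms(1,2)] intro: low_add) }
qed (simp_all add: wmono_Nil comm_map_one deriv_gens[OF assms(1,2)] low_zero)

lemma deriv_low:
  assumes "A \<in> I12" "A' \<in> I34" "g \<in> low n"
  shows "row_deriv A A' g \<in> low (n - 1)" "col_deriv A A' g \<in> low (n - 1)"
  using assms(3)
  by (induction g rule: low_induct, simp_all add: deriv_simps low_zero low_add low_scaleC)
    (rule low_mono[OF deriv_low_word(1)[OF assms(1,2)]] low_mono[OF deriv_low_word(2)[OF assms(1,2)]];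
      auto simp: low_words_def)+

lemma shift_low:
  assumes "g \<in> low n"
  shows "row_shift t i j g \<in> low (n - 1)" "col_shift t i j g \<in> low (n - 1)"
  unfolding row_shift_def col_shift_def by (intro low_sum low_scaleC deriv_low assms; assumption)+

text \<open>In each correction term the prefactor keeps its indices or has them replaced, so its
  weight does not grow, while g is differentiated at least once. For n = 0 the truncated subtraction
  is harmless as g = 0.\<close>

lemma twisted_mult_a_low:
  assumes g: "g \<in> low n"
  shows "a_gl4 i j \<bullet>\<^bsub>t\<^esub> g - a_gl4 i j * g \<in> low (wt (Entry i j) + (n - 1))"
proof -
  have 1: "a_gl4 k l * h \<in> low (wt (Entry i j) + (n - 1))"
    if "k \<in> I34 \<or> k = i" "l \<in> I12 \<or> l = j" "h \<in> low (n - 1)" for k l h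
  proof -
    have "wt (Entry k l) \<le> wt (Entry i j)"
      using that(1,2) index_disjoint[of k] index_disjoint[of l] by (auto simp del: insert_iff)
    then show ?thesis
      by (intro low_mono[OF low_a_mult[OF that(3)]]) simp
  qed
  have h: "row_shift t i' j' (col_shift t k' l' g) \<in> low (n - 1)" for i' j' k' l'
    by (rule low_mono[OF shift_low(1)[OF shift_low(2)[OF g]]]) simp
  have "a_gl4 i j \<bullet>\<^bsub>t\<^esub> g - a_gl4 i j * g = (\<Sum>k\<in>I34. a_gl4 k j * row_shift t i k g)
    - (\<Sum>l\<in>I12. a_gl4 i l * col_shift t l j g)
    - (\<Sum>k\<in>I34. \<Sum>l\<in>I12. a_gl4 k l * row_shift t i k (col_shift t l j g))"
    unfolding twisted_mult_a_expand by simp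
  also have "\<dots> \<in> low (wt (Entry i j) + (n - 1))"
    by (intro low_diff low_sum 1 shift_low[OF g] h) (simp_all del: insert_iff)
  finally show ?thesis .
qed

section \<open>Leading terms of twisted products\<close>

definition quantum_map :: "theta_parameter \<Rightarrow> gl4_gen free_algebra \<Rightarrow> gl4"
  where "quantum_map t = free_algebra_map (\<lambda>h g. h \<bullet>\<^bsub>t\<^esub> g) gl4_gen_elem"

lemmas quantum_map_simps = clinear_simps[OF clinear_free_algebra_map[of "\<lambda>h g. h \<bullet>\<^bsub>t\<^esub> g" gl4_gen_elem for t],
  folded quantum_map_def]

lemma det_inv_twisted_mult: "det_inv \<bullet>\<^bsub>t\<^esub> g = det_inv * g"
  by (rule twisted_mult_grouplike(1)) (simp_all add: comult_gens restrict_gens)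

lemma quantum_map_mult: "quantum_map t (p * q) = quantum_map t p \<bullet>\<^bsub>t\<^esub> quantum_map t q"
  unfolding quantum_map_def
proof (rule free_algebra_map_mult[OF cbilinear_twisted_mult])
  fix x h g
  show "(gl4_gen_elem x \<bullet>\<^bsub>t\<^esub> h) \<bullet>\<^bsub>t\<^esub> g = gl4_gen_elem x \<bullet>\<^bsub>t\<^esub> (h \<bullet>\<^bsub>t\<^esub> g)"
    by (cases x) (simp_all add: twisted_mult_a_assoc det_inv_twisted_mult twisted_mult_det_inv)
qed simp

lemma quantum_map_letter: "quantum_map t (letter x) = gl4_gen_elem x"
  by (simp add: quantum_map_def letter_eq_wmono free_algebra_map_wmono)

lemma quantum_map_one: "quantum_map t 1 = 1"
  by (simp add: quantum_map_def free_algebra_map_wmono flip: wmono_Nil)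

lemma quantum_map_wmono_Cons:
  "quantum_map t (wmono (x # w)) = gl4_gen_elem x \<bullet>\<^bsub>t\<^esub> quantum_map t (wmono w)"
  by (simp add: wmono_Cons quantum_map_mult quantum_map_letter)

text \<open>The twisted product of a word has the commutative product as leading term: the error of
  the tail and the error of multiplying by the first letter both have smaller weight.\<close>

lemma quantum_map_word_low:
  assumes "w \<in> entry_words"
  shows "quantum_map t (wmono w) - comm_map (wmono w) \<in> low (weight w)"
  using assms
proof (induction w)
  case (Cons x w)
  then obtain i j where x: "x = Entry i j" and w: "w \<in> entry_words"
    by (cases x) auto
  let ?q = "quantum_map t (wmono w)" and ?c = "comm_map (wmono w)"
  have e: "?q - ?c \<in> low (weight w)"
    by (rule Cons.IH[OF w])
  have "?c \<in> low (Suc (weight w))"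
    using w by (intro low_word) (simp add: low_words_def)
  from twisted_mult_a_low[OF this, of i j t] have 1: "a_gl4 i j \<bullet>\<^bsub>t\<^esub> ?c - a_gl4 i j * ?c \<in> low (weight (x # w))"
    by (simp add: x)
  have 2: "a_gl4 i j * (?q - ?c) \<in> low (weight (x # w))"
    using low_a_mult[OF e, of i j] by (simp add: x)
  have 3: "a_gl4 i j \<bullet>\<^bsub>t\<^esub> (?q - ?c) - a_gl4 i j * (?q - ?c) \<in> low (weight (x # w))"
    by (rule low_mono[OF twisted_mult_a_low[OF e, of i j t]]) (simp add: x)
  have "quantum_map t (wmono (x # w)) - comm_map (wmono (x # w)) =
      (a_gl4 i j \<bullet>\<^bsub>t\<^esub> ?c - a_gl4 i j * ?c) + a_gl4 i j * (?q - ?c)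
      + (a_gl4 i j \<bullet>\<^bsub>t\<^esub> (?q - ?c) - a_gl4 i j * (?q - ?c))"
    by (simp add: quantum_map_wmono_Cons comm_map_wmono_Cons x twisted_simps algebra_simps)
  with low_add[OF low_add[OF 1 2] 3] show ?case
    by simp
qed (simp add: wmono_Nil quantum_map_one comm_map_one low_zero)

lemma quantum_map_low:
  assumes "p \<in> wspan (low_words (Suc n))"
  shows "quantum_map t p - comm_map p \<in> low n"
  using assms
proof (induction p rule: wspan_induct)
  case (word w)
  then show ?case
    by (intro low_mono[OF quantum_map_word_low]) (auto simp: low_words_def)
next
  case (add p q)
  then show ?case
    using low_add[OF add] by (simp add: quantum_map_simps comm_map_simps algebra_simps)
next
  case (scale c p)
  then show ?case
    using low_scaleC[OF scale, of c] by (simp add: quantum_map_simps comm_map_simps scaleC_simps)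
qed (simp add: quantum_map_simps comm_map_simps low_zero)

text \<open>The leading term is realised by the same words, and the remainder has lower
  weight.\<close>

lemma low_subset_range: "low n \<subseteq> quantum_map t ` wspan entry_words"
proof (induction n)
  case 0
  have "low 0 \<subseteq> {0}"
    by (auto simp: low_def comm_map_simps(3) dest!: wspan_low_zero)
  moreover have "0 \<in> quantum_map t ` wspan entry_words"
    by (rule image_eqI[OF _ wspan_zero]) (simp add: quantum_map_simps)
  ultimately show ?case
    by blast
next
  case (Suc n)
  show ?case
  proof
    fix g assume "g \<in> low (Suc n)"
    then obtain p where p: "p \<in> wspan (low_words (Suc n))" "g = comm_map p"
      by (auto simp: low_def)
    from quantum_map_low[OF p(1), of t] Suc obtain q where
      q: "q \<in> wspan entry_words" "quantum_map t p - comm_map p = quantum_map t q"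
      by blast
    then have "g = quantum_map t (p - q)"
      by (simp add: p(2) quantum_map_simps algebra_simps)
    moreover have "p - q \<in> wspan entry_words"
      using p(1) q(1) wspan_low_entry by (blast intro: wspan_diff)
    ultimately show "g \<in> quantum_map t ` wspan entry_words"
      by blast
  qed
qed

text \<open>The subalgebra of polynomial functions, before the determinant is inverted.\<close>

definition entry_algebra :: "gl4 set"
  where "entry_algebra = comm_map ` wspan entry_words"

lemma entry_algebra_range: "entry_algebra \<subseteq> quantum_map t ` wspan entry_words"
proof
  fix g assume "g \<in> entry_algebra"
  then obtain p where p: "p \<in> wspan entry_words" "g = comm_map p"
    by (auto simp: entry_algebra_def)
  from p(1) obtain n where "p \<in> wspan (low_words n)"
    by (rule wspan_entry_low)
  then have "g \<in> low n"
    by (simp add: low_def p(2))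
  then show "g \<in> quantum_map t ` wspan entry_words"
    using low_subset_range by blast
qed

lemma entry_algebra_one: "1 \<in> entry_algebra"
  and entry_algebra_a: "a_gl4 i j \<in> entry_algebra"
  and entry_algebra_add: "g \<in> entry_algebra \<Longrightarrow> h \<in> entry_algebra \<Longrightarrow> g + h \<in> entry_algebra"
  and entry_algebra_scaleC: "g \<in> entry_algebra \<Longrightarrow> c *\<^sub>C g \<in> entry_algebra"
  and entry_algebra_mult: "g \<in> entry_algebra \<Longrightarrow> h \<in> entry_algebra \<Longrightarrow> g * h \<in> entry_algebra"
proof -
  have "wmono [] \<in> wspan entry_words" "letter (Entry i j) \<in> wspan entry_words"
    by (simp_all add: letter_eq_wmono wspan_wmono)
  from this[THEN imageI, of comm_map] show "1 \<in> entry_algebra" "a_gl4 i j \<in> entry_algebra"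
    by (simp_all add: entry_algebra_def wmono_Nil comm_map_one comm_map_letter)
  assume "g \<in> entry_algebra"
  then obtain p where p: "p \<in> wspan entry_words" "g = comm_map p"
    by (auto simp: entry_algebra_def)
  then show "c *\<^sub>C g \<in> entry_algebra"
    by (auto simp: entry_algebra_def comm_map_simps[symmetric] intro!: imageI wspan_scaleC)
  assume "h \<in> entry_algebra"
  then obtain q where q: "q \<in> wspan entry_words" "h = comm_map q"
    by (auto simp: entry_algebra_def)
  have "p * q \<in> wspan entry_words"
    by (rule wspan_mult[OF p(1) q(1)]) simp
  with p q show "g * h \<in> entry_algebra" "g + h \<in> entry_algebra"
    by (auto simp: entry_algebra_def comm_map_simps[symmetric] comm_map_mult[symmetric]
        intro!: imageI wspan_add)
qed

lemma entry_algebra_det: "det a_matrix \<in> entry_algebra"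
proof -
  have sum: "(\<And>i. i \<in> A \<Longrightarrow> f i \<in> entry_algebra) \<Longrightarrow> sum f A \<in> entry_algebra" for f :: "(4 \<Rightarrow> 4) \<Rightarrow> gl4" and A
    using entry_algebra_scaleC[OF entry_algebra_one, of 0]
    by (induction A rule: infinite_finite_induct) (simp_all add: entry_algebra_add)
  have prod: "(\<Prod>i\<in>A. a_gl4 i (f i)) \<in> entry_algebra" for f A
    by (induction A rule: infinite_finite_induct)
      (simp_all add: entry_algebra_one entry_algebra_mult entry_algebra_a)
  have "of_int (sign f) * g \<in> entry_algebra" if "g \<in> entry_algebra" for f :: "4 \<Rightarrow> 4" and g
    using that entry_algebra_scaleC[OF that, of "- 1"] by (auto simp: sign_def scaleC_minus_one)
  then show ?thesis
    unfolding det_def a_matrix_def by (auto intro!: sum prod)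
qed

text \<open>Clearing denominators, with a common power of the determinant for sums.\<close>

lemma exists_det_power_mult: "\<exists>k. det a_matrix ^ k * g \<in> entry_algebra"
proof (induction g rule: gl4_induct)
  case one
  then show ?case
    using entry_algebra_one by (intro exI[of _ 0]) simp
next
  case (entry i j h)
  then show ?case
    using entry_algebra_mult[OF entry_algebra_a[of i j]] by (metis mult.left_commute)
next
  case (det_inv h)
  then obtain k where "det a_matrix ^ k * h \<in> entry_algebra"
    by blast
  moreover have "det a_matrix ^ Suc k * (det_inv * h) = (det_inv * det a_matrix) * (det a_matrix ^ k * h)"
    by (simp only: power_Suc mult_ac)
  ultimately show ?case
    by (intro exI[of _ "Suc k"]) (simp only: det_inv_det mult_1_left)
next
  case (add g h)
  then obtain k l where k: "det a_matrix ^ k * g \<in> entry_algebra" and l: "det a_matrix ^ l * h \<in> entry_algebra"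
    by blast
  have p: "det a_matrix ^ n \<in> entry_algebra" for n
    by (induction n) (simp_all add: entry_algebra_one entry_algebra_mult entry_algebra_det)
  have "det a_matrix ^ l * (det a_matrix ^ k * g) + det a_matrix ^ k * (det a_matrix ^ l * h) \<in> entry_algebra"
    by (intro entry_algebra_add entry_algebra_mult p k l)
  then show ?case
    by (intro exI[of _ "k + l"]) (simp add: power_add algebra_simps)
next
  case (scale c h)
  then show ?case
    using entry_algebra_scaleC by (metis mult_scaleC_right)
qed

lemma surj_quantum_map: "surj (quantum_map t)"
proof -
  have "det a_matrix ^ k * g \<in> range (quantum_map t) \<Longrightarrow> g \<in> range (quantum_map t)" for k g
  proof (induction k arbitrary: g)
    case (Suc k)
    have "det a_matrix * g \<in> range (quantum_map t)"
      by (rule Suc.IH[of "det a_matrix * g", unfolded mult.assoc[symmetric] power_Suc2[symmetric], OF Suc.prems])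
    then obtain p where "det a_matrix * g = quantum_map t p"
      by blast
    \<comment> \<open>Division by the determinant stays in the range, as twisted multiplication by
      \<open>det_inv\<close> on the left is the ordinary one.\<close>
    then have "quantum_map t (letter Det_Inv * p) = det_inv * (det a_matrix * g)"
      by (simp add: quantum_map_mult quantum_map_letter det_inv_twisted_mult)
    also have "\<dots> = g"
      by (simp add: det_inv_det flip: mult.assoc)
    finally show ?case
      by (metis rangeI)
  qed simp
  moreover have "\<exists>k. det a_matrix ^ k * g \<in> range (quantum_map t)" for g
    using exists_det_power_mult[of g] entry_algebra_range[of t] by blast
  ultimately show ?thesis
    by (metis UNIV_eq_I)
qed

section \<open>Injectivity of the commutative coordinate map\<close>

text \<open>Polynomials in d with coefficients in the ring of matrix entries, so that
  \<open>poly_eval\<close> can land there and the degree in d is available.\<close>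

instantiation poly :: (comm_complex_algebra) comm_complex_algebra
begin

definition scaleC_poly :: "complex \<Rightarrow> 'a poly \<Rightarrow> 'a poly"
  where "scaleC_poly c p = smult (c *\<^sub>C 1) p"

instance
proof
  fix c d :: complex and x y :: "'a poly"
  have m: "(c *\<^sub>C 1) * (d *\<^sub>C (1::'a)) = (c * d) *\<^sub>C 1"
    by (simp add: scaleC_simps mult.commute)
  show "c *\<^sub>C (d *\<^sub>C x) = (c * d) *\<^sub>C x"
    by (simp add: scaleC_poly_def m)
qed (simp_all add: scaleC_poly_def smult_add_left smult_add_right scaleC_simps)

end

lemma inj_gl4_gen_nat: "\<exists>f :: gl4_gen \<Rightarrow> nat. inj f"
proof -
  have "x \<in> insert Det_Inv (range (\<lambda>(i, j). Entry i j))" for x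
    by (cases x) auto
  then have "(UNIV :: gl4_gen set) = insert Det_Inv (range (\<lambda>(i, j). Entry i j))"
    by blast
  then have "finite (UNIV :: gl4_gen set)"
    by (metis finite_insert finite_imageI finite)
  then show ?thesis
    by (metis finite_imp_inj_to_nat_seg)
qed

text \<open>The variables are numbered so that the polynomial ring is an integral domain by type class
  inference, which needs a linear order on the variables.\<close>

definition gen_index :: "gl4_gen \<Rightarrow> nat"
  where "gen_index = (SOME f. inj f)"

lemma inj_gen_index: "inj gen_index"
  unfolding gen_index_def using inj_gl4_gen_nat by (rule someI_ex)

definition symbol_map :: "gl4_gen free_algebra \<Rightarrow> nat cpoly"
  where "symbol_map = free_algebra_map (*) (\<lambda>x. var (gen_index x))"

lemmas symbol_map_simps = clinear_simps[OF clinear_free_algebra_map[of "(*)" "\<lambda>x. var (gen_index x)"],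
  folded symbol_map_def]

lemma symbol_map_wmono:
  "symbol_map (wmono w) = Poly_Mapping.single (\<Sum>x\<leftarrow>w. Poly_Mapping.single (gen_index x) 1) 1"
  by (induction w) (simp_all add: symbol_map_def free_algebra_map_wmono var_def mult_single flip: single_one)

text \<open>If p vanishes in the coordinate algebra, its polynomial is a multiple of d det a - 1.
  The former has degree 0 in d and the latter degree 1 over an integral domain, so the cofactor is
  0.\<close>

lemma symbol_map_inj:
  assumes p: "p \<in> wspan entry_words" and zero: "comm_map p = 0"
  shows "symbol_map p = 0"
proof -
  define c where "c = free_algebra_map (*) (var :: gl4_gen \<Rightarrow> gl4_gen cpoly)"
  let ?g = "\<lambda>x. case x of Entry i j \<Rightarrow> [:var (gen_index x):] | Det_Inv \<Rightarrow> [:0, 1 :: nat cpoly:]"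
  define ev where "ev = poly_eval ?g"
  note lin = clinear_simps[OF clinear_free_algebra_map[of "(*)" "var :: gl4_gen \<Rightarrow> gl4_gen cpoly"], folded c_def]
    poly_eval_add[of ?g, folded ev_def] poly_eval_mult[of ?g, folded ev_def]
    poly_eval_scaleC[of ?g, folded ev_def]
  have evv: "ev (var (Entry i j)) = [:var (gen_index (Entry i j)):]" "ev (var Det_Inv) = [:0, 1:]"
    "ev 1 = 1" "ev 0 = 0" for i j
    by (simp_all add: ev_def)
  have "comm_map q = abs_gl4 (c q)" for q
  proof (induction q rule: free_algebra_induct)
    case (word w)
    show ?case
      by (induction w) (simp_all add: comm_map_def c_def free_algebra_map_wmono
          algebra_homD[OF algebra_hom_abs_gl4] gl4_gen_elem.abs_eq)
  qed (simp_all add: comm_map_simps lin clinear_simps[OF algebra_homD(1)[OF algebra_hom_abs_gl4]])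
  with zero have "abs_gl4 (c p) = abs_gl4 0"
    by (simp add: zero_gl4_def)
  then have "det_relation dvd c p"
    by (simp add: gl4.abs_eq_iff)
  then obtain q where q: "c p = det_relation * q"
    by (rule dvdE)
  have evc: "ev (c p) = [:symbol_map p:]"
    using p
  proof (induction p rule: wspan_induct)
    case (word w)
    then show ?case
    proof (induction w)
      case Nil
      then show ?case
        by (simp add: c_def symbol_map_def free_algebra_map_wmono evv one_pCons)
    next
      case (Cons x w)
      then obtain i j where "x = Entry i j"
        by (cases x) auto
      with Cons show ?case
        by (simp add: c_def symbol_map_def free_algebra_map_wmono evv lin)
    qed
  qed (simp_all add: lin symbol_map_simps evv scaleC_poly_def mult_scaleC_left)
  define D where "D = det ((\<chi> i j. var (gen_index (Entry i j))) :: nat cpoly ^ 4 ^ 4)"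
  have const: "algebra_hom (\<lambda>x :: nat cpoly. [:x:])"
    by (simp add: algebra_hom_def clinear_iff scaleC_poly_def mult_scaleC_left one_pCons)
  have "ev (det generic_matrix) = det (\<chi> i j. [:var (gen_index (Entry i j)):])"
    by (simp add: ev_def poly_eval_det generic_matrix_def)
  also have "\<dots> = [:D:]"
    by (simp add: D_def algebra_hom_det[OF const])
  finally have rel: "ev det_relation = [:- 1, D:]"
    by (simp add: det_relation_def lin ev_def poly_eval_diff poly_eval_mult one_pCons)
  \<comment> \<open>Seen by evaluating at the identity matrix.\<close>
  have "D \<noteq> 0"
  proof
    assume "D = 0"
    define f where "f = (\<lambda>n. case inv gen_index n of Entry i j \<Rightarrow> if i = j then 1 else 0 | Det_Inv \<Rightarrow> (0 :: complex))"
    have "poly_eval f D = det (mat 1 :: complex ^ 4 ^ 4)"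
      by (simp add: D_def poly_eval_det f_def inv_f_f[OF inj_gen_index] mat_def)
    with \<open>D = 0\<close> show False
      by simp
  qed
  have "[:symbol_map p:] = [:- 1, D:] * ev q"
    using evc by (simp add: q lin rel)
  moreover have "degree ([:- 1, D:] * ev q) \<noteq> 0" if "ev q \<noteq> 0"
    using that \<open>D \<noteq> 0\<close> by (subst degree_mult_eq) auto
  ultimately have "ev q = 0"
    by (metis degree_pCons_0)
  with \<open>[:symbol_map p:] = [:- 1, D:] * ev q\<close> show ?thesis
    by simp
qed


section \<open>The relations\<close>

definition row_relator :: "theta_parameter \<Rightarrow> 4 \<Rightarrow> 4 \<Rightarrow> 4 \<Rightarrow> 4 \<Rightarrow> gl4_gen free_algebra"
  where "row_relator t i j k l =
    (\<Sum>c\<in>I34. \<Sum>d\<in>I34. (\<i> * theta_minus t i k c d) *\<^sub>C (a_free c j * a_free d l))"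

definition col_relator :: "theta_parameter \<Rightarrow> 4 \<Rightarrow> 4 \<Rightarrow> 4 \<Rightarrow> 4 \<Rightarrow> gl4_gen free_algebra"
  where "col_relator t i j k l =
    (\<Sum>c\<in>I12. \<Sum>d\<in>I12. (\<i> * theta_minus t c d j l) *\<^sub>C (a_free k d * a_free i c))"

text \<open>The ten families have only four shapes, matching the specialisations of
  \<open>twisted_comm_row_col\<close>.\<close>

lemma gl4_relations_cases:
  assumes "r \<in> gl4_relations t"
  obtains i j k l where
      "r = free_comm (a_free i j) (a_free k l) - row_relator t i j k l" "j \<in> I12 \<or> l \<in> I12"
    | i j k l where
      "r = free_comm (a_free i j) (a_free k l) + col_relator t i j k l" "i \<in> I34 \<or> k \<in> I34"
    | i j k l where
      "r = free_comm (a_free i j) (a_free k l) - row_relator t i j k l + col_relator t i j k l"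
    | i j k l where
      "r = free_comm (a_free i j) (a_free k l)" "i \<in> I34 \<or> k \<in> I34" "j \<in> I12 \<or> l \<in> I12"
  using assms unfolding gl4_relations_def row_relator_def[symmetric] col_relator_def[symmetric] Un_iff mem_Collect_eq
  by (elim disjE exE conjE) blast+

lemma gl4_relations_kernel:
  assumes "r \<in> gl4_relations t"
  shows "quantum_map t r = 0"
proof -
  have row: "quantum_map t (row_relator t i j k l) =
      (\<Sum>c\<in>I34. \<Sum>d\<in>I34. (\<i> * theta_minus t i k c d) *\<^sub>C (a_gl4 c j \<bullet>\<^bsub>t\<^esub> a_gl4 d l))"
    and col: "quantum_map t (col_relator t i j k l) =
      (\<Sum>c\<in>I12. \<Sum>d\<in>I12. (\<i> * theta_minus t c d j l) *\<^sub>C (a_gl4 k d \<bullet>\<^bsub>t\<^esub> a_gl4 i c))" for i j k l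
    unfolding row_relator_def col_relator_def
    by (simp_all only: quantum_map_simps quantum_map_mult quantum_map_letter)
  note simps = quantum_map_simps quantum_map_mult quantum_map_letter twisted_comm_def[symmetric]
  from assms show ?thesis
  proof (cases rule: gl4_relations_cases)
    case (1 i j k l)
    then show ?thesis
      unfolding 1(1) simps row by (simp only: twisted_comm_row diff_self)
  next
    case (2 i j k l)
    then show ?thesis
      unfolding 2(1) simps col by (simp only: twisted_comm_col left_minus)
  next
    case (3 i j k l)
    then show ?thesis
      unfolding 3(1) simps row col twisted_comm_row_col by simp
  next
    case (4 i j k l)
    then show ?thesis
      unfolding 4(1) simps by (simp only: twisted_comm_zero)
  qed
qed

lemma gen_ideal_kernel:
  assumes "\<And>r. r \<in> R \<Longrightarrow> quantum_map t r = 0" "x \<in> gen_ideal R"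
  shows "quantum_map t x = 0"
  using assms(2)
  by (induction rule: gen_ideal.induct) (simp_all add: quantum_map_simps quantum_map_mult twisted_simps assms(1))

text \<open>Elements that the relations rewrite to weight below n: the remainder terms of
  reordering.\<close>

definition low_mod :: "theta_parameter \<Rightarrow> nat \<Rightarrow> gl4_gen free_algebra set"
  where "low_mod t n = {p. \<exists>r\<in>wspan (low_words n). p - r \<in> gen_ideal (gl4_relations t)}"

lemma low_modI: "p - r \<in> gen_ideal (gl4_relations t) \<Longrightarrow> r \<in> wspan (low_words n) \<Longrightarrow> p \<in> low_mod t n"
  by (auto simp: low_mod_def)

lemma low_mod_zero: "0 \<in> low_mod t n"
  by (rule low_modI[of 0 0]) (simp_all add: gen_ideal.zero wspan_zero)

lemma low_mod_add:
  assumes "p \<in> low_mod t n" "q \<in> low_mod t n"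
  shows "p + q \<in> low_mod t n"
proof -
  obtain r s where "p - r \<in> gen_ideal (gl4_relations t)" "q - s \<in> gen_ideal (gl4_relations t)"
    "r \<in> wspan (low_words n)" "s \<in> wspan (low_words n)"
    using assms by (auto simp: low_mod_def)
  then show ?thesis
    by (intro low_modI[of _ "r + s"] gen_ideal_cong_add wspan_add)
qed

lemma low_mod_scaleC:
  assumes "p \<in> low_mod t n"
  shows "c *\<^sub>C p \<in> low_mod t n"
proof -
  obtain r where "p - r \<in> gen_ideal (gl4_relations t)" "r \<in> wspan (low_words n)"
    using assms by (auto simp: low_mod_def)
  then show ?thesis
    by (intro low_modI[of _ "c *\<^sub>C r"] wspan_scaleC) (simp_all add: gen_ideal_scaleC flip: scaleC_diff_right)
qed

lemma low_mod_uminus: "p \<in> low_mod t n \<Longrightarrow> - p \<in> low_mod t n"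
  using low_mod_scaleC[of p t n "- 1"] by (simp add: scaleC_minus_one)

lemma low_mod_mono: "p \<in> low_mod t m \<Longrightarrow> m \<le> n \<Longrightarrow> p \<in> low_mod t n"
  unfolding low_mod_def using wspan_low_mono by blast

lemma low_mod_mult:
  assumes p: "p \<in> low_mod t n" and uv: "u \<in> entry_words" "v \<in> entry_words"
  shows "wmono u * p * wmono v \<in> low_mod t (weight u + n + weight v)"
proof -
  obtain r where r: "p - r \<in> gen_ideal (gl4_relations t)" "r \<in> wspan (low_words n)"
    using p by (auto simp: low_mod_def)
  show ?thesis
  proof (rule low_modI)
    show "wmono u * p * wmono v - wmono u * r * wmono v \<in> gen_ideal (gl4_relations t)"
      using gen_ideal.mult[OF r(1), of "wmono u" "wmono v"] by (simp add: algebra_simps)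
    have "wmono u * r \<in> wspan (low_words (weight u + n))"
      by (rule wspan_mult[OF wspan_wmono[of u "{u}"] r(2)]) (use uv in \<open>auto simp: low_words_def\<close>)
    then show "wmono u * r * wmono v \<in> wspan (low_words (weight u + n + weight v))"
      by (rule wspan_mult[OF _ wspan_wmono[of v "{v}"]]) (use uv in \<open>auto simp: low_words_def\<close>)
  qed
qed

lemma relator_low:
  "i \<in> I12 \<Longrightarrow> row_relator t i j k l \<in> wspan (low_words (wt (Entry i j) + wt (Entry k l)))"
  "j \<in> I34 \<Longrightarrow> col_relator t i j k l \<in> wspan (low_words (wt (Entry i j) + wt (Entry k l)))"
  unfolding row_relator_def col_relator_def letter_eq_wmono wmono_mult
  by (intro wspan_sum wspan_scaleC wspan_wmono; simp add: low_words_def index_disjoint del: insert_iff)+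

text \<open>The right sides of the relations have smaller weight than the commutator. The relations
  list each pair of blocks in one order only, so the opposite order is reached through
  \<open>sym\<close>.\<close>

lemma free_comm_low_mod:
  "free_comm (a_free i j) (a_free k l) \<in> low_mod t (wt (Entry i j) + wt (Entry k l))"
proof -
  let ?n = "wt (Entry i j) + wt (Entry k l)"
  have sym: "free_comm (a_free i j) (a_free k l) \<in> low_mod t ?n"
    if "free_comm (a_free k l) (a_free i j) \<in> low_mod t (wt (Entry k l) + wt (Entry i j))"
    using low_mod_uminus[OF that] by (simp add: add.commute)
  note relI = low_modI[OF gen_ideal.gen]
  note rel_def = gl4_relations_def row_relator_def[symmetric] col_relator_def[symmetric]
  \<comment> \<open>Opaque names keep the index sets from being split into elements during the
    search for the matching family.\<close>
  define P Q :: "4 set" where "P = I12" and "Q = I34"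
  note PQ = P_def[symmetric] Q_def[symmetric]
  have row: "free_comm (a_free i j) (a_free k l) \<in> low_mod t (wt (Entry i j) + wt (Entry k l))"
    if "i \<in> I12" "j \<in> I12" "k \<in> I12" "l \<in> I12 \<or> l \<in> I34" for i j k l
  proof (rule relI[OF _ relator_low(1)[OF that(1), of t]])
    show "free_comm (a_free i j) (a_free k l) - row_relator t i j k l \<in> gl4_relations t"
      using that unfolding rel_def unfolding PQ Un_iff mem_Collect_eq by blast
  qed
  have col: "free_comm (a_free i j) (a_free k l) \<in> low_mod t (wt (Entry i j) + wt (Entry k l))"
    if "i \<in> I34" "j \<in> I34" "k \<in> I12 \<or> k \<in> I34" "l \<in> I34" for i j k l
  proof (rule relI[OF _ wspan_uminus[OF relator_low(2)[OF that(2), of t]]])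
    show "free_comm (a_free i j) (a_free k l) - - col_relator t i j k l \<in> gl4_relations t"
      using that unfolding rel_def diff_minus_eq_add unfolding PQ Un_iff mem_Collect_eq by blast
  qed
  have row_col: "free_comm (a_free i j) (a_free k l) \<in> low_mod t (wt (Entry i j) + wt (Entry k l))"
    if "i \<in> I12" "j \<in> I34" "k \<in> I12" "l \<in> I34" for i j k l
  proof (rule relI[OF _ wspan_diff[OF relator_low(1)[OF that(1), of t] relator_low(2)[OF that(2), of t]]])
    show "free_comm (a_free i j) (a_free k l) - (row_relator t i j k l - col_relator t i j k l) \<in> gl4_relations t"
      using that unfolding rel_def diff_diff_eq2 diff_add_eq unfolding PQ Un_iff mem_Collect_eq by blast
  qed
  have zero: "free_comm (a_free i j) (a_free k l) \<in> low_mod t (wt (Entry i j) + wt (Entry k l))"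
    if "k \<in> I34" "i \<in> I12 \<and> j \<in> I12 \<and> l \<in> I34 \<or> l \<in> I12" "i \<in> I12 \<or> i \<in> I34" "j \<in> I12 \<or> j \<in> I34" for i j k l
  proof (rule relI[OF _ wspan_zero])
    show "free_comm (a_free i j) (a_free k l) - 0 \<in> gl4_relations t"
      using that unfolding rel_def diff_zero unfolding PQ Un_iff mem_Collect_eq by metis
  qed
  have I: "p \<in> I12 \<or> p \<in> I34" for p :: 4
    using exhaust_4[of p] by auto
  show ?thesis
    using I[of i] I[of j] I[of k] I[of l] row[of i j k l] col[of i j k l] row_col[of i j k l] zero[of k i j l]
      row[of k l i j] col[of k l i j] zero[of i k l j] sym
    unfolding PQ by metis
qed

section \<open>Reordering words modulo lower weight\<close>

lemma move_low_mod:
  assumes "Entry i j # l @ r \<in> entry_words"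
  shows "wmono (Entry i j # l @ r) - wmono (l @ Entry i j # r) \<in> low_mod t (weight (Entry i j # l @ r))"
  using assms
proof (induction l)
  case (Cons y l)
  then obtain k s where y: "y = Entry k s"
    by (cases y) auto
  let ?x = "Entry i j"
  have "wmono [] * free_comm (letter ?x) (letter y) * wmono (l @ r) \<in> low_mod t (weight [] + (wt ?x + wt y) + weight (l @ r))"
    unfolding y using Cons.prems by (intro low_mod_mult free_comm_low_mod) simp_all
  moreover have "wmono [y] * (wmono (?x # l @ r) - wmono (l @ ?x # r)) * wmono [] \<in>
      low_mod t (weight [y] + weight (?x # l @ r) + weight [])"
    using Cons by (intro low_mod_mult Cons.IH) simp_all
  ultimately have "wmono [] * free_comm (letter ?x) (letter y) * wmono (l @ r)
      + wmono [y] * (wmono (?x # l @ r) - wmono (l @ ?x # r)) * wmono [] \<in> low_mod t (weight (?x # (y # l) @ r))"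
    by (intro low_mod_add) (simp_all add: add_ac)
  also have "wmono [] * free_comm (letter ?x) (letter y) * wmono (l @ r)
      + wmono [y] * (wmono (?x # l @ r) - wmono (l @ ?x # r)) * wmono [] =
      wmono (?x # (y # l) @ r) - wmono ((y # l) @ ?x # r)"
    by (simp add: letter_eq_wmono left_diff_distrib right_diff_distrib wmono_mult wmono_Nil)
  finally show ?case .
qed (simp add: low_mod_zero)

lemma permute_low_mod:
  assumes "w \<in> entry_words" "mset w = mset w'"
  shows "wmono w - wmono w' \<in> low_mod t (weight w)"
  using assms
proof (induction w arbitrary: w')
  case (Cons x u)
  then have "x \<in> set w'"
    by (metis list.set_intros(1) mset_eq_setD)
  then obtain l r where w': "w' = l @ x # r"
    by (meson split_list)
  obtain i j where x: "x = Entry i j"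
    using Cons.prems(1) by (cases x) auto
  have lr: "mset u = mset (l @ r)"
    using Cons.prems(2) by (simp add: w')
  have w: "weight u = weight (l @ r)"
    unfolding weight_def using lr by (metis mset_map sum_mset_sum_list)
  have e: "l @ r \<in> entry_words"
    using Cons.prems(1) mset_eq_setD[OF lr] by (auto simp: entry_words_def)
  have "wmono [x] * (wmono u - wmono (l @ r)) * wmono [] \<in> low_mod t (weight [x] + weight u + weight [])"
    using Cons.prems(1) by (intro low_mod_mult Cons.IH lr) simp_all
  moreover have "wmono (x # l @ r) - wmono (l @ x # r) \<in> low_mod t (weight (x # l @ r))"
    unfolding x by (rule move_low_mod) (use e in simp)
  ultimately have "wmono [x] * (wmono u - wmono (l @ r)) * wmono [] + (wmono (x # l @ r) - wmono (l @ x # r))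
      \<in> low_mod t (weight (x # u))"
    by (intro low_mod_add) (simp_all add: w)
  then show ?case
    by (simp add: w' left_diff_distrib right_diff_distrib wmono_mult wmono_Nil)
qed (simp add: low_mod_zero)

text \<open>Picks one ordering of the letters of each monomial as its normal form; any choice works
  because words are compared only up to permutation.\<close>

definition monomial_word :: "(nat \<Rightarrow>\<^sub>0 nat) \<Rightarrow> gl4_gen list"
  where "monomial_word m = (SOME w. (\<Sum>x\<leftarrow>w. Poly_Mapping.single (gen_index x) 1) = m)"

definition polynomial_lift :: "nat cpoly \<Rightarrow> gl4_gen free_algebra"
  where "polynomial_lift = linear_extension (\<lambda>m. wmono (monomial_word m))"

lemma mset_monomial_word: "mset (monomial_word (\<Sum>x\<leftarrow>w. Poly_Mapping.single (gen_index x) 1)) = mset w"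
proof -
  let ?m = "\<lambda>w. \<Sum>x\<leftarrow>w. Poly_Mapping.single (gen_index x) (1::nat)"
  have "?m (monomial_word (?m w)) = ?m w"
    unfolding monomial_word_def by (rule someI) (rule refl)
  moreover have "Poly_Mapping.lookup (?m w) (gen_index x) = count (mset w) x" for w x
    by (induction w) (auto simp: lookup_add lookup_single when_def inj_eq[OF inj_gen_index])
  ultimately show ?thesis
    by (metis multiset_eqI)
qed

text \<open>Each word is a permutation of its normal form, hence congruent to it up to lower weight.
  So an element with vanishing symbol is itself congruent to something of lower weight.\<close>

lemma polynomial_lift_low_mod:
  assumes "p \<in> wspan (low_words (Suc n))"
  shows "p - polynomial_lift (symbol_map p) \<in> low_mod t n"
  using assms
proof (induction p rule: wspan_induct)
  case (word w)
  let ?w = "monomial_word (\<Sum>x\<leftarrow>w. Poly_Mapping.single (gen_index x) 1)"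
  have "wmono w - wmono ?w \<in> low_mod t (weight w)"
    using word by (intro permute_low_mod mset_monomial_word[symmetric]) (simp add: low_words_def)
  then show ?case
    using word by (auto simp: symbol_map_wmono polynomial_lift_def scaleC_one low_words_def intro: low_mod_mono)
next
  case (add p q)
  then show ?case
    using low_mod_add[OF add] by (simp add: symbol_map_simps polynomial_lift_def linear_extension_add algebra_simps)
next
  case (scale c p)
  then show ?case
    using low_mod_scaleC[OF scale, of c]
    by (simp add: symbol_map_simps polynomial_lift_def linear_extension_scaleC scaleC_diff_right)
qed (simp add: symbol_map_simps polynomial_lift_def low_mod_zero)

text \<open>For p in the kernel the commutative image has lower weight, so some p' of lower weight
  makes the symbol of p + p' vanish. Then p + p' is congruent to some r of lower weight, and r - p'
  is in the kernel and falls under the induction hypothesis.\<close>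

lemma quantum_map_kernel_low:
  "p \<in> wspan (low_words n) \<Longrightarrow> quantum_map t p = 0 \<Longrightarrow> p \<in> gen_ideal (gl4_relations t)"
proof (induction n arbitrary: p)
  case 0
  then show ?case
    by (metis wspan_low_zero gen_ideal.zero)
next
  case (Suc n)
  from quantum_map_low[OF Suc.prems(1), of t] obtain p' where
    p': "p' \<in> wspan (low_words n)" "- comm_map p = comm_map p'"
    using Suc.prems(2) by (auto simp: low_def)
  have sum: "p + p' \<in> wspan (low_words (Suc n))"
    using p'(1) Suc.prems(1) wspan_low_mono[of n "Suc n"] by (auto intro: wspan_add)
  have "symbol_map (p + p') = 0"
    using sum wspan_low_entry p'(2)[symmetric] by (intro symbol_map_inj) (auto simp: comm_map_simps)
  then have "p + p' \<in> low_mod t n"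
    using polynomial_lift_low_mod[OF sum, of t] by (simp add: polynomial_lift_def)
  then obtain r where r: "r \<in> wspan (low_words n)" "p + p' - r \<in> gen_ideal (gl4_relations t)"
    by (auto simp: low_mod_def)
  have "quantum_map t (p + p' - r) = 0"
    using gl4_relations_kernel r(2) by (rule gen_ideal_kernel)
  then have "quantum_map t (r - p') = 0"
    using Suc.prems(2) by (simp add: quantum_map_simps)
  then have "r - p' \<in> gen_ideal (gl4_relations t)"
    using r(1) p'(1) by (intro Suc.IH wspan_diff)
  from gen_ideal.add[OF r(2) this] show ?case
    by simp
qed

lemma quantum_map_kernel:
  assumes "p \<in> wspan entry_words" "quantum_map t p = 0"
  shows "p \<in> gen_ideal (gl4_relations t)"
  using wspan_entry_low[OF assms(1)] quantum_map_kernel_low assms(2) by metis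

lemma det_twisted_mult: "det a_matrix \<bullet>\<^bsub>t\<^esub> g = det a_matrix * g" "g \<bullet>\<^bsub>t\<^esub> det a_matrix = det a_matrix * g"
  by (rule twisted_mult_grouplike[OF comult_det restrict_det])+

text \<open>A localisation argument: right multiplication by a power of D removes all letters
  \<open>Det_Inv\<close> modulo the ideal, the kernel among entry words is already known, and D is
  cancelled again because it has an inverse.\<close>

lemma gl4_presentation:
  assumes D: "D \<in> wspan entry_words" "quantum_map t D = det a_matrix"
  defines "R \<equiv> gl4_relations t \<union> {D * letter Det_Inv - 1, letter Det_Inv * D - 1}"
  shows "presented_by (\<lambda>h g. h \<bullet>\<^bsub>t\<^esub> g) gl4_gen_elem R"
proof -
  let ?d = "letter Det_Inv"
  have ker: "quantum_map t r = 0" if "r \<in> R" for r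
    using that gl4_relations_kernel[of r t] unfolding R_def
    by (auto simp: quantum_map_simps quantum_map_mult quantum_map_letter quantum_map_one D(2)
        det_twisted_mult det_inv_twisted_mult det_inv_det mult.commute[of _ det_inv])
  have low: "gen_ideal (gl4_relations t) \<subseteq> gen_ideal R"
    unfolding R_def by (rule gen_ideal_mono) blast
  have dD: "?d * D - 1 \<in> gen_ideal R" and Dd: "D * ?d - 1 \<in> gen_ideal R"
    unfolding R_def by (auto intro: gen_ideal.gen)
  have mult: "p * q \<in> wspan entry_words" if "p \<in> wspan entry_words" "q \<in> wspan entry_words" for p q
    using that by (rule wspan_mult) simp
  have pow: "D ^ n \<in> wspan entry_words" for n
    by (induction n) (simp_all add: mult D(1) wspan_wmono flip: wmono_Nil)
  have clear: "\<exists>K. \<exists>q\<in>wspan entry_words. p * D ^ K - q \<in> gen_ideal R" for p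
  proof (induction p rule: free_algebra_induct)
    case (word w)
    show ?case
    proof (induction w)
      case Nil
      show ?case
        by (intro exI[of _ 0] bexI[OF _ wspan_wmono[of "[]"]]) (simp_all add: wmono_Nil gen_ideal.zero)
    next
      case (Cons x w)
      then obtain K q where q: "q \<in> wspan entry_words" "wmono w * D ^ K - q \<in> gen_ideal R"
        by blast
      show ?case
      proof (cases x)
        case (Entry i j)
        have "letter x * (wmono w * D ^ K - q) \<in> gen_ideal R"
          using q(2) by (rule gen_ideal_left)
        moreover have "letter x * q \<in> wspan entry_words"
          by (rule mult[OF _ q(1)]) (simp add: letter_eq_wmono wspan_wmono Entry)
        ultimately show ?thesis
          by (auto simp: wmono_Cons right_diff_distrib mult.assoc)
      next
        case Det_Inv
        \<comment> \<open>Centrality of D modulo the relations need not be computed: the determinant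
          is central, so this entry polynomial is in the kernel.\<close>
        have "q * D - D * q \<in> gen_ideal (gl4_relations t)"
          by (rule quantum_map_kernel)
            (simp_all add: wspan_diff mult q(1) D quantum_map_simps quantum_map_mult det_twisted_mult)
        then have 1: "?d * (q * D - D * q) \<in> gen_ideal R"
          using low by (blast intro: gen_ideal_left)
        have 2: "?d * (wmono w * D ^ K - q) * D \<in> gen_ideal R"
          using q(2) by (rule gen_ideal.mult)
        have 3: "(?d * D - 1) * q \<in> gen_ideal R"
          using dD by (rule gen_ideal_right)
        have "wmono (x # w) * D ^ Suc K - q =
            ?d * (wmono w * D ^ K - q) * D + ?d * (q * D - D * q) + (?d * D - 1) * q"
          by (simp add: wmono_Cons Det_Inv algebra_simps power_Suc2 del: power_Suc)
        also have "\<dots> \<in> gen_ideal R"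
          by (intro gen_ideal.add 1 2 3)
        finally show ?thesis
          using q(1) by blast
      qed
    qed
  next
    case zero
    show ?case
      by (intro exI[of _ 0] bexI[of _ 0]) (simp_all add: gen_ideal.zero wspan_zero)
  next
    case (add p p')
    then obtain K q K' q' where q: "q \<in> wspan entry_words" "p * D ^ K - q \<in> gen_ideal R"
      and q': "q' \<in> wspan entry_words" "p' * D ^ K' - q' \<in> gen_ideal R"
      by blast
    have "(p * D ^ K - q) * D ^ K' + (p' * D ^ K' - q') * D ^ K \<in> gen_ideal R"
      by (intro gen_ideal.add gen_ideal_right q q')
    also have "(p * D ^ K - q) * D ^ K' + (p' * D ^ K' - q') * D ^ K =
        (p + p') * D ^ (K + K') - (q * D ^ K' + q' * D ^ K)"
      by (simp add: algebra_simps flip: power_add)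
    finally show ?case
      using wspan_add[OF mult[OF q(1) pow] mult[OF q'(1) pow]] by blast
  next
    case (scale c p)
    then obtain K q where "q \<in> wspan entry_words" "p * D ^ K - q \<in> gen_ideal R"
      by blast
    then have "c *\<^sub>C q \<in> wspan entry_words" "c *\<^sub>C (p * D ^ K - q) \<in> gen_ideal R"
      by (simp_all add: wspan_scaleC gen_ideal_scaleC)
    then show ?case
      by (auto simp: scaleC_diff_right mult_scaleC_left)
  qed
  have "p \<in> gen_ideal R" if "quantum_map t p = 0" for p
  proof -
    obtain K q where q: "q \<in> wspan entry_words" "p * D ^ K - q \<in> gen_ideal R"
      using clear by blast
    have "quantum_map t (p * D ^ K - q) = 0"
      using ker q(2) by (rule gen_ideal_kernel)
    then have "quantum_map t q = 0"
      by (simp add: quantum_map_simps quantum_map_mult that twisted_simps)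
    then have "q \<in> gen_ideal R"
      using quantum_map_kernel[OF q(1)] low by blast
    from gen_ideal.add[OF q(2) this] have "p * D ^ K \<in> gen_ideal R"
      by simp
    then show ?thesis
    proof (induction K)
      case (Suc K)
      have "p * D ^ Suc K * ?d - p * D ^ K * (D * ?d - 1) \<in> gen_ideal R"
        by (intro gen_ideal_diff gen_ideal_left[OF Dd] gen_ideal_right[OF Suc.prems])
      then have "p * D ^ K \<in> gen_ideal R"
        by (simp add: right_diff_distrib mult.assoc power_Suc2 del: power_Suc)
      then show ?case
        by (rule Suc.IH)
    qed simp
  qed
  moreover have "quantum_map t p = 0" if "p \<in> gen_ideal R" for p
    using ker that by (rule gen_ideal_kernel)
  ultimately have "{p. quantum_map t p = 0} = gen_ideal R"
    by blast
  then show ?thesis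
    using surj_quantum_map[of t] quantum_map_mult[of t]
    unfolding presented_by_def quantum_map_def by blast
qed

theorem theorem4p1:
  fixes \<theta> :: "4 \<Rightarrow> 4 \<Rightarrow> 4 \<Rightarrow> 4 \<Rightarrow> complex"
  shows "
    (\<forall>\<mu>\<in>I12. \<forall>\<nu>\<in>I34. \<forall>\<alpha>\<in>I12. \<forall>\<beta>\<in>I34.
        a_gl4 \<mu> \<nu> \<bullet>\<^bsub>\<theta>\<^esub> a_gl4 \<alpha> \<beta> =
        a_gl4 \<mu> \<nu> * a_gl4 \<alpha> \<beta>
        + (\<Sum>c\<in>I34. \<Sum>d\<in>I34. (\<i> / 2 * theta_ext \<theta> \<mu> \<alpha> c d) *\<^sub>C (a_gl4 c \<nu> * a_gl4 d \<beta>))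
        - (\<Sum>c\<in>I12. \<Sum>d\<in>I12. (\<i> / 2 * theta_ext \<theta> c d \<nu> \<beta>) *\<^sub>C (a_gl4 \<mu> c * a_gl4 \<alpha> d))
        + (\<Sum>a\<in>I34. \<Sum>b\<in>I34. \<Sum>c\<in>I12. \<Sum>d\<in>I12.
            (1/4 * theta_ext \<theta> \<mu> \<alpha> a b * theta_ext \<theta> c d \<nu> \<beta>) *\<^sub>C (a_gl4 a c * a_gl4 b d)))
    \<and> (\<forall>\<mu>\<in>I12. \<forall>\<nu>\<in>I12. \<forall>\<alpha>\<in>I12. \<forall>\<beta>\<in>I34.
        a_gl4 \<mu> \<nu> \<bullet>\<^bsub>\<theta>\<^esub> a_gl4 \<alpha> \<beta> =
        a_gl4 \<mu> \<nu> * a_gl4 \<alpha> \<beta>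
        + (\<Sum>c\<in>I34. \<Sum>d\<in>I34. (\<i> / 2 * theta_ext \<theta> \<mu> \<alpha> c d) *\<^sub>C (a_gl4 c \<nu> * a_gl4 d \<beta>)))
    \<and> (\<forall>\<mu>\<in>I12. \<forall>\<nu>\<in>I34. \<forall>\<alpha>\<in>I12. \<forall>\<beta>\<in>I12.
        a_gl4 \<mu> \<nu> \<bullet>\<^bsub>\<theta>\<^esub> a_gl4 \<alpha> \<beta> =
        a_gl4 \<mu> \<nu> * a_gl4 \<alpha> \<beta>
        + (\<Sum>c\<in>I34. \<Sum>d\<in>I34. (\<i> / 2 * theta_ext \<theta> \<mu> \<alpha> c d) *\<^sub>C (a_gl4 c \<nu> * a_gl4 d \<beta>)))
    \<and> (\<forall>\<mu>\<in>I34. \<forall>\<nu>\<in>I34. \<forall>\<alpha>\<in>I12. \<forall>\<beta>\<in>I34.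
        a_gl4 \<mu> \<nu> \<bullet>\<^bsub>\<theta>\<^esub> a_gl4 \<alpha> \<beta> =
        a_gl4 \<mu> \<nu> * a_gl4 \<alpha> \<beta>
        - (\<Sum>c\<in>I12. \<Sum>d\<in>I12. (\<i> / 2 * theta_ext \<theta> c d \<nu> \<beta>) *\<^sub>C (a_gl4 \<mu> c * a_gl4 \<alpha> d)))
    \<and> (\<forall>\<mu>\<in>I12. \<forall>\<nu>\<in>I34. \<forall>\<alpha>\<in>I34. \<forall>\<beta>\<in>I34.
        a_gl4 \<mu> \<nu> \<bullet>\<^bsub>\<theta>\<^esub> a_gl4 \<alpha> \<beta> =
        a_gl4 \<mu> \<nu> * a_gl4 \<alpha> \<beta>
        - (\<Sum>c\<in>I12. \<Sum>d\<in>I12. (\<i> / 2 * theta_ext \<theta> c d \<nu> \<beta>) *\<^sub>C (a_gl4 \<mu> c * a_gl4 \<alpha> d)))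
    \<and> (\<forall>\<mu>\<in>I12. \<forall>\<nu>\<in>I12. \<forall>\<alpha>\<in>I12. \<forall>\<beta>\<in>I12.
        a_gl4 \<mu> \<nu> \<bullet>\<^bsub>\<theta>\<^esub> a_gl4 \<alpha> \<beta> =
        a_gl4 \<mu> \<nu> * a_gl4 \<alpha> \<beta>
        + (\<Sum>c\<in>I34. \<Sum>d\<in>I34. (\<i> / 2 * theta_ext \<theta> \<mu> \<alpha> c d) *\<^sub>C (a_gl4 c \<nu> * a_gl4 d \<beta>)))
    \<and> (\<forall>\<mu>\<in>I34. \<forall>\<nu>\<in>I34. \<forall>\<alpha>\<in>I34. \<forall>\<beta>\<in>I34.
        a_gl4 \<mu> \<nu> \<bullet>\<^bsub>\<theta>\<^esub> a_gl4 \<alpha> \<beta> =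
        a_gl4 \<mu> \<nu> * a_gl4 \<alpha> \<beta>
        - (\<Sum>c\<in>I12. \<Sum>d\<in>I12. (\<i> / 2 * theta_ext \<theta> c d \<nu> \<beta>) *\<^sub>C (a_gl4 \<mu> c * a_gl4 \<alpha> d)))
    \<and> (\<forall>\<mu>\<in>I12. \<forall>\<nu>\<in>I12. \<forall>\<alpha>\<in>I34. \<forall>\<beta>\<in>I34.
        a_gl4 \<mu> \<nu> \<bullet>\<^bsub>\<theta>\<^esub> a_gl4 \<alpha> \<beta> =
        a_gl4 \<mu> \<nu> * a_gl4 \<alpha> \<beta>)
    \<and> (\<forall>\<mu>\<in>I34. \<forall>\<nu>\<in>I34. \<forall>\<alpha>\<in>I12. \<forall>\<beta>\<in>I12.
        a_gl4 \<mu> \<nu> \<bullet>\<^bsub>\<theta>\<^esub> a_gl4 \<alpha> \<beta> =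
        a_gl4 \<mu> \<nu> * a_gl4 \<alpha> \<beta>)
    \<and> (\<forall>\<mu>\<in>I12. \<forall>\<nu>\<in>I12. \<forall>\<alpha>\<in>I34. \<forall>\<beta>\<in>I12.
        a_gl4 \<mu> \<nu> \<bullet>\<^bsub>\<theta>\<^esub> a_gl4 \<alpha> \<beta> =
        a_gl4 \<mu> \<nu> * a_gl4 \<alpha> \<beta>)
    \<and> (\<forall>\<mu>\<in>I34. \<forall>\<nu>\<in>I12. \<forall>\<alpha>\<in>I12. \<forall>\<beta>\<in>I12.
        a_gl4 \<mu> \<nu> \<bullet>\<^bsub>\<theta>\<^esub> a_gl4 \<alpha> \<beta> =
        a_gl4 \<mu> \<nu> * a_gl4 \<alpha> \<beta>)
    \<and> (\<forall>\<mu>\<in>I34. \<forall>\<nu>\<in>I34. \<forall>\<alpha>\<in>I34. \<forall>\<beta>\<in>I12.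
        a_gl4 \<mu> \<nu> \<bullet>\<^bsub>\<theta>\<^esub> a_gl4 \<alpha> \<beta> =
        a_gl4 \<mu> \<nu> * a_gl4 \<alpha> \<beta>)
    \<and> (\<forall>\<mu>\<in>I34. \<forall>\<nu>\<in>I12. \<forall>\<alpha>\<in>I34. \<forall>\<beta>\<in>I34.
        a_gl4 \<mu> \<nu> \<bullet>\<^bsub>\<theta>\<^esub> a_gl4 \<alpha> \<beta> =
        a_gl4 \<mu> \<nu> * a_gl4 \<alpha> \<beta>)
    \<and> (\<forall>\<mu>\<in>I12. \<forall>\<nu>\<in>I34. \<forall>\<alpha>\<in>I34. \<forall>\<beta>\<in>I12.
        a_gl4 \<mu> \<nu> \<bullet>\<^bsub>\<theta>\<^esub> a_gl4 \<alpha> \<beta> =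
        a_gl4 \<mu> \<nu> * a_gl4 \<alpha> \<beta>)
    \<and> (\<forall>\<mu>\<in>I34. \<forall>\<nu>\<in>I12. \<forall>\<alpha>\<in>I12. \<forall>\<beta>\<in>I34.
        a_gl4 \<mu> \<nu> \<bullet>\<^bsub>\<theta>\<^esub> a_gl4 \<alpha> \<beta> =
        a_gl4 \<mu> \<nu> * a_gl4 \<alpha> \<beta>)
    \<and> (\<forall>\<mu>\<in>I34. \<forall>\<nu>\<in>I12. \<forall>\<alpha>\<in>I34. \<forall>\<beta>\<in>I12.
        a_gl4 \<mu> \<nu> \<bullet>\<^bsub>\<theta>\<^esub> a_gl4 \<alpha> \<beta> =
        a_gl4 \<mu> \<nu> * a_gl4 \<alpha> \<beta>)
    \<and> (\<forall>\<mu> \<nu>. twisted_antipode \<theta> (a_gl4 \<mu> \<nu>) = antipode (a_gl4 \<mu> \<nu>))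
    \<and> (\<forall>\<mu> \<nu>. twisted_comult \<theta> (a_gl4 \<mu> \<nu>) = (\<Sum>\<alpha>\<in>UNIV. a_gl4 \<mu> \<alpha> \<otimes> a_gl4 \<alpha> \<nu>))
    \<and> (\<forall>\<mu>\<in>I12. \<forall>\<nu>\<in>I12. \<forall>\<alpha>\<in>I12. \<forall>\<beta>\<in>I12.
        twisted_comm \<theta> (a_gl4 \<mu> \<nu>) (a_gl4 \<alpha> \<beta>) =
        (\<Sum>c\<in>I34. \<Sum>d\<in>I34. (\<i> * theta_minus \<theta> \<mu> \<alpha> c d) *\<^sub>C (a_gl4 c \<nu> \<bullet>\<^bsub>\<theta>\<^esub> a_gl4 d \<beta>)))
    \<and> (\<forall>\<mu>\<in>I34. \<forall>\<nu>\<in>I34. \<forall>\<alpha>\<in>I34. \<forall>\<beta>\<in>I34.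
        twisted_comm \<theta> (a_gl4 \<mu> \<nu>) (a_gl4 \<alpha> \<beta>) =
        - (\<Sum>c\<in>I12. \<Sum>d\<in>I12. (\<i> * theta_minus \<theta> c d \<nu> \<beta>) *\<^sub>C (a_gl4 \<alpha> d \<bullet>\<^bsub>\<theta>\<^esub> a_gl4 \<mu> c)))
    \<and> (\<forall>\<mu>\<in>I12. \<forall>\<nu>\<in>I12. \<forall>\<alpha>\<in>I12. \<forall>\<beta>\<in>I34.
        twisted_comm \<theta> (a_gl4 \<mu> \<nu>) (a_gl4 \<alpha> \<beta>) =
        (\<Sum>c\<in>I34. \<Sum>d\<in>I34. (\<i> * theta_minus \<theta> \<mu> \<alpha> c d) *\<^sub>C (a_gl4 c \<nu> \<bullet>\<^bsub>\<theta>\<^esub> a_gl4 d \<beta>)))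
    \<and> (\<forall>\<mu>\<in>I34. \<forall>\<nu>\<in>I34. \<forall>\<alpha>\<in>I12. \<forall>\<beta>\<in>I34.
        twisted_comm \<theta> (a_gl4 \<mu> \<nu>) (a_gl4 \<alpha> \<beta>) =
        - (\<Sum>c\<in>I12. \<Sum>d\<in>I12. (\<i> * theta_minus \<theta> c d \<nu> \<beta>) *\<^sub>C (a_gl4 \<alpha> d \<bullet>\<^bsub>\<theta>\<^esub> a_gl4 \<mu> c)))
    \<and> (\<forall>\<mu>\<in>I12. \<forall>\<nu>\<in>I34. \<forall>\<alpha>\<in>I12. \<forall>\<beta>\<in>I34.
        twisted_comm \<theta> (a_gl4 \<mu> \<nu>) (a_gl4 \<alpha> \<beta>) =
        (\<Sum>c\<in>I34. \<Sum>d\<in>I34. (\<i> * theta_minus \<theta> \<mu> \<alpha> c d) *\<^sub>C (a_gl4 c \<nu> \<bullet>\<^bsub>\<theta>\<^esub> a_gl4 d \<beta>))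
        - (\<Sum>c\<in>I12. \<Sum>d\<in>I12. (\<i> * theta_minus \<theta> c d \<nu> \<beta>) *\<^sub>C (a_gl4 \<alpha> d \<bullet>\<^bsub>\<theta>\<^esub> a_gl4 \<mu> c)))
    \<and> (\<forall>\<mu>\<in>I12. \<forall>\<nu>\<in>I12. \<forall>\<alpha>\<in>I34. \<forall>\<beta>\<in>I34.
        twisted_comm \<theta> (a_gl4 \<mu> \<nu>) (a_gl4 \<alpha> \<beta>) = 0)
    \<and> (\<forall>\<mu>\<in>I12. \<forall>\<nu>\<in>I12. \<forall>\<alpha>\<in>I34. \<forall>\<beta>\<in>I12.
        twisted_comm \<theta> (a_gl4 \<mu> \<nu>) (a_gl4 \<alpha> \<beta>) = 0)
    \<and> (\<forall>\<mu>\<in>I34. \<forall>\<nu>\<in>I34. \<forall>\<alpha>\<in>I34. \<forall>\<beta>\<in>I12.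
        twisted_comm \<theta> (a_gl4 \<mu> \<nu>) (a_gl4 \<alpha> \<beta>) = 0)
    \<and> (\<forall>\<mu>\<in>I12. \<forall>\<nu>\<in>I34. \<forall>\<alpha>\<in>I34. \<forall>\<beta>\<in>I12.
        twisted_comm \<theta> (a_gl4 \<mu> \<nu>) (a_gl4 \<alpha> \<beta>) = 0)
    \<and> (\<forall>\<mu>\<in>I34. \<forall>\<nu>\<in>I12. \<forall>\<alpha>\<in>I34. \<forall>\<beta>\<in>I12.
        twisted_comm \<theta> (a_gl4 \<mu> \<nu>) (a_gl4 \<alpha> \<beta>) = 0)
    \<and> (\<exists>D :: gl4_gen free_algebra.
        (\<forall>w\<in>Poly_Mapping.keys D. Det_Inv \<notin> set (letters w)) \<and>
        free_algebra_map (\<lambda>h g. h \<bullet>\<^bsub>\<theta>\<^esub> g) gl4_gen_elem D = det (\<chi> \<mu> \<nu>. a_gl4 \<mu> \<nu>) \<and>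
        presented_by (\<lambda>h g. h \<bullet>\<^bsub>\<theta>\<^esub> g) gl4_gen_elem
          (gl4_relations \<theta> \<union> {D * letter Det_Inv - 1, letter Det_Inv * D - 1}))"
proof -
  note terms = row_term_def[symmetric] col_term_def[symmetric] mixed_term_def[symmetric]
    index_disjoint simp_thms
  \<comment> \<open>The determinant to be inverted is the classical one, rewritten as a twisted
    polynomial in the entries; this is possible because it lies in
    \<open>entry_algebra\<close>.\<close>
  obtain D where D: "D \<in> wspan entry_words" "quantum_map \<theta> D = det a_matrix"
    using entry_algebra_range[of \<theta>] entry_algebra_det by force
  have presentation: "\<exists>D :: gl4_gen free_algebra.
      (\<forall>w\<in>Poly_Mapping.keys D. Det_Inv \<notin> set (letters w)) \<and>
      free_algebra_map (\<lambda>h g. h \<bullet>\<^bsub>\<theta>\<^esub> g) gl4_gen_elem D = det (\<chi> \<mu> \<nu>. a_gl4 \<mu> \<nu>) \<and>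
      presented_by (\<lambda>h g. h \<bullet>\<^bsub>\<theta>\<^esub> g) gl4_gen_elem
        (gl4_relations \<theta> \<union> {D * letter Det_Inv - 1, letter Det_Inv * D - 1})"
    using D gl4_presentation[OF D]
    by (intro exI[of _ D]) (simp add: wspan_def entry_words_def quantum_map_def a_matrix_def)
  show ?thesis
    apply (intro conjI ballI allI)
    subgoal by (simp only: twisted_mult_gens terms)
    subgoal by (simp only: twisted_gens_row terms)
    subgoal by (simp only: twisted_gens_row terms)
    subgoal by (simp only: twisted_gens_col terms)
    subgoal by (simp only: twisted_gens_col terms)
    subgoal by (simp only: twisted_gens_row terms)
    subgoal by (simp only: twisted_gens_col terms)
    apply ((simp only: twisted_gens_plain terms)+)[9]
    subgoal by (rule twisted_antipode_a)
    subgoal by (simp only: twisted_comult_def comult_gens)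
    subgoal by (rule twisted_comm_row) blast
    subgoal by (rule twisted_comm_col) blast
    subgoal by (rule twisted_comm_row) blast
    subgoal by (rule twisted_comm_col) blast
    subgoal by (rule twisted_comm_row_col)
    subgoal by (rule twisted_comm_zero) blast+
    subgoal by (rule twisted_comm_zero) blast+
    subgoal by (rule twisted_comm_zero) blast+
    subgoal by (rule twisted_comm_zero) blast+
    subgoal by (rule twisted_comm_zero) blast+
    subgoal by (rule presentation)
    done
qed

end
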